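(* If $k\in\mathbb{N}=\{1,2,\ldots\}$, then there exist parameters $c>1$ and $p,q,r\ge0$ with $p+q+r=1$, $p+r>0$, $q+r>0$ such that $\mu^{(k)}\in ID$ and $\rho^{(k)}\in ID^0$.
   Context: For $k\in\mathbb{Z}$ and parameters $c,p,q,r$ as in the claim, let $\{(N_t^{(k)},L_t^{(k)}),t\ge0\}$ be the bivariate compound Poisson process (pure jump, no drift) with $E[e^{i(z_1N_t^{(k)}+z_2L_t^{(k)})}]=\exp[t\int_{\mathbb{R}^2}(e^{i(z_1x_1+z_2x_2)}-1)\nu^{(k)}(dx)]$, where $\nu^{(k)}$ is concentrated on the points $(1,0)$, $(0,1)$, $(1,c^{-k})$ with masses $u,v,w\ge0$ respectively, and $p=u/(u+v+w)$, $q=v/(u+v+w)$, $r=w/(u+v+w)$. Let $T$ be the first jump time of $\{N_t^{(k)}\}$. Define $\rho^{(k)}$ as the distribution of $L_T^{(k)}$, and $\mu^{(k)}$ as the distribution of $\int_0^{\infty-}c^{-N^{(k)}_{s-}}\,dL_s^{(k)}$ (the almost sure limit of $\int_0^t$ as $t\to\infty$, which exists). These depend on $u,v,w$ only through $p,q,r$. A distribution $\sigma$ on $\mathbb{R}$ is quasi-infinitely divisible if its characteristic function is $\widehat\sigma(z)=\exp[i\gamma z-az^2+\int_{\mathbb{R}}(e^{izx}-1-izx1_{[-1,1]}(x))\,\nu_\sigma(dx)]$, where $\gamma,a\in\mathbb{R}$ and $\nu_\sigma$ is a signed measure (a difference $\nu_\sigma^+-\nu_\sigma^-$ of mutually singular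 measures, possibly both of infinite mass near $0$) with total variation measure $|\nu_\sigma|$ satisfying $\nu_\sigma(\{0\})=0$ and $\int(x^2\wedge1)\,|\nu_\sigma|(dx)<\infty$. $ID$ is the class of infinitely divisible distributions on $\mathbb{R}$; $ID^0$ is the class of quasi-infinitely divisible distributions that are not infinitely divisible. *)

theory Defs
  imports "HOL-Probability.Probability"
begin

section \<open>Levy processes and the bivariate compound Poisson process\<close>

definition cadlag :: "(real \<Rightarrow> 'b::topological_space) \<Rightarrow> bool" where
  "cadlag f \<longleftrightarrow>
     (\<forall>t\<ge>0. (f \<longlongrightarrow> f t) (at_right t)) \<and>
     (\<forall>t>0. \<exists>l. (f \<longlongrightarrow> l) (at_left t))"

text \<open>Processes are indexed by \<^typ>\<open>real\<close>, but only times \<open>t \<ge> 0\<close> matter.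
  Stochastic continuity is not listed: it follows from right-continuity of the paths and
  stationarity of the increments.\<close>

definition levy_process :: "'a measure \<Rightarrow> (real \<Rightarrow> 'a \<Rightarrow> 'b::euclidean_space) \<Rightarrow> bool" where
  "levy_process M X \<longleftrightarrow>
     prob_space M \<and>
     (\<forall>t\<ge>0. X t \<in> borel_measurable M) \<and>
     (AE \<omega> in M. X 0 \<omega> = 0) \<and>
     (\<forall>n (\<tau> :: nat \<Rightarrow> real). 0 \<le> \<tau> 0 \<and> (\<forall>i<n. \<tau> i \<le> \<tau> (Suc i)) \<longrightarrow>
        prob_space.indep_vars M (\<lambda>_. borel)
          (\<lambda>i \<omega>. X (\<tau> (Suc i)) \<omega> - X (\<tau> i) \<omega>) {..<n}) \<and>
     (\<forall>s\<ge>0. \<forall>t\<ge>0.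
        distr M borel (\<lambda>\<omega>. X (s + t) \<omega> - X s \<omega>) = distr M borel (X t)) \<and>
     (AE \<omega> in M. cadlag (\<lambda>t. X t \<omega>))"

definition nu :: "int \<Rightarrow> real \<Rightarrow> real \<Rightarrow> real \<Rightarrow> real \<Rightarrow> (real \<times> real) measure" where
  "nu k c u v w =
     distr (point_measure {(1, 0), (0, 1), (1, c powi (- k))}
             (\<lambda>x. if x = (1, 0) then ennreal u else if x = (0, 1) then ennreal v else ennreal w))
       borel (\<lambda>x. x)"

text \<open>The absence of drift and of a Gaussian part (hence the pure-jump property of the paths)
  is encoded in the characteristic function.\<close>

definition bivariate_compound_poisson ::
    "int \<Rightarrow> real \<Rightarrow> real \<Rightarrow> real \<Rightarrow> real \<Rightarrow> 'a measure \<Rightarrow>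
     (real \<Rightarrow> 'a \<Rightarrow> real) \<Rightarrow> (real \<Rightarrow> 'a \<Rightarrow> real) \<Rightarrow> bool" where
  "bivariate_compound_poisson k c u v w M N L \<longleftrightarrow>
     levy_process M (\<lambda>t \<omega>. (N t \<omega>, L t \<omega>)) \<and>
     (\<forall>t\<ge>0. \<forall>z1 z2.
        (CLINT \<omega>|M. iexp (z1 * N t \<omega> + z2 * L t \<omega>)) =
        exp (complex_of_real t *
          (CLINT x|nu k c u v w. (iexp (z1 * fst x + z2 * snd x) - 1))))"

section \<open>The distributions \<open>\<rho>\<close> and \<open>\<mu>\<close>\<close>

abbreviation left_lim :: "(real \<Rightarrow> real) \<Rightarrow> real \<Rightarrow> real" where
  "left_lim f t \<equiv> Lim (at_left t) f"

definition first_jump_time :: "(real \<Rightarrow> real) \<Rightarrow> real" where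
  "first_jump_time f = Inf {t. 0 < t \<and> left_lim f t \<noteq> f t}"

text \<open>The pathwise Lebesgue-Stieltjes integral of \<open>c\<close> to the power \<open>- n(s-)\<close> over \<open>(0, t]\<close>
  with respect to \<open>l\<close>, for right-continuous with left limits \<open>n\<close> and for \<open>l\<close> right-continuous and nondecreasing on
  \<open>[0, \<infinity>)\<close>, as the paths of \<open>L\<close> almost surely are (all jumps of \<open>L\<close> are positive).\<close>

definition stieltjes_integral :: "real \<Rightarrow> (real \<Rightarrow> real) \<Rightarrow> (real \<Rightarrow> real) \<Rightarrow> real \<Rightarrow> real" where
  "stieltjes_integral c n l t =
     (LINT s:{0<..t}|interval_measure (\<lambda>s. l (max 0 s)). c powr (- left_lim n s))"

definition rates :: "real \<Rightarrow> real \<Rightarrow> real \<Rightarrow> real \<Rightarrow> real \<Rightarrow> real \<Rightarrow> bool" where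
  "rates p q r u v w \<longleftrightarrow>
     0 \<le> u \<and> 0 \<le> v \<and> 0 \<le> w \<and> 0 < u + v + w \<and>
     p = u / (u + v + w) \<and> q = v / (u + v + w) \<and> r = w / (u + v + w)"

text \<open>The law of a random variable that is only determined almost surely by the paths is the
  distribution of any measurable version. The two predicates below hold for any realisation of
  the process on a probability space over \<^typ>\<open>'a\<close> and for any admissible \<open>u\<close>, \<open>v\<close>, \<open>w\<close>.\<close>

definition is_rho_law ::
    "'a itself \<Rightarrow> int \<Rightarrow> real \<Rightarrow> real \<Rightarrow> real \<Rightarrow> real \<Rightarrow> real measure \<Rightarrow> bool" where
  "is_rho_law _ k c p q r \<sigma> \<longleftrightarrow>
     (\<exists>u v w (M :: 'a measure) N L Y.
        rates p q r u v w \<and> bivariate_compound_poisson k c u v w M N L \<and>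
        Y \<in> borel_measurable M \<and>
        (AE \<omega> in M. Y \<omega> = L (first_jump_time (\<lambda>t. N t \<omega>)) \<omega>) \<and>
        \<sigma> = distr M borel Y)"

definition is_mu_law ::
    "'a itself \<Rightarrow> int \<Rightarrow> real \<Rightarrow> real \<Rightarrow> real \<Rightarrow> real \<Rightarrow> real measure \<Rightarrow> bool" where
  "is_mu_law _ k c p q r \<sigma> \<longleftrightarrow>
     (\<exists>u v w (M :: 'a measure) N L Z.
        rates p q r u v w \<and> bivariate_compound_poisson k c u v w M N L \<and>
        Z \<in> borel_measurable M \<and>
        (AE \<omega> in M. ((\<lambda>t. stieltjes_integral c (\<lambda>s. N s \<omega>) (\<lambda>s. L s \<omega>) t) \<longlongrightarrow> Z \<omega>) at_top) \<and>
        \<sigma> = distr M borel Z)"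

text \<open>The laws do not depend on the realisation nor on \<open>u\<close>, \<open>v\<close>, \<open>w\<close> (given \<open>p\<close>, \<open>q\<close>, \<open>r\<close>).
  The sample type \<^typ>\<open>nat \<Rightarrow> real\<close> is fixed only because the definitions must not depend
  on a type parameter; it is rich enough to carry the process, so that the descriptions below
  are proper.\<close>

definition rho :: "int \<Rightarrow> real \<Rightarrow> real \<Rightarrow> real \<Rightarrow> real \<Rightarrow> real measure" where
  "rho k c p q r = (THE \<sigma>. is_rho_law TYPE(nat \<Rightarrow> real) k c p q r \<sigma>)"

definition mu :: "int \<Rightarrow> real \<Rightarrow> real \<Rightarrow> real \<Rightarrow> real \<Rightarrow> real measure" where
  "mu k c p q r = (THE \<sigma>. is_mu_law TYPE(nat \<Rightarrow> real) k c p q r \<sigma>)"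

section \<open>Infinite and quasi-infinite divisibility\<close>

primrec convolution_power :: "real measure \<Rightarrow> nat \<Rightarrow> real measure" where
  "convolution_power \<sigma> 0 = return borel 0"
| "convolution_power \<sigma> (Suc n) = (\<sigma> \<star> convolution_power \<sigma> n)"

definition ID :: "real measure set" where
  "ID = {\<sigma>. real_distribution \<sigma> \<and>
            (\<forall>n\<ge>1. \<exists>\<eta>. real_distribution \<eta> \<and> \<sigma> = convolution_power \<eta> n)}"

text \<open>The signed measure is represented by its Jordan decomposition \<open>\<nu>p - \<nu>m\<close>, since it need
  not be defined on sets near \<open>0\<close>; its total variation is \<open>\<nu>p + \<nu>m\<close>.\<close>

definition signed_levy_measure :: "real measure \<Rightarrow> real measure \<Rightarrow> bool" where
  "signed_levy_measure \<nu>p \<nu>m \<longleftrightarrow>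
     sets \<nu>p = sets borel \<and> sets \<nu>m = sets borel \<and>
     (\<exists>A\<in>sets borel. emeasure \<nu>p A = 0 \<and> emeasure \<nu>m (- A) = 0) \<and>
     emeasure \<nu>p {0} = 0 \<and> emeasure \<nu>m {0} = 0 \<and>
     (\<integral>\<^sup>+x. ennreal (min (x\<^sup>2) 1) \<partial>\<nu>p) + (\<integral>\<^sup>+x. ennreal (min (x\<^sup>2) 1) \<partial>\<nu>m) < \<infinity>"

definition levy_khintchine_integrand :: "real \<Rightarrow> real \<Rightarrow> complex" where
  "levy_khintchine_integrand z x =
     iexp (z * x) - 1 - \<i> * complex_of_real (z * x * indicator {-1..1} x)"

definition quasi_ID :: "real measure set" where
  "quasi_ID = {\<sigma>. real_distribution \<sigma> \<and>
     (\<exists>(\<gamma>::real) (a::real) \<nu>p \<nu>m. signed_levy_measure \<nu>p \<nu>m \<and>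
        (\<forall>z. char \<sigma> z =
           exp (\<i> * complex_of_real (\<gamma> * z) - complex_of_real (a * z\<^sup>2) +
                ((CLINT x|\<nu>p. levy_khintchine_integrand z x) -
                 (CLINT x|\<nu>m. levy_khintchine_integrand z x)))))}"

definition ID0 :: "real measure set" where
  "ID0 = quasi_ID - ID"

end

theory Submission
  imports Defs
begin

text \<open>With \<open>a = c powi (- k)\<close>, the characteristic functions satisfy
  \<open>char \<rho> z = (p + r * iexp (a * z)) / (1 - q * iexp z)\<close> and \<open>char \<mu> z = char \<rho> z * char \<mu> (z / c)\<close>. For
  \<open>r = p q\<close> the factor \<open>p + r * iexp (a * z)\<close> contributes a signed measure of jumps to \<open>\<rho>\<close>; in the
  infinite product \<open>\<mu>\<close> its negative part is compensated by the geometric factor \<open>1 / (1 - q * iexp z)\<close>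
  taken \<open>k\<close> scales further down, so \<open>\<mu>\<close> is infinitely divisible for all \<open>k \<ge> 1\<close>. With \<open>c ^ k = 3\<close>, \<open>\<rho>\<close>
  lives on \<open>\<nat> \<union> (\<nat> + 1 / 3)\<close>, has atoms at \<open>0\<close> and \<open>1 / 3\<close> but none at \<open>2 / 3\<close>, and hence no
  convolution square root.

  For an arbitrary realisation, both laws are obtained by discretising time with mesh \<open>h = 2 ^ (- m)\<close>.
  The defect is \<open>O(h\<^sup>2)\<close> per step, because the joint characteristic function at the frequencies \<open>0\<close> and
  \<open>pi\<close> of \<open>N h\<close> separates the events \<open>N h = 0\<close> and \<open>N h = 1\<close> up to \<open>P (N h \<ge> 2) = O(h\<^sup>2)\<close>. A
  realisation is built from independent blocks of Poisson many uniform points.\<close>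

section \<open>Exponents of subordinators\<close>

text \<open>\<open>rho\<close> and \<open>mu\<close> are defined by \<open>THE\<close> over all
  realisations on \<open>nat \<Rightarrow> real\<close>, so for each of them one realisation must
  exist and all realisations must share one law. A realisation is known only through its
  characteristic functions, its independent stationary increments and its cadlag paths; jump times
  and jump sizes are not given. Laws are therefore never computed from jumps. For \<mu> the route is
  verification: a solution of the functional equation is built as \<open>exp\<close> of
  \<open>mu_exponent\<close> and then shown to be the characteristic function of the integral, using
  only that it is measurable, bounded by \<open>1\<close> and Lipschitz at \<open>0\<close>.

  The choice \<open>r = p * q\<close> turns \<open>p + r * iexp y\<close> into
  \<open>p * (1 + q * iexp y)\<close>, so the parameter \<open>q\<close> of the geometric factor
  returns with the opposite sign. The weights \<open>q ^ n / n\<close> and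
  \<open>- ((- q) ^ n) / n\<close> add up to nonnegative numbers once they sit at the same scale.
  Together with \<open>p + q + r = 1\<close> this forces \<open>p = (1 - q) / (1 + q)\<close>;
  \<open>q = 1 / 2\<close> is one convenient value. With \<open>c ^ k = 3\<close> both families of
  jumps of \<rho> lie on the multiples of \<open>1 / 3\<close>.\<close>

lemma sums_measure_pmf_nat:
  fixes f :: "nat \<Rightarrow> 'b::{banach, second_countable_topology}"
  assumes "\<And>n. norm (f n) \<le> B"
  shows "(\<lambda>n. pmf p n *\<^sub>R f n) sums (\<integral>n. f n \<partial>measure_pmf p)"
proof -
  have "integrable (measure_pmf p) f"
    using assms by (intro measure_pmf.integrable_const_bound[where B=B]) auto
  then have "integrable (count_space UNIV) (\<lambda>n. pmf p n *\<^sub>R f n)"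
    by (simp add: measure_pmf_eq_density integrable_density)
  moreover have "(\<integral>n. f n \<partial>measure_pmf p) = (\<integral>n. pmf p n *\<^sub>R f n \<partial>count_space UNIV)"
    by (simp add: measure_pmf_eq_density integral_density)
  ultimately show ?thesis
    using sums_integral_count_space_nat by metis
qed

lemma poisson_exp_sums:
  fixes y :: complex
  assumes "0 < r"
  shows "(\<lambda>n. pmf (poisson_pmf r) n *\<^sub>R y ^ n) sums exp (of_real r * (y - 1))"
proof -
  have "(\<lambda>n. exp (- of_real r) * ((of_real r * y) ^ n /\<^sub>R fact n)) sums
      (exp (- of_real r) * exp (of_real r * y))"
    by (intro sums_mult exp_converges)
  moreover have "exp (- of_real r) * ((of_real r * y) ^ n /\<^sub>R fact n) = pmf (poisson_pmf r) n *\<^sub>R y ^ n" for n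
    using assms by (simp add: scaleR_conv_of_real power_mult_distrib divide_inverse flip: exp_of_real)
  ultimately show ?thesis by (simp add: algebra_simps flip: exp_add)
qed

lemma poisson_mean:
  assumes "0 < r"
  shows "(\<integral>\<^sup>+n. ennreal (real n) \<partial>measure_pmf (poisson_pmf r)) = ennreal r"
proof -
  have "(\<lambda>n. r ^ Suc n / fact n * exp (- r)) sums (exp r * (r * exp (- r)))"
    using sums_mult2[OF exp_converges[of r], of "r * exp (- r)"]
    by (simp add: field_simps)
  moreover have "pmf (poisson_pmf r) (Suc n) * real (Suc n) = r ^ Suc n / fact n * exp (- r)" for n
  proof -
    have "fact (Suc n) = real (Suc n) * fact n" by simp
    then show ?thesis using assms by (simp del: fact_Suc of_nat_Suc)
  qed
  moreover have "exp r * (r * exp (- r)) = r" by (simp flip: exp_add)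
  ultimately have "(\<lambda>n. pmf (poisson_pmf r) (Suc n) * real (Suc n)) sums r" by simp
  then have s: "(\<lambda>n. pmf (poisson_pmf r) n * real n) sums r"
    by (subst (asm) sums_Suc_iff) simp
  have "(\<integral>\<^sup>+n. ennreal (real n) \<partial>measure_pmf (poisson_pmf r))
     = (\<Sum>n. ennreal (pmf (poisson_pmf r) n * real n))"
    by (simp add: measure_pmf_eq_density nn_integral_density nn_integral_count_space_nat ennreal_mult)
  also have "\<dots> = ennreal r"
    using s by (intro suminf_ennreal_eq) auto
  finally show ?thesis .
qed

lemma char_poisson:
  assumes r: "0 < r"
  shows "char (distr (measure_pmf (poisson_pmf r)) borel (\<lambda>n. real n * x)) z = exp (of_real r * (iexp (z * x) - 1))"
proof -
  let ?p = "measure_pmf (poisson_pmf r)"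
  have "iexp (z * (real n * x)) = iexp (z * x) ^ n" for n
    by (simp add: exp_of_nat_mult[symmetric] mult_ac)
  then have "char (distr ?p borel (\<lambda>n. real n * x)) z = (\<integral>n. (iexp (z * x)) ^ n \<partial>?p)"
    unfolding char_def by (subst integral_distr) (auto simp del: of_real_mult)
  also have "\<dots> = exp (of_real r * (iexp (z * x) - 1))"
    using sums_measure_pmf_nat[of "\<lambda>n. (iexp (z * x)) ^ n" 1 "poisson_pmf r"]
      poisson_exp_sums[OF r, of "iexp (z * x)"]
    by (intro sums_unique2[rotated]) (auto simp: norm_power simp del: of_real_mult)
  finally show ?thesis .
qed

lemma norm_iexp_minus_one_le: "cmod (iexp x - 1) \<le> \<bar>x\<bar>"
  using iexp_approx1[of x 0] by simp

text \<open>A convolution semigroup on the half line, indexed by \<open>s\<close>, with mean at most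
  \<open>s * m\<close>. Its members at \<open>s = 1 / n\<close> serve as convolution roots. The
  bound on the mean makes infinite sums of such variables converge almost surely, and the linear
  bound on \<Phi> makes the sum of the exponents converge.\<close>

definition subordinator_exponent :: "(real \<Rightarrow> complex) \<Rightarrow> real \<Rightarrow> bool" where
  "subordinator_exponent \<Phi> m \<longleftrightarrow> 0 \<le> m \<and> (\<forall>z. cmod (\<Phi> z) \<le> m * \<bar>z\<bar>) \<and>
     (\<forall>s\<ge>0. \<exists>D. real_distribution D \<and> (AE x in D. 0 \<le> x) \<and>
        (\<integral>\<^sup>+x. ennreal x \<partial>D) \<le> ennreal (s * m) \<and> (\<forall>z. char D z = exp (of_real s * \<Phi> z)))"

lemma subordinator_exponent_poisson:
  assumes "0 \<le> l" "0 \<le> x"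
  shows "subordinator_exponent (\<lambda>z. of_real l * (iexp (z * x) - 1)) (l * x)"
  unfolding subordinator_exponent_def
proof (intro conjI allI impI)
  show "0 \<le> l * x" using assms by simp
  fix z
  have "cmod (of_real l * (iexp (z * x) - 1)) = l * cmod (iexp (z * x) - 1)"
    using assms by (simp add: norm_mult)
  also have "\<dots> \<le> l * \<bar>z * x\<bar>"
    using assms by (intro mult_left_mono norm_iexp_minus_one_le)
  finally show "cmod (of_real l * (iexp (z * x) - 1)) \<le> l * x * \<bar>z\<bar>"
    using assms by (simp add: abs_mult mult_ac)
next
  fix s :: real assume s: "0 \<le> s"
  show "\<exists>D. real_distribution D \<and> (AE x in D. 0 \<le> x) \<and>
        (\<integral>\<^sup>+x. ennreal x \<partial>D) \<le> ennreal (s * (l * x)) \<and>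
        (\<forall>z. char D z = exp (of_real s * (of_real l * (iexp (z * x) - 1))))"
  \<comment> \<open>\<open>char_poisson\<close> and \<open>poisson_mean\<close> ask for a positive
    rate; rate \<open>0\<close> is the point mass at \<open>0\<close>.\<close>
  proof (cases "s * l = 0")
    case True
    interpret D: prob_space "return borel (0::real)" by (intro prob_space_return) simp
    have "real_distribution (return borel (0::real))" by standard auto
    moreover have "char (return borel (0::real)) z = exp (of_real s * (of_real l * (iexp (z * x) - 1)))" for z
    proof -
      have "of_real s * (of_real l * (iexp (z * x) - 1)) = 0" using True by auto
      then show ?thesis by (simp only:) (simp add: char_def integral_return)
    qed
    ultimately show ?thesis
      using assms s by (intro exI[of _ "return borel 0"]) (auto simp: AE_return nn_integral_return)
  next
    case False
    define r where "r = s * l"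
    have r: "0 < r" using False assms s by (simp add: r_def less_le)
    let ?p = "measure_pmf (poisson_pmf r)"
    define D where "D = distr ?p borel (\<lambda>n. real n * x)"
    have "real_distribution D"
      unfolding D_def by (intro prob_space.real_distribution_distr prob_space_measure_pmf) simp
    moreover have "AE x in D. 0 \<le> x"
      unfolding D_def using assms by (subst AE_distr_iff) auto
    moreover have "(\<integral>\<^sup>+x. ennreal x \<partial>D) \<le> ennreal (s * (l * x))"
    proof -
      have "(\<integral>\<^sup>+x. ennreal x \<partial>D) = (\<integral>\<^sup>+n. ennreal (real n) * ennreal x \<partial>?p)"
        unfolding D_def using assms by (subst nn_integral_distr) (auto simp: ennreal_mult)
      also have "\<dots> = ennreal r * ennreal x"
        using poisson_mean[OF r] by (subst nn_integral_multc) auto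
      also have "\<dots> = ennreal (s * (l * x))"
        using r assms by (simp add: r_def ennreal_mult'[symmetric] mult_ac)
      finally show ?thesis by simp
    qed
    moreover have "char D z = exp (of_real s * (of_real l * (iexp (z * x) - 1)))" for z
    proof -
      have "char D z = exp (of_real r * (iexp (z * x) - 1))"
        unfolding D_def using char_poisson[OF r] .
      then show ?thesis by (simp add: r_def mult_ac)
    qed
    ultimately show ?thesis by blast
  qed
qed

lemma subordinator_exponent_scale:
  assumes "subordinator_exponent \<Phi> m" "0 \<le> b"
  shows "subordinator_exponent (\<lambda>z. \<Phi> (b * z)) (b * m)"
  unfolding subordinator_exponent_def
proof (intro conjI allI impI)
  show "0 \<le> b * m" using assms by (auto simp: subordinator_exponent_def)
  show "cmod (\<Phi> (b * z)) \<le> b * m * \<bar>z\<bar>" for z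
    using assms unfolding subordinator_exponent_def by (metis abs_mult abs_of_nonneg mult.assoc mult.commute)
  fix s :: real assume s: "0 \<le> s"
  with assms obtain D where D: "real_distribution D" "AE x in D. 0 \<le> x"
        "(\<integral>\<^sup>+x. ennreal x \<partial>D) \<le> ennreal (s * m)" "\<And>z. char D z = exp (of_real s * \<Phi> z)"
    unfolding subordinator_exponent_def by meson
  interpret D: real_distribution D by fact
  have "real_distribution (distr D borel (\<lambda>x. b * x))"
    by (intro D.real_distribution_distr) simp
  moreover have "AE x in distr D borel (\<lambda>x. b * x). 0 \<le> x"
    using D(2) assms by (subst AE_distr_iff) auto
  moreover have "(\<integral>\<^sup>+x. ennreal x \<partial>distr D borel (\<lambda>x. b * x)) \<le> ennreal (s * (b * m))"
  proof -
    have "(\<integral>\<^sup>+x. ennreal x \<partial>distr D borel (\<lambda>x. b * x)) = (\<integral>\<^sup>+x. ennreal b * ennreal x \<partial>D)"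
      using assms by (subst nn_integral_distr) (auto simp: ennreal_mult')
    also have "\<dots> \<le> ennreal b * ennreal (s * m)"
      using D(3) by (subst nn_integral_cmult) (auto intro: mult_left_mono)
    finally show ?thesis using assms by (simp add: ennreal_mult'[symmetric] mult_ac)
  qed
  moreover have "char (distr D borel (\<lambda>x. b * x)) z = exp (of_real s * \<Phi> (b * z))" for z
    unfolding D(4)[symmetric] char_def by (subst integral_distr) (auto simp: mult_ac)
  ultimately show "\<exists>D. real_distribution D \<and> (AE x in D. 0 \<le> x) \<and>
        (\<integral>\<^sup>+x. ennreal x \<partial>D) \<le> ennreal (s * (b * m)) \<and>
        (\<forall>z. char D z = exp (of_real s * \<Phi> (b * z)))" by blast
qed

text \<open>Restriction to \<open>I\<close> is the identity on the product space, so the joint law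
  of the coordinates is the product measure itself.\<close>

lemma indep_vars_PiM_component:
  assumes "\<And>i. prob_space (D i)" "I \<noteq> {}"
  shows "prob_space.indep_vars (PiM I D) D (\<lambda>i \<omega>. \<omega> i) I"
proof -
  interpret prob_space "PiM I D" using assms by (intro prob_space_PiM)
  have "distr (PiM I D) (PiM I D) (\<lambda>x. \<lambda>i\<in>I. x i) = distr (PiM I D) (PiM I D) (\<lambda>x. x)"
    by (intro distr_cong) (auto simp: space_PiM)
  also have "\<dots> = PiM I (\<lambda>i. distr (PiM I D) (D i) (\<lambda>x. x i))"
    using assms by (subst distr_id) (intro PiM_cong refl distr_PiM_component[symmetric])
  finally show ?thesis
    using assms by (subst indep_vars_iff_distr_eq_PiM') auto
qed

text \<open>The laws with exponents \<open>s * \<Phi> i\<close> are placed on the independent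
  coordinates of a product space and the coordinates are added. They are nonnegative with summable
  means, so the expected total is finite and the series converges almost surely; dominated
  convergence then carries the characteristic functions of the partial sums to the limit.\<close>

lemma subordinator_exponent_suminf:
  assumes \<Phi>: "\<And>i. subordinator_exponent (\<Phi> i) (m i)" and m: "summable m"
  shows "subordinator_exponent (\<lambda>z. \<Sum>i. \<Phi> i z) (\<Sum>i. m i)"
  unfolding subordinator_exponent_def
proof (intro conjI allI impI)
  have m0: "0 \<le> m i" and b: "cmod (\<Phi> i z) \<le> m i * \<bar>z\<bar>" for i z
    using \<Phi>[of i] by (auto simp: subordinator_exponent_def)
  show "0 \<le> (\<Sum>i. m i)" using m m0 by (intro suminf_nonneg)
  have s\<Phi>: "summable (\<lambda>i. cmod (\<Phi> i z))" for z
    by (rule summable_comparison_test'[where g="\<lambda>i. m i * \<bar>z\<bar>"]) (auto intro: b summable_mult2 m)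
  show "cmod (\<Sum>i. \<Phi> i z) \<le> (\<Sum>i. m i) * \<bar>z\<bar>" for z
  proof -
    have "cmod (\<Sum>i. \<Phi> i z) \<le> (\<Sum>i. cmod (\<Phi> i z))" by (intro summable_norm s\<Phi>)
    also have "\<dots> \<le> (\<Sum>i. m i * \<bar>z\<bar>)" by (intro suminf_le b s\<Phi> summable_mult2 m)
    finally show ?thesis using m by (simp add: suminf_mult2)
  qed
  fix s :: real assume s: "0 \<le> s"
  have "\<exists>D. real_distribution D \<and> (AE x in D. 0 \<le> x) \<and> (\<integral>\<^sup>+x. ennreal x \<partial>D) \<le> ennreal (s * m i) \<and>
        (\<forall>z. char D z = exp (of_real s * \<Phi> i z))" for i
    using \<Phi>[of i] s unfolding subordinator_exponent_def by meson
  then obtain D where D: "\<And>i. real_distribution (D i)" "\<And>i. AE x in D i. 0 \<le> x"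
    "\<And>i. (\<integral>\<^sup>+x. ennreal x \<partial>D i) \<le> ennreal (s * m i)" "\<And>i z. char (D i) z = exp (of_real s * \<Phi> i z)"
    by metis
  interpret D: real_distribution "D i" for i by fact
  define P where "P = PiM UNIV D"
  interpret P: prob_space P unfolding P_def by (intro prob_space_PiM D.prob_space_axioms)
  have setsP: "sets P = sets (PiM UNIV (\<lambda>_. borel))" unfolding P_def by (intro sets_PiM_cong) auto
  have [measurable]: "(\<lambda>\<omega>. \<omega> i) \<in> borel_measurable P" for i
    by (subst measurable_cong_sets[OF setsP refl]) simp
  have comp: "distr P borel (\<lambda>\<omega>. \<omega> i) = D i" for i
  proof -
    have "distr P borel (\<lambda>\<omega>. \<omega> i) = distr P (D i) (\<lambda>\<omega>. \<omega> i)" by (intro distr_cong) auto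
    also have "\<dots> = D i" unfolding P_def by (intro distr_PiM_component D.prob_space_axioms) auto
    finally show ?thesis .
  qed
  have pos: "AE \<omega> in P. \<forall>i. 0 \<le> \<omega> i"
    unfolding AE_all_countable
  proof
    show "AE \<omega> in P. 0 \<le> \<omega> i" for i
      using D(2)[of i] unfolding comp[of i, symmetric] by (subst (asm) AE_distr_iff) auto
  qed
  have mean: "(\<integral>\<^sup>+\<omega>. ennreal (\<omega> i) \<partial>P) \<le> ennreal (s * m i)" for i
    using D(3)[of i] unfolding comp[of i, symmetric] by (subst (asm) nn_integral_distr) auto
  have total: "(\<integral>\<^sup>+\<omega>. (\<Sum>i. ennreal (\<omega> i)) \<partial>P) \<le> ennreal (s * (\<Sum>i. m i))"
  proof -
    have "(\<integral>\<^sup>+\<omega>. (\<Sum>i. ennreal (\<omega> i)) \<partial>P) = (\<Sum>i. \<integral>\<^sup>+\<omega>. ennreal (\<omega> i) \<partial>P)"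
      by (intro nn_integral_suminf) auto
    also have "\<dots> \<le> (\<Sum>i. ennreal (s * m i))" by (intro suminf_le mean) auto
    also have "\<dots> = ennreal (\<Sum>i. s * m i)"
      using m m0 s by (intro suminf_ennreal2) (auto intro: summable_mult)
    finally show ?thesis using m by (simp add: suminf_mult)
  qed
  have "AE \<omega> in P. (\<Sum>i. ennreal (\<omega> i)) \<noteq> \<infinity>"
    using total by (intro nn_integral_PInf_AE) (auto simp: top_unique)
  with pos have summ: "AE \<omega> in P. summable (\<lambda>i. \<omega> i)"
  proof eventually_elim
    case (elim \<omega>)
    then show ?case by (intro summable_suminf_not_top) auto
  qed
  define S where "S \<omega> = (\<Sum>i. \<omega> i)" for \<omega> :: "nat \<Rightarrow> real"
  have [measurable]: "S \<in> borel_measurable P" unfolding S_def by measurable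
  define R where "R = distr P borel S"
  have "real_distribution R" unfolding R_def by (intro P.real_distribution_distr) simp
  moreover have "AE x in R. 0 \<le> x"
    unfolding R_def using pos summ
    by (subst AE_distr_iff) (auto simp: S_def intro: suminf_nonneg)
  moreover have "(\<integral>\<^sup>+x. ennreal x \<partial>R) \<le> ennreal (s * (\<Sum>i. m i))"
  proof -
    have "(\<integral>\<^sup>+x. ennreal x \<partial>R) = (\<integral>\<^sup>+\<omega>. ennreal (S \<omega>) \<partial>P)"
      unfolding R_def by (subst nn_integral_distr) auto
    also have "\<dots> = (\<integral>\<^sup>+\<omega>. (\<Sum>i. ennreal (\<omega> i)) \<partial>P)"
      using pos summ by (intro nn_integral_cong_AE) (auto simp: S_def suminf_ennreal2)
    finally show ?thesis using total by simp
  qed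
  moreover have "char R z = exp (of_real s * (\<Sum>i. \<Phi> i z))" for z
  proof (rule LIMSEQ_unique)
    have "(\<lambda>n. CLINT \<omega>|P. iexp (z * (\<Sum>i<n. \<omega> i))) \<longlonglongrightarrow> (CLINT \<omega>|P. iexp (z * S \<omega>))"
    proof (rule integral_dominated_convergence[where w="\<lambda>_. 1"])
      show "AE \<omega> in P. (\<lambda>n. iexp (z * (\<Sum>i<n. \<omega> i))) \<longlonglongrightarrow> iexp (z * S \<omega>)"
        using summ
      proof eventually_elim
        case (elim \<omega>)
        then have "(\<lambda>n. \<Sum>i<n. \<omega> i) \<longlonglongrightarrow> S \<omega>" unfolding S_def by (rule summable_LIMSEQ)
        then show ?case by (intro tendsto_intros)
      qed
    qed (auto simp del: of_real_mult of_real_sum)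
    also have "(CLINT \<omega>|P. iexp (z * S \<omega>)) = char R z"
      unfolding R_def char_def by (subst integral_distr) auto
    finally show "(\<lambda>n. CLINT \<omega>|P. iexp (z * (\<Sum>i<n. \<omega> i))) \<longlonglongrightarrow> char R z" .
    have ind: "P.indep_vars (\<lambda>_. borel) (\<lambda>i \<omega>. \<omega> i) {..<n}" for n
    proof (rule P.indep_vars_subset)
      have "P.indep_vars D (\<lambda>i \<omega>. \<omega> i) UNIV"
        unfolding P_def by (intro indep_vars_PiM_component D.prob_space_axioms) auto
      from P.indep_vars_compose2[OF this, of "\<lambda>_ x. x" "\<lambda>_. borel"]
      show "P.indep_vars (\<lambda>_. borel) (\<lambda>i \<omega>. \<omega> i) UNIV" by simp
    qed auto
    have "(CLINT \<omega>|P. iexp (z * (\<Sum>i<n. \<omega> i))) = exp (of_real s * (\<Sum>i<n. \<Phi> i z))" for n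
    proof -
      have "(CLINT \<omega>|P. iexp (z * (\<Sum>i<n. \<omega> i))) = char (distr P borel (\<lambda>\<omega>. \<Sum>i<n. \<omega> i)) z"
        unfolding char_def by (subst integral_distr) auto
      also have "\<dots> = (\<Prod>i<n. char (D i) z)"
        by (subst P.char_distr_sum[OF ind]) (simp add: comp)
      finally show ?thesis by (simp add: D(4) exp_sum sum_distrib_left)
    qed
    moreover have "(\<lambda>n. exp (of_real s * (\<Sum>i<n. \<Phi> i z))) \<longlonglongrightarrow> exp (of_real s * (\<Sum>i. \<Phi> i z))"
      by (intro tendsto_intros summable_LIMSEQ summable_norm_cancel[OF s\<Phi>])
    ultimately show "(\<lambda>n. CLINT \<omega>|P. iexp (z * (\<Sum>i<n. \<omega> i))) \<longlonglongrightarrow> exp (of_real s * (\<Sum>i. \<Phi> i z))"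
      by simp
  qed
  ultimately show "\<exists>D. real_distribution D \<and> (AE x in D. 0 \<le> x) \<and>
        (\<integral>\<^sup>+x. ennreal x \<partial>D) \<le> ennreal (s * (\<Sum>i. m i)) \<and>
        (\<forall>z. char D z = exp (of_real s * (\<Sum>i. \<Phi> i z)))" by blast
qed


text \<open>Integrates \<open>\<bar>iexp (z * x) - 1\<bar> \<le> \<bar>z\<bar> * x\<close>. This is
  the Lipschitz bound at \<open>0\<close> by which the part of the stochastic integral after a late
  time becomes negligible.\<close>

lemma norm_char_minus_one_le:
  assumes "real_distribution D" "AE x in D. 0 \<le> x" "(\<integral>\<^sup>+x. ennreal x \<partial>D) \<le> ennreal m" "0 \<le> m"
  shows "cmod (char D z - 1) \<le> m * \<bar>z\<bar>"
proof -
  interpret D: real_distribution D by fact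
  have fin: "(\<integral>\<^sup>+x. ennreal x \<partial>D) < \<infinity>"
    using assms(3) by (metis ennreal_less_top infinity_ennreal_def order_le_less_trans)
  have int: "integrable D (\<lambda>x. x)"
    using fin assms(2) by (intro integrableI_nn_integral_finite[where x="enn2real (\<integral>\<^sup>+x. ennreal x \<partial>D)"]) auto
  have "char D z - 1 = (CLINT x|D. iexp (z * x) - 1)"
    unfolding char_def
    by (subst Bochner_Integration.integral_diff) (auto simp: D.prob_space[simplified] intro!: D.integrable_iexp)
  also have "cmod \<dots> \<le> (\<integral>x. cmod (iexp (z * x) - 1) \<partial>D)"
    by (rule integral_norm_bound)
  also have "\<dots> \<le> (\<integral>x. \<bar>z\<bar> * x \<partial>D)"
  proof (rule integral_mono_AE)
    show "AE x in D. cmod (iexp (z * x) - 1) \<le> \<bar>z\<bar> * x"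
      using assms(2)
    proof eventually_elim
      case (elim x)
      then show ?case using norm_iexp_minus_one_le[of "z * x"] by (simp add: abs_mult)
    qed
    show "integrable D (\<lambda>x. cmod (iexp (z * x) - 1))"
      by (intro integrable_norm Bochner_Integration.integrable_diff D.integrable_iexp) auto
  qed (use int in auto)
  also have "\<dots> = \<bar>z\<bar> * (\<integral>x. x \<partial>D)" by simp
  also have "\<dots> \<le> \<bar>z\<bar> * m"
  proof (rule mult_left_mono)
    show "(\<integral>x. x \<partial>D) \<le> m"
      using assms int by (subst ennreal_le_iff[symmetric]) (auto simp: nn_integral_eq_integral[symmetric])
  qed simp
  finally show ?thesis by (simp add: mult.commute)
qed

section \<open>Convolutions and infinite divisibility\<close>

lemma char_convolution:
  assumes "real_distribution D" "real_distribution E"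
  shows "char (D \<star> E) z = char D z * char E z" and "real_distribution (D \<star> E)"
proof -
  interpret D: real_distribution D by fact
  interpret E: real_distribution E by fact
  interpret P: pair_prob_space D E ..
  have [measurable]: "(\<lambda>(x, y). x + y) \<in> borel_measurable (D \<Otimes>\<^sub>M E)" by measurable
  show "real_distribution (D \<star> E)"
    unfolding convolution_def by (intro P.real_distribution_distr) simp
  have int: "integrable (D \<Otimes>\<^sub>M E) (\<lambda>x. iexp (z * (fst x + snd x)))"
    by (intro P.integrable_iexp) auto
  have "char (D \<star> E) z = (CLINT x|D \<Otimes>\<^sub>M E. iexp (z * (fst x + snd x)))"
    unfolding convolution_def char_def by (subst integral_distr) (auto simp: case_prod_beta)
  also have "\<dots> = (CLINT x|D. CLINT y|E. iexp (z * (x + y)))"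
    by (subst P.integral_fst'[symmetric, OF int]) simp
  also have "\<dots> = (CLINT x|D. iexp (z * x) * (CLINT y|E. iexp (z * y)))"
    by (simp add: ring_distribs exp_add)
  also have "\<dots> = char D z * char E z"
    by (simp add: char_def mult.commute[of _ "CLINT y|E. _ y"])
  finally show "char (D \<star> E) z = char D z * char E z" .
qed

lemma char_convolution_power:
  assumes "real_distribution D"
  shows "real_distribution (convolution_power D n)" and "char (convolution_power D n) z = char D z ^ n"
proof -
  have "real_distribution (convolution_power D n) \<and> char (convolution_power D n) z = char D z ^ n"
  proof (induction n)
    case 0
    interpret R: prob_space "return borel (0::real)" by (intro prob_space_return) simp
    have "real_distribution (return borel (0::real))" by standard auto
    then show ?case by (simp add: char_def integral_return)
  next
    case (Suc n)
    then show ?case using char_convolution[OF assms] by simp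
  qed
  then show "real_distribution (convolution_power D n)" "char (convolution_power D n) z = char D z ^ n"
    by auto
qed

text \<open>The member of the semigroup at \<open>s = 1 / n\<close> is an \<open>n\<close>-th
  convolution root.\<close>

lemma ID_subordinator:
  assumes "subordinator_exponent \<Phi> m" "real_distribution D" "\<And>z. char D z = exp (\<Phi> z)"
  shows "D \<in> ID"
  unfolding ID_def
proof (intro CollectI conjI allI impI)
  fix n :: nat assume n: "n \<ge> 1"
  obtain E where E: "real_distribution E" "\<And>z. char E z = exp (of_real (1 / real n) * \<Phi> z)"
    using assms(1) unfolding subordinator_exponent_def by (metis divide_nonneg_nonneg of_nat_0_le_iff zero_le_one)
  have "char D = char (convolution_power E n)"
    using n by (auto simp: fun_eq_iff char_convolution_power[OF E(1)] E(2) assms(3) simp flip: exp_of_nat_mult)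
  then have "D = convolution_power E n"
    using E(1) assms(2) by (intro Levy_uniqueness char_convolution_power)
  with E(1) show "\<exists>\<eta>. real_distribution \<eta> \<and> D = convolution_power \<eta> n" by blast
qed fact

text \<open>For \<open>0 \<le> t\<close> this is the Levy exponent of the geometric law with parameter \<open>1 - t\<close>.\<close>

definition log_exponent :: "real \<Rightarrow> real \<Rightarrow> complex" where
  "log_exponent t z = ln (1 - of_real t) - ln (1 - of_real t * iexp z)"

text \<open>In the difference of the two logarithmic series the expansion of
  \<open>ln (1 - t)\<close> supplies the \<open>- 1\<close> of each term. The weights
  \<open>t ^ n / n\<close> are jump masses at \<open>n\<close>, of alternating sign when
  \<open>t < 0\<close>.\<close>

lemma log_exponent_sums:
  assumes "\<bar>t\<bar> < 1"
  shows "(\<lambda>n. of_real (t ^ Suc n / real (Suc n)) * (iexp (z * real (Suc n)) - 1)) sums log_exponent t z"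
proof -
  have *: "(\<lambda>n. - (y ^ Suc n / of_nat (Suc n))) sums ln (1 - y)" if "cmod y < 1" for y
  proof -
    have "(\<lambda>n. - ((- (- y)) ^ n) / of_nat n) sums ln (1 + - y)"
      by (rule Ln_series') (use that in simp)
    \<comment> \<open>The term of index \<open>0\<close> is a division by \<open>0\<close>, hence
      \<open>0\<close>; it is written out only to match the form of
      \<open>sums_Suc_iff\<close>.\<close>
    then have "(\<lambda>n. - (y ^ n) / of_nat n) sums (ln (1 - y) + - (y ^ 0) / of_nat 0)" by simp
    then have "(\<lambda>n. - (y ^ Suc n) / of_nat (Suc n)) sums ln (1 - y)"
      unfolding sums_Suc_iff[of "\<lambda>n. - (y ^ n) / of_nat n", symmetric] .
    then show ?thesis by (simp only: minus_divide_left)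
  qed
  have "(\<lambda>n. - (of_real t ^ Suc n / of_nat (Suc n)) - - ((of_real t * iexp z) ^ Suc n / of_nat (Suc n)))
      sums log_exponent t z"
    unfolding log_exponent_def using assms by (intro sums_diff *) (auto simp: norm_mult)
  moreover have "iexp (z * real (Suc n)) = iexp z ^ Suc n" for n
    by (simp add: exp_of_nat_mult[symmetric] mult_ac del: of_nat_Suc power_Suc)
  ultimately show ?thesis
    by (simp add: power_mult_distrib right_diff_distrib del: of_nat_Suc power_Suc)
qed

lemma exp_log_exponent:
  assumes "\<bar>t\<bar> < 1"
  shows "exp (log_exponent t z) = (1 - of_real t) / (1 - of_real t * iexp z)"
proof -
  have "cmod (of_real t * iexp z) < 1" using assms by (simp add: norm_mult)
  then have "1 - of_real t * iexp z \<noteq> 0" by auto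
  moreover have "1 - complex_of_real t \<noteq> 0" using assms
    by (metis abs_1 less_irrefl norm_of_real of_real_1 right_minus_eq)
  ultimately show ?thesis by (simp add: log_exponent_def exp_diff)
qed

lemma geometric_Suc_sums:
  fixes t :: real
  assumes "\<bar>t\<bar> < 1"
  shows "(\<lambda>n. t ^ Suc n) sums (t / (1 - t))"
  using sums_mult[OF geometric_sums[of t], of t] assms by simp

text \<open>The factor \<open>Suc n\<close> from \<open>\<bar>iexp (z * real (Suc n)) - 1\<bar>
  \<le> \<bar>z\<bar> * Suc n\<close> cancels the denominator of the weight and leaves a geometric
  series. Linearity in \<open>\<bar>z\<bar>\<close> is what makes the sums over the scales
  \<open>b ^ l\<close> converge.\<close>

lemma norm_log_exponent_le:
  assumes "\<bar>t\<bar> < 1"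
  shows "cmod (log_exponent t z) \<le> \<bar>t\<bar> / (1 - \<bar>t\<bar>) * \<bar>z\<bar>"
proof -
  let ?f = "\<lambda>n. of_real (t ^ Suc n / real (Suc n)) * (iexp (z * real (Suc n)) - 1)"
  have b: "cmod (?f n) \<le> \<bar>t\<bar> ^ Suc n * \<bar>z\<bar>" for n
  proof -
    have "cmod (?f n) = \<bar>t\<bar> ^ Suc n / real (Suc n) * cmod (iexp (z * real (Suc n)) - 1)"
      by (simp add: norm_mult power_abs abs_mult norm_divide norm_power del: of_nat_Suc)
    also have "\<dots> \<le> \<bar>t\<bar> ^ Suc n / real (Suc n) * \<bar>z * real (Suc n)\<bar>"
      by (intro mult_left_mono norm_iexp_minus_one_le) auto
    also have "\<dots> = \<bar>t\<bar> ^ Suc n * \<bar>z\<bar>" by (simp add: abs_mult)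
    finally show ?thesis .
  qed
  have g: "(\<lambda>n. \<bar>t\<bar> ^ Suc n * \<bar>z\<bar>) sums (\<bar>t\<bar> / (1 - \<bar>t\<bar>) * \<bar>z\<bar>)"
    using assms by (intro sums_mult2 geometric_Suc_sums) auto
  have s: "summable (\<lambda>n. cmod (?f n))"
    by (rule summable_comparison_test'[OF sums_summable[OF g]]) (use b in simp)
  have "cmod (log_exponent t z) = cmod (\<Sum>n. ?f n)"
    using log_exponent_sums[OF assms] by (simp add: sums_iff)
  also have "\<dots> \<le> (\<Sum>n. cmod (?f n))" by (intro summable_norm s)
  also have "\<dots> \<le> \<bar>t\<bar> / (1 - \<bar>t\<bar>) * \<bar>z\<bar>"
    unfolding sums_unique[OF g] by (intro suminf_le b s sums_summable[OF g])
  finally show ?thesis .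
qed

text \<open>A sum of independent Poisson numbers of jumps of size \<open>Suc n\<close> with
  intensity \<open>w n\<close>; the second assumption says that their means are summable.\<close>

lemma subordinator_exponent_weights:
  assumes "\<And>n. 0 \<le> w n" "summable (\<lambda>n. w n * real (Suc n))"
    and "\<And>z. (\<lambda>n. of_real (w n) * (iexp (z * real (Suc n)) - 1)) sums \<Phi> z"
  shows "\<exists>m. subordinator_exponent \<Phi> m"
proof -
  have "\<Phi> = (\<lambda>z. \<Sum>n. of_real (w n) * (iexp (z * real (Suc n)) - 1))"
    by (intro ext sums_unique assms(3))
  moreover have "subordinator_exponent (\<lambda>z. \<Sum>n. of_real (w n) * (iexp (z * real (Suc n)) - 1))
      (\<Sum>n. w n * real (Suc n))"
    by (intro subordinator_exponent_suminf subordinator_exponent_poisson assms(1,2) of_nat_0_le_iff)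
  ultimately show ?thesis by blast
qed

lemma subordinator_exponent_log:
  assumes "0 \<le> q" "q < 1"
  shows "\<exists>m. subordinator_exponent (log_exponent q) m"
proof (rule subordinator_exponent_weights)
  show "summable (\<lambda>n. q ^ Suc n / real (Suc n) * real (Suc n))"
    using geometric_Suc_sums[of q] assms by (simp add: sums_iff)
  show "(\<lambda>n. of_real (q ^ Suc n / real (Suc n)) * (iexp (z * real (Suc n)) - 1)) sums log_exponent q z" for z
    by (rule log_exponent_sums) (use assms in auto)
qed (use assms in auto)

text \<open>This is the compensation of the negative jumps: \<open>q ^ n / n - (- q) ^ n / n\<close>
  is \<open>0\<close> for even \<open>n\<close> and \<open>2 * q ^ n / n\<close> for odd
  \<open>n\<close>.\<close>

lemma subordinator_exponent_log_diff:
  assumes "0 \<le> q" "q < 1"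
  shows "\<exists>m. subordinator_exponent (\<lambda>z. log_exponent q z - log_exponent (- q) z) m"
proof (rule subordinator_exponent_weights)
  show "0 \<le> q ^ Suc n / real (Suc n) - (- q) ^ Suc n / real (Suc n)" for n
  proof -
    have "(- q) ^ Suc n \<le> \<bar>(- q) ^ Suc n\<bar>" by (rule abs_ge_self)
    also have "\<dots> = q ^ Suc n" using assms by (simp add: power_abs abs_mult)
    finally show ?thesis by (simp add: divide_right_mono del: of_nat_Suc power_Suc)
  qed
  have "summable (\<lambda>n. q ^ Suc n - (- q) ^ Suc n)"
    using assms by (intro summable_diff sums_summable[OF geometric_Suc_sums]) auto
  then show "summable (\<lambda>n. (q ^ Suc n / real (Suc n) - (- q) ^ Suc n / real (Suc n)) * real (Suc n))"
    by (simp add: left_diff_distrib del: of_nat_Suc power_Suc)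
  show "(\<lambda>n. of_real (q ^ Suc n / real (Suc n) - (- q) ^ Suc n / real (Suc n)) * (iexp (z * real (Suc n)) - 1))
     sums (log_exponent q z - log_exponent (- q) z)" for z
    using sums_diff[OF log_exponent_sums[of q z] log_exponent_sums[of "-q" z]] assms
    by (simp only: of_real_diff left_diff_distrib)
qed

text \<open>The Levy exponent of \<open>\<mu>\<close> for \<open>r = p q\<close>, with \<open>b = 1 / c\<close>: the negative jumps contributed by
  the factor \<open>p + r * iexp (b ^ k * z)\<close> of the characteristic function of \<open>\<rho>\<close> are cancelled by the
  geometric factor \<open>k\<close> scales further down.\<close>

definition mu_exponent :: "nat \<Rightarrow> real \<Rightarrow> real \<Rightarrow> real \<Rightarrow> complex" where
  "mu_exponent k b q z = (\<Sum>l. log_exponent q (b ^ l * z)) - (\<Sum>l. log_exponent (- q) (b ^ (l + k) * z))"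

section \<open>Summation over the scales\<close>

context
  fixes k :: nat and b q :: real
  assumes b: "0 < b" "b < 1" and q: "0 \<le> q" "q < 1"
begin

lemma summable_log_exponent:
  assumes "\<bar>t\<bar> < 1"
  shows "summable (\<lambda>l. log_exponent t (b ^ (l + n) * z))"
proof (rule summable_comparison_test')
  show "summable (\<lambda>l. \<bar>t\<bar> / (1 - \<bar>t\<bar>) * (b ^ l * b ^ n * \<bar>z\<bar>))"
    using b by (intro summable_mult summable_mult2 summable_geometric) auto
  show "norm (log_exponent t (b ^ (l + n) * z)) \<le> \<bar>t\<bar> / (1 - \<bar>t\<bar>) * (b ^ l * b ^ n * \<bar>z\<bar>)" for l
    using norm_log_exponent_le[OF assms, of "b ^ (l + n) * z"] b by (simp add: abs_mult power_add)
qed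

text \<open>Detaching the terms \<open>l = 0\<close> of both series gives the functional equation of
  \<mu> in logarithmic form: the two detached terms form the exponent of \<rho>.\<close>

lemma mu_exponent_rec:
  "mu_exponent k b q z = log_exponent q z - log_exponent (- q) (b ^ k * z) + mu_exponent k b q (b * z)"
proof -
  have "(\<Sum>l. log_exponent q (b ^ l * z)) = (\<Sum>l. log_exponent q (b ^ l * (b * z))) + log_exponent q z"
    using suminf_split_head[OF summable_log_exponent[of q 0 z]] q by (simp add: mult_ac)
  moreover have "(\<Sum>l. log_exponent (- q) (b ^ (l + k) * z)) =
      (\<Sum>l. log_exponent (- q) (b ^ (l + k) * (b * z))) + log_exponent (- q) (b ^ k * z)"
    using suminf_split_head[OF summable_log_exponent[of "- q" k z]] q by (simp add: mult_ac)
  ultimately show ?thesis by (simp add: mu_exponent_def)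
qed

text \<open>Divided by \<open>1 + q\<close>, with \<open>p = (1 - q) / (1 + q)\<close> and
  \<open>r = p * q\<close>, this reads \<open>(1 - q * iexp z) * F z = (p + r * iexp (b ^ k * z)) *
  F (b * z)\<close> for \<open>F = exp\<close> of \<open>mu_exponent\<close>.\<close>

lemma exp_mu_exponent_rec:
  "(1 - of_real q * iexp z) * (1 + of_real q) * exp (mu_exponent k b q z)
   = (1 - of_real q) * (1 + of_real q * iexp (b ^ k * z)) * exp (mu_exponent k b q (b * z))"
proof -
  have nz: "1 - of_real t * iexp y \<noteq> 0" if "\<bar>t\<bar> < 1" for t y
  proof -
    have "cmod (of_real t * iexp y) < 1" using that by (simp add: norm_mult)
    then show ?thesis by auto
  qed
  have "1 + complex_of_real q \<noteq> 0" using nz[of "-q" 0] q by simp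
  moreover have "exp (mu_exponent k b q z) = exp (log_exponent q z) / exp (log_exponent (- q) (b ^ k * z))
      * exp (mu_exponent k b q (b * z))"
    by (subst mu_exponent_rec) (simp add: exp_add exp_diff)
  ultimately show ?thesis
    using q nz[of q z] nz[of "- q" "b ^ k * z"] by (simp add: exp_log_exponent mult_ac del: of_real_mult)
qed

lemma subordinator_exponent_mu: "\<exists>m. subordinator_exponent (mu_exponent k b q) m"
proof -
  obtain m1 where m1: "subordinator_exponent (log_exponent q) m1"
    using subordinator_exponent_log[OF q] by blast
  obtain m2 where m2: "subordinator_exponent (\<lambda>z. log_exponent q z - log_exponent (- q) z) m2"
    using subordinator_exponent_log_diff[OF q] by blast
  \<comment> \<open>Both series are regrouped by the scale \<open>b ^ l\<close>. Below
    \<open>k\<close> only the geometric factor is present; from \<open>k\<close> on each negative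
    contribution meets the geometric one of the same scale, so every \<Phi> l is a subordinator
    exponent.\<close>
  define \<Phi> where "\<Phi> l z = (if l < k then log_exponent q (b ^ l * z)
     else log_exponent q (b ^ l * z) - log_exponent (- q) (b ^ l * z))" for l z
  have "subordinator_exponent (\<Phi> l) (b ^ l * (if l < k then m1 else m2))" for l
    unfolding \<Phi>_def using subordinator_exponent_scale[OF m1, of "b ^ l"] subordinator_exponent_scale[OF m2, of "b ^ l"] b
    by simp
  moreover have "summable (\<lambda>l. b ^ l * (if l < k then m1 else m2))"
  proof (rule summable_comparison_test')
    show "summable (\<lambda>l. b ^ l * max \<bar>m1\<bar> \<bar>m2\<bar>)" using b by (intro summable_mult2 summable_geometric) auto
    show "norm (b ^ l * (if l < k then m1 else m2)) \<le> b ^ l * max \<bar>m1\<bar> \<bar>m2\<bar>" for l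
      using b by (auto simp: abs_mult intro: mult_left_mono)
  qed
  ultimately have "subordinator_exponent (\<lambda>z. \<Sum>l. \<Phi> l z) (\<Sum>l. b ^ l * (if l < k then m1 else m2))"
    by (rule subordinator_exponent_suminf)
  moreover have "(\<Sum>l. \<Phi> l z) = mu_exponent k b q z" for z
  proof -
    \<comment> \<open>The second series starts at scale \<open>k\<close>; padding it with
      \<open>k\<close> zeros gives both series the same index.\<close>
    define g where "g l = (if l < k then 0 else log_exponent (- q) (b ^ l * z))" for l
    have g: "(\<lambda>l. g (l + k)) = (\<lambda>l. log_exponent (- q) (b ^ (l + k) * z))" by (auto simp: g_def)
    have sg: "summable g"
      using summable_log_exponent[of "- q" k z] q by (subst summable_iff_shift[of g k, symmetric]) (simp add: g)
    have "suminf g = (\<Sum>l. log_exponent (- q) (b ^ (l + k) * z))"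
      using suminf_split_initial_segment[OF sg, of k] by (simp add: g g_def)
    moreover have "(\<Sum>l. \<Phi> l z) = (\<Sum>l. log_exponent q (b ^ l * z)) - suminf g"
      using summable_log_exponent[of q 0 z] q sg
      by (subst suminf_diff) (auto simp: \<Phi>_def g_def intro!: arg_cong[where f=suminf])
    ultimately show ?thesis by (simp add: mu_exponent_def)
  qed
  ultimately show ?thesis by auto
qed

end

section \<open>Paths\<close>

text \<open>Dyadic, so that the integer time \<open>k\<close> is the mesh point of index
  \<open>k * 2 ^ m\<close> for every \<open>m\<close>.\<close>

definition mesh :: "nat \<Rightarrow> real" where
  "mesh m = 1 / 2 ^ m"

lemma mesh_pos [simp]: "0 < mesh m" and mesh_nonneg [simp]: "0 \<le> mesh m"
  and mesh_nonzero [simp]: "mesh m \<noteq> 0" and mesh_le_1: "mesh m \<le> 1"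
  by (auto simp: mesh_def)

lemma mesh_tendsto: "mesh \<longlonglongrightarrow> 0"
proof -
  have "(\<lambda>m. (1 / 2) ^ m :: real) \<longlonglongrightarrow> 0" by (intro LIMSEQ_power_zero) auto
  then show ?thesis unfolding mesh_def by (simp add: power_divide)
qed

text \<open>The integrand is taken at the left end of each mesh interval: this yields the left
  limits \<open>n (s-)\<close> in the limit, and it makes the integrand independent of the increment
  of \<open>l\<close> that it multiplies.\<close>

definition riemann_sum :: "(real \<Rightarrow> real) \<Rightarrow> (real \<Rightarrow> real) \<Rightarrow> real \<Rightarrow> real \<Rightarrow> nat \<Rightarrow> real" where
  "riemann_sum n l c h k = (\<Sum>j<k. c powr (- n (real j * h)) * (l (real (Suc j) * h) - l (real j * h)))"

text \<open>Deterministic paths with the properties that almost every path of a realisation has; the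
  limits along the mesh are taken here, path by path.\<close>

locale good_path =
  fixes n l :: "real \<Rightarrow> real"
  assumes n0: "n 0 = 0"
    and n_cadlag: "cadlag n" and l_cadlag: "cadlag l"
    and n_incr: "\<And>s t. 0 \<le> s \<Longrightarrow> s \<le> t \<Longrightarrow> n t - n s \<in> \<nat>"
    and l_incr: "\<And>s t. 0 \<le> s \<Longrightarrow> s \<le> t \<Longrightarrow> l s \<le> l t"
begin

lemma n_mono: "0 \<le> s \<Longrightarrow> s \<le> t \<Longrightarrow> n s \<le> n t"
  using n_incr[of s t] by (auto simp: Nats_def)

lemma n_Nats: "0 \<le> t \<Longrightarrow> n t \<in> \<nat>"
  using n_incr[of 0 t] n0 by simp

lemma n_nonneg: "0 \<le> t \<Longrightarrow> 0 \<le> n t"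
  using n_mono[of 0 t] n0 by simp

lemma n_ge_1: "0 \<le> t \<Longrightarrow> n t \<noteq> 0 \<Longrightarrow> 1 \<le> n t"
  using n_Nats[of t] by (auto simp: Nats_def)

lemma left_lim_tendsto:
  assumes "0 < t"
  shows "(n \<longlongrightarrow> left_lim n t) (at_left t)"
proof -
  obtain x where x: "(n \<longlongrightarrow> x) (at_left t)" using n_cadlag assms unfolding cadlag_def by blast
  then have "left_lim n t = x" by (intro tendsto_Lim) auto
  with x show ?thesis by simp
qed

text \<open>The infimum of the times at which \<open>n\<close> is nonzero is attained: otherwise
  right-continuity would keep \<open>n\<close> below \<open>1\<close>, hence at \<open>0\<close>, on
  an interval to its right. Before this time \<open>n\<close> vanishes and has no jump, and at this
  time its left limit is \<open>0\<close> while its value is not, so it is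
  \<open>first_jump_time n\<close>.\<close>

lemma first_jump:
  assumes T: "0 < T" "n T \<noteq> 0"
  defines "\<tau> \<equiv> first_jump_time n"
  shows "0 < \<tau>" and "\<And>t. 0 \<le> t \<Longrightarrow> n t \<noteq> 0 \<longleftrightarrow> \<tau> \<le> t"
proof -
  define A where "A = {t. 0 \<le> t \<and> n t \<noteq> 0}"
  define \<sigma> where "\<sigma> = Inf A"
  have A: "A \<noteq> {}" "bdd_below A" using T by (auto simp: A_def bdd_below_def intro: less_imp_le)
  have \<sigma>0: "0 \<le> \<sigma>" unfolding \<sigma>_def using A by (intro cInf_greatest) (auto simp: A_def)
  have n\<sigma>: "n \<sigma> \<noteq> 0"
  proof
    assume 0: "n \<sigma> = 0"
    have "(n \<longlongrightarrow> n \<sigma>) (at_right \<sigma>)" using n_cadlag \<sigma>0 by (auto simp: cadlag_def)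
    then have "eventually (\<lambda>t. n t < 1) (at_right \<sigma>)" using 0 by (intro order_tendstoD) auto
    then obtain b where b: "b > \<sigma>" "\<And>t. \<sigma> < t \<Longrightarrow> t < b \<Longrightarrow> n t < 1"
      by (auto simp: eventually_at_right_field)
    have "b \<le> Inf A"
    proof (rule cInf_greatest[OF A(1)])
      fix t assume t: "t \<in> A"
      then have "\<sigma> \<le> t" unfolding \<sigma>_def using A by (intro cInf_lower)
      moreover have "t \<noteq> \<sigma>" using t 0 by (auto simp: A_def)
      moreover have "1 \<le> n t" using t n_ge_1 by (auto simp: A_def)
      ultimately show "b \<le> t" using b(2)[of t] by (meson le_less_linear less_le not_le)
    qed
    then show False using b(1) by (simp add: \<sigma>_def)
  qed
  have \<sigma>: "0 < \<sigma>" using n\<sigma> n0 \<sigma>0 by (cases "\<sigma> = 0") auto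
  have iff: "n t \<noteq> 0 \<longleftrightarrow> \<sigma> \<le> t" if "0 \<le> t" for t
  proof
    show "\<sigma> \<le> t" if "n t \<noteq> 0"
      unfolding \<sigma>_def using A that \<open>0 \<le> t\<close> by (intro cInf_lower) (auto simp: A_def)
    show "n t \<noteq> 0" if "\<sigma> \<le> t"
      using n_mono[OF \<sigma>0 that] n_ge_1[OF \<sigma>0 n\<sigma>] by auto
  qed
  have zero: "left_lim n t = 0" if "0 < t" "t \<le> \<sigma>" for t
  proof (rule tendsto_Lim)
    have "eventually (\<lambda>s. s \<in> {0<..<t}) (at_left t)" using that by (intro eventually_at_left_real) auto
    then have "eventually (\<lambda>s. n s = 0) (at_left t)"
    proof eventually_elim
      case (elim s)
      then show ?case using iff[of s] that by simp
    qed
    then show "(n \<longlongrightarrow> 0) (at_left t)" by (rule tendsto_eventually)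
  qed simp
  have "\<tau> = \<sigma>"
    unfolding \<tau>_def first_jump_time_def
  proof (rule cInf_eq_minimum)
    show "\<sigma> \<in> {t. 0 < t \<and> left_lim n t \<noteq> n t}" using \<sigma> zero[of \<sigma>] n\<sigma> by auto
    show "\<sigma> \<le> t" if "t \<in> {t. 0 < t \<and> left_lim n t \<noteq> n t}" for t
    proof (rule ccontr)
      assume "\<not> \<sigma> \<le> t"
      with that zero[of t] iff[of t] show False by auto
    qed
  qed
  with \<sigma> iff show "0 < \<tau>" and "\<And>t. 0 \<le> t \<Longrightarrow> n t \<noteq> 0 \<longleftrightarrow> \<tau> \<le> t" by auto
qed

text \<open>The first mesh point at which \<open>n\<close> is nonzero lies in
  \<open>{\<tau>..\<tau> + mesh m}\<close>. It approaches \<tau> from the right, where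
  \<open>l\<close> is continuous.\<close>

lemma first_jump_mesh_tendsto:
  assumes T: "0 < T" "n T \<noteq> 0"
  shows "(\<lambda>m. l (real (LEAST j. n (real j * mesh m) \<noteq> 0) * mesh m)) \<longlonglongrightarrow> l (first_jump_time n)"
proof -
  define \<tau> where "\<tau> = first_jump_time n"
  note fj = first_jump[OF T, folded \<tau>_def]
  define J where "J m = (LEAST j. n (real j * mesh m) \<noteq> 0)" for m
  have ge: "n (real (J m) * mesh m) \<noteq> 0" for m
    unfolding J_def
  proof (rule LeastI)
    show "n (real (nat \<lceil>\<tau> * 2 ^ m\<rceil>) * mesh m) \<noteq> 0"
    proof -
      have "\<tau> = (\<tau> * 2 ^ m) * mesh m" by (simp add: mesh_def)
      also have "\<dots> \<le> real (nat \<lceil>\<tau> * 2 ^ m\<rceil>) * mesh m"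
        by (intro mult_right_mono real_nat_ceiling_ge) (simp add: mesh_def)
      finally show ?thesis using fj mesh_pos[of m] by (simp add: less_imp_le)
    qed
  qed
  then have 1: "\<tau> \<le> real (J m) * mesh m" for m using fj(2)[of "real (J m) * mesh m"] by (simp add: less_imp_le)
  have 2: "real (J m) * mesh m \<le> \<tau> + mesh m" for m
  proof -
    have "J m \<noteq> 0" using 1[of m] fj(1) by (intro notI) simp
    then obtain j where j: "J m = Suc j" using not0_implies_Suc by blast
    then have "\<not> n (real j * mesh m) \<noteq> 0" unfolding J_def by (intro not_less_Least) simp
    then have "real j * mesh m < \<tau>" using fj(2)[of "real j * mesh m"] by (simp add: less_imp_le)
    then show ?thesis by (simp add: j ring_distribs)
  qed
  have up: "(\<lambda>m. \<tau> + mesh m) \<longlonglongrightarrow> \<tau>" using tendsto_add[OF tendsto_const mesh_tendsto, of \<tau>] by simp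
  have lim: "(\<lambda>m. real (J m) * mesh m) \<longlonglongrightarrow> \<tau>"
    by (rule tendsto_sandwich[OF always_eventually always_eventually tendsto_const[of \<tau>] up]) (simp_all add: 1 2)
  have "continuous (at \<tau> within {\<tau>..}) l"
    using l_cadlag fj(1) by (simp add: continuous_within at_within_Ici_at_right cadlag_def)
  from continuous_within_tendsto_compose'[OF this _ lim]
  have "(\<lambda>m. l (real (J m) * mesh m)) \<longlonglongrightarrow> l \<tau>" using 1 by simp
  then show ?thesis unfolding J_def \<tau>_def .
qed

section \<open>The pathwise integral as a limit of Riemann sums\<close>

abbreviation "dl \<equiv> interval_measure (\<lambda>s. l (max 0 s))"

text \<open>\<open>interval_measure\<close> acts on functions on the whole line; the constant
  continuation of \<open>l\<close> to negative times is nondecreasing and right-continuous and puts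
  no mass on \<open>{..0}\<close>.\<close>

lemma l_ext:
  shows "\<And>x y. x \<le> y \<Longrightarrow> l (max 0 x) \<le> l (max 0 y)" and "\<And>a. continuous (at_right a) (\<lambda>s. l (max 0 s))"
proof -
  show "l (max 0 x) \<le> l (max 0 y)" if "x \<le> y" for x y using that by (intro l_incr) auto
  show "continuous (at_right a) (\<lambda>s. l (max 0 s))" for a
  proof (cases "0 \<le> a")
    case True
    have "eventually (\<lambda>s. l s = l (max 0 s)) (at_right a)"
      using eventually_at_right_less[of a] by eventually_elim (use True in auto)
    moreover have "(l \<longlongrightarrow> l a) (at_right a)" using l_cadlag True by (auto simp: cadlag_def)
    ultimately have "((\<lambda>s. l (max 0 s)) \<longlongrightarrow> l a) (at_right a)" by (rule Lim_transform_eventually[rotated])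
    then show ?thesis using True by (simp add: continuous_within max_def)
  next
    case False
    then have "eventually (\<lambda>s. s \<in> {a<..<0}) (at_right a)" by (intro eventually_at_right_real) auto
    then have "eventually (\<lambda>s. l (max 0 s) = l 0) (at_right a)" by eventually_elim auto
    then have "((\<lambda>s. l (max 0 s)) \<longlongrightarrow> l 0) (at_right a)" by (rule tendsto_eventually)
    then show ?thesis using False by (simp add: continuous_within max_def)
  qed
qed

lemma measure_dl: "0 \<le> a \<Longrightarrow> a \<le> b \<Longrightarrow> measure dl {a<..b} = l b - l a"
  and emeasure_dl_finite: "emeasure dl {a<..b} < \<infinity>"
proof -
  show "measure dl {a<..b} = l b - l a" if "0 \<le> a" "a \<le> b"
    using that measure_interval_measure_Ioc[OF that(2) l_ext] by (simp add: max_def)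
  have "emeasure dl {a<..b} = ennreal (if a \<le> b then l (max 0 b) - l (max 0 a) else 0)"
    by (rule emeasure_interval_measure_Ioc_eq[OF l_ext])
  then show "emeasure dl {a<..b} < \<infinity>" by simp
qed

text \<open>The Riemann sum is the \<open>dl\<close>-integral of the step function \<phi> m, which
  on each mesh interval takes the value of the integrand at its left end. These steps converge to
  the integrand with left limits and are at most \<open>1\<close>, because \<open>c > 1\<close> and
  \<open>n\<close> is nonnegative.\<close>

lemma riemann_sum_tendsto:
  fixes c :: real and k :: nat
  assumes c: "1 < c"
  shows "(\<lambda>m. riemann_sum n l c (mesh m) (k * 2 ^ m)) \<longlonglongrightarrow> stieltjes_integral c n l (real k)"
    and "set_integrable dl {0<..real k} (\<lambda>s. c powr (- left_lim n s))"
proof -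
  define \<phi> where "\<phi> m s = (\<Sum>j<k * 2 ^ m. indicator {real j * mesh m<..real (Suc j) * mesh m} s * c powr (- n (real j * mesh m)))" for m s
  have int: "(\<integral>s. \<phi> m s \<partial>dl) = riemann_sum n l c (mesh m) (k * 2 ^ m)" for m
  proof -
    have le: "real j * mesh m \<le> real (Suc j) * mesh m" for j by (intro mult_right_mono) (auto simp: less_imp_le)
    have "(\<integral>s. \<phi> m s \<partial>dl) = (\<Sum>j<k * 2 ^ m. \<integral>s. indicator {real j * mesh m<..real (Suc j) * mesh m} s * c powr (- n (real j * mesh m)) \<partial>dl)"
      unfolding \<phi>_def
      by (intro Bochner_Integration.integral_sum integrable_mult_left integrable_real_indicator emeasure_dl_finite) auto
    also have "\<dots> = riemann_sum n l c (mesh m) (k * 2 ^ m)"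
      unfolding riemann_sum_def
    proof (rule sum.cong[OF refl])
      fix j
      have "0 \<le> real j * mesh m" by (simp add: less_imp_le)
      from measure_dl[OF this le]
      show "(\<integral>s. indicator {real j * mesh m<..real (Suc j) * mesh m} s * c powr (- n (real j * mesh m)) \<partial>dl) =
         c powr (- n (real j * mesh m)) * (l (real (Suc j) * mesh m) - l (real j * mesh m))"
        by (simp add: mult.commute del: of_nat_Suc)
    qed
    finally show ?thesis .
  qed
  \<comment> \<open>The mesh intervals are open on the left and closed on the right, so a positive
    \<open>s\<close> lies in exactly one of them, which the ceiling identifies.\<close>
  have unique: "s \<in> {real j * mesh m<..real (Suc j) * mesh m} \<longleftrightarrow> j = nat (\<lceil>s * 2 ^ m\<rceil> - 1)" if "0 < s" for s j m
  proof -
    have "s \<in> {real j * mesh m<..real (Suc j) * mesh m} \<longleftrightarrow> real j < s * 2 ^ m \<and> s * 2 ^ m \<le> real j + 1"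
      by (auto simp: mesh_def field_simps)
    also have "\<dots> \<longleftrightarrow> \<lceil>s * 2 ^ m\<rceil> = int j + 1" by (subst ceiling_eq_iff) auto
    also have "\<dots> \<longleftrightarrow> j = nat (\<lceil>s * 2 ^ m\<rceil> - 1)"
    proof -
      have "0 < \<lceil>s * 2 ^ m\<rceil>" using that by simp
      then show ?thesis by linarith
    qed
    finally show ?thesis .
  qed
  have out: "\<phi> m s = 0" if "s \<notin> {0<..real k}" for m s
    unfolding \<phi>_def
  proof (rule sum.neutral, rule ballI)
    fix j assume j: "j \<in> {..<k * 2 ^ m}"
    have "0 \<le> real j * mesh m" by (simp add: less_imp_le)
    moreover have "real (Suc j) * mesh m \<le> real (k * 2 ^ m) * mesh m"
      using j by (intro mult_right_mono) (auto simp: less_imp_le simp del: of_nat_Suc of_nat_mult)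
    then have "real (Suc j) * mesh m \<le> real k" by (simp add: mesh_def)
    ultimately have "s \<notin> {real j * mesh m<..real (Suc j) * mesh m}"
      using that unfolding greaterThanAtMost_iff by linarith
    then show "indicator {real j * mesh m<..real (Suc j) * mesh m} s * c powr (- n (real j * mesh m)) = 0" by simp
  qed
  define J where "J s m = nat (\<lceil>s * 2 ^ m\<rceil> - 1)" for s :: real and m :: nat
  have inside: "\<phi> m s = c powr (- n (real (J s m) * mesh m))" if s: "s \<in> {0<..real k}" for m s
  proof -
    have "s \<in> {real (J s m) * mesh m<..real (Suc (J s m)) * mesh m}"
      using unique[of s "J s m" m] s by (auto simp: J_def)
    moreover have "J s m < k * 2 ^ m"
    proof -
      have "s * 2 ^ m \<le> real k * 2 ^ m" using s by (intro mult_right_mono) auto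
      then have "\<lceil>s * 2 ^ m\<rceil> \<le> int (k * 2 ^ m)" by (intro ceiling_le) simp
      moreover have "0 < \<lceil>s * 2 ^ m\<rceil>" using s by simp
      ultimately show ?thesis unfolding J_def by linarith
    qed
    moreover have "\<phi> m s = (\<Sum>j<k * 2 ^ m. if j = J s m then c powr (- n (real (J s m) * mesh m)) else 0)"
      unfolding \<phi>_def
    proof (rule sum.cong[OF refl])
      fix j
      have "s \<in> {real j * mesh m<..real (Suc j) * mesh m} \<longleftrightarrow> j = J s m"
        using s unfolding J_def by (intro unique) simp
      then show "indicator {real j * mesh m<..real (Suc j) * mesh m} s * c powr (- n (real j * mesh m)) =
          (if j = J s m then c powr (- n (real (J s m) * mesh m)) else 0)"
        by (simp only: indicator_def) simp
    qed
    ultimately show ?thesis by simp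
  qed
  have lim: "(\<lambda>m. \<phi> m s) \<longlonglongrightarrow> indicator {0<..real k} s *\<^sub>R c powr (- left_lim n s)" for s
  proof (cases "s \<in> {0<..real k}")
    case True
    have *: "real (J s m) * mesh m < s" "s - mesh m \<le> real (J s m) * mesh m" for m
    proof -
      have "s \<in> {real (J s m) * mesh m<..real (Suc (J s m)) * mesh m}"
        using unique[of s "J s m" m] True by (auto simp: J_def)
      then show "real (J s m) * mesh m < s" "s - mesh m \<le> real (J s m) * mesh m"
        by (auto simp: ring_distribs)
    qed
    have "(\<lambda>m. real (J s m) * mesh m) \<longlonglongrightarrow> s"
    proof (rule tendsto_sandwich[OF always_eventually always_eventually _ tendsto_const[of s]])
      have "(\<lambda>m. s - mesh m) \<longlonglongrightarrow> s - 0" by (intro tendsto_intros mesh_tendsto)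
      then show "(\<lambda>m. s - mesh m) \<longlonglongrightarrow> s" by simp
    qed (simp_all add: * less_imp_le)
    \<comment> \<open>The left end is strictly below \<open>s\<close>, even when \<open>s\<close> is
      itself a mesh point; hence the limit is the left limit of \<open>n\<close> and not its
      value.\<close>
    then have "filterlim (\<lambda>m. real (J s m) * mesh m) (at_left s) sequentially"
      unfolding filterlim_at using * by (auto simp: less_le)
    from filterlim_compose[OF left_lim_tendsto this] True
    have "(\<lambda>m. n (real (J s m) * mesh m)) \<longlonglongrightarrow> left_lim n s" by simp
    then have "(\<lambda>m. c powr (- n (real (J s m) * mesh m))) \<longlonglongrightarrow> c powr (- left_lim n s)"
      using c by (intro tendsto_intros) auto
    then show ?thesis using True inside[OF True] by simp
  qed (simp add: out)
  have meas: "\<phi> m \<in> borel_measurable dl" for m unfolding \<phi>_def by measurable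
  \<comment> \<open>Measurability of the integrand comes for free, as that of a pointwise limit of
    step functions.\<close>
  have lim_meas: "(\<lambda>s. indicator {0<..real k} s *\<^sub>R c powr (- left_lim n s)) \<in> borel_measurable dl"
    by (rule borel_measurable_LIMSEQ_real[OF lim meas])
  have dom: "norm (\<phi> m s) \<le> indicator {0<..real k} s" for m s
  proof (cases "s \<in> {0<..real k}")
    case True
    have "0 \<le> n (real (J s m) * mesh m)" by (intro n_nonneg) (simp add: less_imp_le)
    then have "c powr (- n (real (J s m) * mesh m)) \<le> 1" using c by (simp add: powr_minus inverse_le_1_iff ge_one_powr_ge_zero)
    then show ?thesis using inside[OF True] True by simp
  qed (simp add: out)
  have w: "integrable dl (indicator {0<..real k} :: real \<Rightarrow> real)"
    by (intro integrable_real_indicator emeasure_dl_finite) auto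
  show "set_integrable dl {0<..real k} (\<lambda>s. c powr (- left_lim n s))"
    unfolding set_integrable_def
    by (rule integrable_dominated_convergence[where s=\<phi>, OF lim_meas meas w]) (use lim dom in auto)
  have "(\<lambda>m. \<integral>s. \<phi> m s \<partial>dl) \<longlonglongrightarrow> (\<integral>s. indicator {0<..real k} s *\<^sub>R c powr (- left_lim n s) \<partial>dl)"
    by (rule integral_dominated_convergence[where s=\<phi>, OF lim_meas meas w]) (use lim dom in auto)
  then show "(\<lambda>m. riemann_sum n l c (mesh m) (k * 2 ^ m)) \<longlonglongrightarrow> stieltjes_integral c n l (real k)"
    by (simp add: int stieltjes_integral_def set_lebesgue_integral_def)
qed

lemma stieltjes_integral_mono:
  assumes c: "1 < c" and st: "s \<le> t"
  shows "stieltjes_integral c n l s \<le> stieltjes_integral c n l t" and "0 \<le> stieltjes_integral c n l s"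
proof -
  obtain k where k: "t \<le> real k" using real_arch_simple by blast
  have *: "set_integrable dl {0<..x} (\<lambda>s. c powr (- left_lim n s))" if "x \<le> real k" for x
    by (rule set_integrable_subset[OF riemann_sum_tendsto(2)[OF c, of k]]) (use that in auto)
  show "stieltjes_integral c n l s \<le> stieltjes_integral c n l t"
    unfolding stieltjes_integral_def set_lebesgue_integral_def
    using *[of s] *[of t] k st unfolding set_integrable_def
    by (intro integral_mono) (auto split: split_indicator)
  show "0 \<le> stieltjes_integral c n l s"
    unfolding stieltjes_integral_def set_lebesgue_integral_def by (intro integral_nonneg_AE) auto
qed

lemma stieltjes_integral_tendsto:
  assumes c: "1 < c" and bd: "\<And>k::nat. stieltjes_integral c n l (real k) \<le> B"
  shows "\<exists>Z. (stieltjes_integral c n l \<longlongrightarrow> Z) at_top"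
proof -
  let ?Z = "SUP t. stieltjes_integral c n l t"
  have B: "stieltjes_integral c n l t \<le> B" for t
    using real_arch_simple[of t] stieltjes_integral_mono(1)[OF c] bd order_trans by metis
  have "(stieltjes_integral c n l \<longlongrightarrow> ?Z) at_top"
  proof (rule increasing_tendsto)
    show "\<forall>\<^sub>F t in at_top. stieltjes_integral c n l t \<le> ?Z"
      by (intro always_eventually allI cSUP_upper) (auto intro!: bdd_aboveI2[where M=B] B)
    fix x assume "x < ?Z"
    then obtain t where t: "x < stieltjes_integral c n l t"
      by (subst (asm) less_cSUP_iff) (auto intro!: bdd_aboveI2[where M=B] B)
    show "\<forall>\<^sub>F t in at_top. x < stieltjes_integral c n l t"
      using eventually_ge_at_top[of t] by (rule eventually_mono) (rule less_le_trans[OF t stieltjes_integral_mono(1)[OF c]])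
  qed
  then show ?thesis by blast
qed

end

section \<open>The marginals of a realisation\<close>

lemma subordinator_exponent_zero: "subordinator_exponent (\<lambda>_. 0) 0"
  using subordinator_exponent_poisson[of 0 0] by simp

text \<open>The series version, padded with zero exponents.\<close>

lemma subordinator_exponent_add:
  assumes "subordinator_exponent \<Phi> m" "subordinator_exponent \<Psi> m'"
  shows "subordinator_exponent (\<lambda>z. \<Phi> z + \<Psi> z) (m + m')"
proof -
  define f where "f i = (if i = 0 then \<Phi> else if i = Suc 0 then \<Psi> else (\<lambda>_. 0))" for i :: nat
  define g where "g i = (if i = 0 then m else if i = Suc 0 then m' else 0)" for i :: nat
  have g: "g sums (m + m')"
    using sums_finite[of "{0, Suc 0}" g] by (simp add: g_def)
  have f: "(\<lambda>i. f i z) sums (\<Phi> z + \<Psi> z)" for z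
    using sums_finite[of "{0, Suc 0}" "\<lambda>i. f i z"] by (simp add: f_def)
  have "subordinator_exponent (f i) (g i)" for i
    using assms subordinator_exponent_zero by (simp add: f_def g_def)
  from subordinator_exponent_suminf[OF this sums_summable[OF g]]
  show ?thesis using sums_unique[OF g] sums_unique[OF f] by simp
qed

text \<open>The integral over \<open>nu\<close>, written out, with \<open>a\<close> in place of
  \<open>c powi (- k)\<close>.\<close>

definition joint_exponent :: "real \<Rightarrow> real \<Rightarrow> real \<Rightarrow> real \<Rightarrow> real \<Rightarrow> real \<Rightarrow> complex" where
  "joint_exponent u v w a z1 z2 =
     of_real u * (iexp z1 - 1) + of_real v * (iexp z2 - 1) + of_real w * (iexp (z1 + a * z2) - 1)"

locale poisson_pair =
  fixes M :: "'a measure" and N L :: "real \<Rightarrow> 'a \<Rightarrow> real" and u v w a :: real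
  assumes levy: "levy_process M (\<lambda>t \<omega>. (N t \<omega>, L t \<omega>))"
    and char_NL: "\<And>t z1 z2. 0 \<le> t \<Longrightarrow>
      (CLINT \<omega>|M. iexp (z1 * N t \<omega> + z2 * L t \<omega>)) = exp (of_real t * joint_exponent u v w a z1 z2)"
    and rates_nonneg: "0 \<le> u" "0 \<le> v" "0 \<le> w" and rate_N: "0 < u + w" and a_nonneg: "0 \<le> a"
begin

sublocale prob_space M
  using levy unfolding levy_process_def by blast

lemma measurable_NL: "0 \<le> t \<Longrightarrow> (\<lambda>\<omega>. (N t \<omega>, L t \<omega>)) \<in> borel_measurable M"
  using levy unfolding levy_process_def by blast

lemma measurable_N: "0 \<le> t \<Longrightarrow> N t \<in> borel_measurable M"
  using measurable_compose[OF measurable_NL, of t fst borel] by (simp add: borel_prod[symmetric])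

lemma measurable_L: "0 \<le> t \<Longrightarrow> L t \<in> borel_measurable M"
  using measurable_compose[OF measurable_NL, of t snd borel] by (simp add: borel_prod[symmetric])

lemma measurable_increment:
  "0 \<le> s \<Longrightarrow> 0 \<le> t \<Longrightarrow> (\<lambda>\<omega>. (N t \<omega> - N s \<omega>, L t \<omega> - L s \<omega>)) \<in> borel_measurable M"
  by (subst borel_prod[symmetric]) (intro measurable_Pair borel_measurable_diff measurable_N measurable_L)

lemma distr_increment:
  assumes "0 \<le> s" "0 \<le> t"
  shows "distr M borel (\<lambda>\<omega>. (N (s + t) \<omega> - N s \<omega>, L (s + t) \<omega> - L s \<omega>)) =
    distr M borel (\<lambda>\<omega>. (N t \<omega>, L t \<omega>))"
  using levy assms unfolding levy_process_def by simp

lemma AE_start: "AE \<omega> in M. N 0 \<omega> = 0 \<and> L 0 \<omega> = 0"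
  using levy unfolding levy_process_def by (simp add: zero_prod_def)

lemma integral_increment:
  fixes f :: "real \<times> real \<Rightarrow> 'c::{banach, second_countable_topology}"
  assumes "0 \<le> s" "0 \<le> t" "f \<in> borel_measurable borel"
  shows "(\<integral>\<omega>. f (N (s + t) \<omega> - N s \<omega>, L (s + t) \<omega> - L s \<omega>) \<partial>M) = (\<integral>\<omega>. f (N t \<omega>, L t \<omega>) \<partial>M)"
  using integral_distr[OF measurable_NL[OF assms(2)] assms(3)]
    integral_distr[OF measurable_increment[of s "s + t"] assms(3)] distr_increment[OF assms(1,2)] assms by simp

lemma nn_integral_increment:
  assumes "0 \<le> s" "0 \<le> t" "f \<in> borel_measurable borel"
  shows "(\<integral>\<^sup>+\<omega>. f (N (s + t) \<omega> - N s \<omega>, L (s + t) \<omega> - L s \<omega>) \<partial>M) = (\<integral>\<^sup>+\<omega>. f (N t \<omega>, L t \<omega>) \<partial>M)"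
  using nn_integral_distr[OF measurable_NL[OF assms(2)], of f]
    nn_integral_distr[OF measurable_increment[of s "s + t"], of f] distr_increment[OF assms(1,2)] assms by simp

lemma AE_increment:
  assumes "0 \<le> s" "0 \<le> t" "{x. P x} \<in> sets borel" "AE \<omega> in M. P (N t \<omega>, L t \<omega>)"
  shows "AE \<omega> in M. P (N (s + t) \<omega> - N s \<omega>, L (s + t) \<omega> - L s \<omega>)"
proof -
  have "AE x in distr M borel (\<lambda>\<omega>. (N t \<omega>, L t \<omega>)). P x"
    using assms by (subst AE_distr_iff) (auto intro: measurable_NL)
  then show ?thesis
    unfolding distr_increment[OF assms(1,2), symmetric]
    using assms by (subst (asm) AE_distr_iff) (auto intro: measurable_increment)
qed

abbreviation "lam \<equiv> u + w"

lemma distr_N: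
  assumes "0 < t"
  shows "distr M borel (N t) = distr (measure_pmf (poisson_pmf (lam * t))) borel real"
proof (rule Levy_uniqueness)
  have r: "0 < lam * t" using assms rate_N by simp
  show "real_distribution (distr M borel (N t))"
    using assms by (intro real_distribution_distr measurable_N) auto
  show "real_distribution (distr (measure_pmf (poisson_pmf (lam * t))) borel real)"
    by (intro prob_space.real_distribution_distr prob_space_measure_pmf) simp
  show "char (distr M borel (N t)) = char (distr (measure_pmf (poisson_pmf (lam * t))) borel real)"
  proof
    fix z
    have "char (distr M borel (N t)) z = (CLINT \<omega>|M. iexp (z * N t \<omega> + 0 * L t \<omega>))"
      unfolding char_def using assms measurable_N[of t] by (subst integral_distr) auto
    also have "\<dots> = exp (of_real (lam * t) * (iexp z - 1))"
      using assms by (subst char_NL) (auto simp: joint_exponent_def algebra_simps)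
    also have "\<dots> = char (distr (measure_pmf (poisson_pmf (lam * t))) borel real) z"
      using char_poisson[OF r, of 1 z] by simp
    finally show "char (distr M borel (N t)) z = char (distr (measure_pmf (poisson_pmf (lam * t))) borel real) z" .
  qed
qed

lemma AE_N_Nats:
  assumes "0 \<le> t"
  shows "AE \<omega> in M. N t \<omega> \<in> \<nat>"
proof (cases "t = 0")
  case True
  then show ?thesis using AE_start by (auto elim: eventually_mono)
next
  case False
  have s: "\<nat> \<in> sets (borel :: real measure)" using closed_Nats by (rule borel_closed)
  have "AE x in distr M borel (N t). x \<in> \<nat>"
    using False assms s by (subst distr_N) (auto simp: AE_distr_iff)
  then show ?thesis using assms s by (subst (asm) AE_distr_iff) (auto intro: measurable_N)
qed

text \<open>Source of all errors of order \<open>h\<^sup>2\<close> that stem from two jumps in one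
  step. With \<open>r\<close> the Poisson mean, \<open>1 - r \<le> exp (- r)\<close> gives
  \<open>1 - (1 + r) * exp (- r) \<le> 1 - (1 - r) * (1 + r)\<close>.\<close>

lemma prob_N_ge_2:
  assumes "0 \<le> t"
  shows "prob {\<omega>\<in>space M. 2 \<le> N t \<omega>} \<le> (lam * t)\<^sup>2"
proof (cases "t = 0")
  case True
  have "prob {\<omega>\<in>space M. 2 \<le> N 0 \<omega>} = prob {}"
    using AE_start measurable_N[of 0] by (intro finite_measure_eq_AE) auto
  then show ?thesis using True by simp
next
  case False
  define r where "r = lam * t"
  have r: "0 < r" using False assms rate_N by (simp add: r_def)
  have "prob {\<omega>\<in>space M. 2 \<le> N t \<omega>} = measure (distr M borel (N t)) {2..}"
    using assms by (subst measure_distr) (auto intro: measurable_N arg_cong[where f=prob])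
  also have "\<dots> = measure_pmf.prob (poisson_pmf r) (UNIV - {0, 1})"
    using False assms by (subst distr_N) (auto simp: measure_distr r_def intro!: arg_cong2[where f=measure])
  also have "\<dots> = 1 - (exp (- r) + r * exp (- r))"
    using r by (subst measure_pmf.prob_compl[simplified]) (auto simp: measure_measure_pmf_finite)
  also have "\<dots> \<le> r\<^sup>2"
  proof -
    have "(1 - r) * (1 + r) \<le> exp (- r) * (1 + r)"
      using exp_ge_add_one_self[of "- r"] r by (intro mult_right_mono) auto
    then show ?thesis by (simp add: algebra_simps power2_eq_square)
  qed
  finally show ?thesis by (simp add: r_def)
qed

text \<open>Used with \<open>b = 1 / c\<close> for the decay of the discount factor and with
  \<open>b = 1 / 2\<close> to dominate the event that \<open>N\<close> has not jumped.\<close>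

lemma laplace_N:
  assumes "0 \<le> t" "0 < b" "b \<le> 1"
  shows "expectation (\<lambda>\<omega>. b powr N t \<omega>) = exp (- (lam * t * (1 - b)))"
proof (cases "t = 0")
  case True
  have "expectation (\<lambda>\<omega>. b powr N 0 \<omega>) = expectation (\<lambda>\<omega>. 1)"
    using AE_start measurable_N[of 0] assms by (intro integral_cong_AE) auto
  then show ?thesis using True by (simp add: prob_space)
next
  case False
  define r where "r = lam * t"
  have r: "0 < r" using False assms rate_N by (simp add: r_def)
  have "expectation (\<lambda>\<omega>. b powr N t \<omega>) = (\<integral>x. b powr x \<partial>distr M borel (N t))"
    using assms by (subst integral_distr) (auto intro: measurable_N)
  also have "\<dots> = (\<integral>n. b ^ n \<partial>measure_pmf (poisson_pmf r))"
    using False assms by (subst distr_N) (auto simp: integral_distr r_def powr_realpow)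
  also have "of_real \<dots> = exp (of_real r * (of_real b - 1) :: complex)"
  proof (rule sums_unique2[OF _ poisson_exp_sums[OF r]])
    have "(\<lambda>n. pmf (poisson_pmf r) n *\<^sub>R b ^ n) sums (\<integral>n. b ^ n \<partial>measure_pmf (poisson_pmf r))"
      using assms by (intro sums_measure_pmf_nat[where B=1]) (auto simp: power_le_one)
    from sums_of_real[OF this, where 'a=complex]
    show "(\<lambda>n. pmf (poisson_pmf r) n *\<^sub>R (of_real b :: complex) ^ n) sums
        complex_of_real (\<integral>n. b ^ n \<partial>measure_pmf (poisson_pmf r))"
      by (simp add: scaleR_conv_of_real)
  qed
  also have "\<dots> = complex_of_real (exp (- (r * (1 - b))))"
    by (simp add: algebra_simps flip: exp_of_real)
  finally show ?thesis by (simp add: r_def of_real_eq_iff)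
qed

lemma integrable_powr_N:
  assumes t: "0 \<le> t" and b: "0 < b" "b \<le> 1"
  shows "integrable M (\<lambda>\<omega>. b powr N t \<omega>)"
proof (rule integrable_const_bound[where B=1])
  show "AE \<omega> in M. norm (b powr N t \<omega>) \<le> 1"
    using AE_N_Nats[OF t]
  proof eventually_elim
    case (elim \<omega>)
    then obtain n where "N t \<omega> = real n" by (auto simp: Nats_def)
    then show ?case using b by (simp add: powr_realpow power_le_one)
  qed
  show "(\<lambda>\<omega>. b powr N t \<omega>) \<in> borel_measurable M" using measurable_N[OF t] by measurable
qed

definition mean_L :: real where
  "mean_L = v + w * a"

lemma mean_L_nonneg: "0 \<le> mean_L"
  using rates_nonneg a_nonneg by (simp add: mean_L_def)

text \<open>The jumps of \<open>L\<close> are not accessible, so sign and mean are taken from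
  another law with the same characteristic function: the time \<open>t\<close> member of the
  semigroup with jumps \<open>1\<close> at rate \<open>v\<close> and \<open>a\<close> at rate
  \<open>w\<close>.\<close>

lemma
  assumes "0 \<le> t"
  shows AE_L_nonneg: "AE \<omega> in M. 0 \<le> L t \<omega>"
    and nn_integral_L: "(\<integral>\<^sup>+\<omega>. ennreal (L t \<omega>) \<partial>M) \<le> ennreal (t * mean_L)"
proof -
  let ?\<Phi> = "\<lambda>z. of_real v * (iexp (z * 1) - 1) + of_real w * (iexp (z * a) - 1)"
  have "subordinator_exponent ?\<Phi> (v * 1 + w * a)"
    using rates_nonneg a_nonneg by (intro subordinator_exponent_add subordinator_exponent_poisson) auto
  then obtain D where D: "real_distribution D" "AE x in D. 0 \<le> x"
      "(\<integral>\<^sup>+x. ennreal x \<partial>D) \<le> ennreal (t * mean_L)" "\<And>z. char D z = exp (of_real t * ?\<Phi> z)"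
    using assms unfolding subordinator_exponent_def mean_L_def by (metis mult.right_neutral)
  have "distr M borel (L t) = D"
  proof (rule Levy_uniqueness)
    show "char (distr M borel (L t)) = char D"
    proof
      fix z
      have "char (distr M borel (L t)) z = (CLINT \<omega>|M. iexp (0 * N t \<omega> + z * L t \<omega>))"
        unfolding char_def using assms measurable_L[of t] by (subst integral_distr) auto
      also have "\<dots> = char D z"
        using assms by (subst char_NL) (auto simp: joint_exponent_def D(4) mult.commute)
      finally show "char (distr M borel (L t)) z = char D z" .
    qed
  qed (use assms D(1) in \<open>auto intro: real_distribution_distr measurable_L\<close>)
  note d = this[symmetric]
  show "AE \<omega> in M. 0 \<le> L t \<omega>"
    using D(2) measurable_L[OF assms] unfolding d by (subst (asm) AE_distr_iff) auto
  show "(\<integral>\<^sup>+\<omega>. ennreal (L t \<omega>) \<partial>M) \<le> ennreal (t * mean_L)"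
    using D(3) measurable_L[OF assms] unfolding d by (subst (asm) nn_integral_distr) auto
qed

text \<open>Almost sure statements can be combined over countably many times only; these sequences
  extend them from rational to all times by right-continuity.\<close>

lemma right_rationals:
  fixes t :: real
  obtains q :: "nat \<Rightarrow> rat" where "\<And>n. t < of_rat (q n)" "(\<lambda>n. of_rat (q n) :: real) \<longlonglongrightarrow> t"
    "filterlim (\<lambda>n. of_rat (q n) :: real) (at_right t) sequentially"
proof -
  have "\<exists>q::rat. t < of_rat q \<and> of_rat q < t + 1 / real (Suc n)" for n
    using of_rat_dense[of t "t + 1 / real (Suc n)"] by simp
  then obtain q :: "nat \<Rightarrow> rat" where q: "\<And>n. t < of_rat (q n)" "\<And>n. of_rat (q n) < t + 1 / real (Suc n)"
    by metis
  have up: "(\<lambda>n. t + 1 / real (Suc n)) \<longlonglongrightarrow> t"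
    using tendsto_add[OF tendsto_const LIMSEQ_Suc[OF lim_inverse_n'], of t] by simp
  have lim: "(\<lambda>n. of_rat (q n) :: real) \<longlonglongrightarrow> t"
    by (rule tendsto_sandwich[OF always_eventually always_eventually tendsto_const[of t] up])
       (use q in \<open>auto intro: less_imp_le\<close>)
  have "filterlim (\<lambda>n. of_rat (q n) :: real) (at_right t) sequentially"
    unfolding filterlim_at
  proof (intro conjI lim always_eventually allI)
    show "of_rat (q n) \<noteq> t" "of_rat (q n) \<in> {t<..}" for n using q(1)[of n] by auto
  qed
  with q(1) lim that show thesis by blast
qed

text \<open>At rational times the increments are almost surely natural numbers, respectively
  nonnegative. Both conditions are closed, so they survive the passage to arbitrary times along
  rationals from the right.\<close>

lemma AE_good_path: "AE \<omega> in M. good_path (\<lambda>t. N t \<omega>) (\<lambda>t. L t \<omega>)"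
proof -
  have "AE \<omega> in M. \<forall>s t :: rat. 0 \<le> s \<longrightarrow> s \<le> t \<longrightarrow>
      N (of_rat t) \<omega> - N (of_rat s) \<omega> \<in> \<nat> \<and> 0 \<le> L (of_rat t) \<omega> - L (of_rat s) \<omega>"
    unfolding AE_all_countable
  proof (intro allI)
    fix s t :: rat
    show "AE \<omega> in M. 0 \<le> s \<longrightarrow> s \<le> t \<longrightarrow>
      N (of_rat t) \<omega> - N (of_rat s) \<omega> \<in> \<nat> \<and> 0 \<le> L (of_rat t) \<omega> - L (of_rat s) \<omega>"
    proof (cases "0 \<le> s \<and> s \<le> t")
      case True
      have c: "closed ({x. fst x \<in> \<nat>} :: (real \<times> real) set)" "closed {x::real \<times> real. 0 \<le> snd x}"
        by (auto intro!: closed_Collect_le continuous_intros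
            closed_vimage[OF closed_Nats continuous_on_fst[OF continuous_on_id], unfolded vimage_def])
      have "{x::real \<times> real. fst x \<in> \<nat> \<and> 0 \<le> snd x} = {x. fst x \<in> \<nat>} \<inter> {x. 0 \<le> snd x}" by auto
      then have "{x::real \<times> real. fst x \<in> \<nat> \<and> 0 \<le> snd x} \<in> sets borel"
        using c by (simp add: borel_closed sets.Int)
      from AE_increment[OF _ _ this, of "of_rat s" "of_rat (t - s)"] True
      show ?thesis
        using AE_N_Nats[of "of_rat (t - s)"] AE_L_nonneg[of "of_rat (t - s)"]
        by (auto simp: of_rat_diff of_rat_less_eq)
    qed auto
  qed
  moreover have "AE \<omega> in M. cadlag (\<lambda>t. (N t \<omega>, L t \<omega>))"
    using levy unfolding levy_process_def by blast
  ultimately show ?thesis using AE_start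
  proof eventually_elim
    case (elim \<omega>)
    note inc = elim(1)[rule_format] and cd = elim(2) and st = elim(3)
    have rc: "((\<lambda>t. N t \<omega>) \<longlongrightarrow> N t \<omega>) (at_right t)" "((\<lambda>t. L t \<omega>) \<longlongrightarrow> L t \<omega>) (at_right t)" if "0 \<le> t" for t
    proof -
      have "((\<lambda>t. (N t \<omega>, L t \<omega>)) \<longlongrightarrow> (N t \<omega>, L t \<omega>)) (at_right t)"
        using cd that unfolding cadlag_def by blast
      from tendsto_fst[OF this] tendsto_snd[OF this]
      show "((\<lambda>t. N t \<omega>) \<longlongrightarrow> N t \<omega>) (at_right t)" "((\<lambda>t. L t \<omega>) \<longlongrightarrow> L t \<omega>) (at_right t)" by auto
    qed
    have ll: "\<exists>x. ((\<lambda>t. N t \<omega>) \<longlongrightarrow> x) (at_left t)" "\<exists>x. ((\<lambda>t. L t \<omega>) \<longlongrightarrow> x) (at_left t)" if "0 < t" for t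
    proof -
      have "\<forall>t>0. \<exists>x. ((\<lambda>t. (N t \<omega>, L t \<omega>)) \<longlongrightarrow> x) (at_left t)"
        using cd unfolding cadlag_def by (rule conjunct2)
      with that obtain x where "((\<lambda>t. (N t \<omega>, L t \<omega>)) \<longlongrightarrow> x) (at_left t)" by (auto simp only:)
      from tendsto_fst[OF this] tendsto_snd[OF this]
      have "((\<lambda>t. N t \<omega>) \<longlongrightarrow> fst x) (at_left t)" "((\<lambda>t. L t \<omega>) \<longlongrightarrow> snd x) (at_left t)" by simp_all
      then show "\<exists>x. ((\<lambda>t. N t \<omega>) \<longlongrightarrow> x) (at_left t)" "\<exists>x. ((\<lambda>t. L t \<omega>) \<longlongrightarrow> x) (at_left t)" by blast+
    qed
    have main: "N t \<omega> - N s \<omega> \<in> \<nat> \<and> 0 \<le> L t \<omega> - L s \<omega>" if st: "0 \<le> s" "s < t" for s t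
    proof -
      obtain p where p: "\<And>n. s < of_rat (p n)" "(\<lambda>n. of_rat (p n) :: real) \<longlonglongrightarrow> s"
        "filterlim (\<lambda>n. of_rat (p n) :: real) (at_right s) sequentially" using right_rationals[of s] by blast
      obtain q where q: "\<And>n. t < of_rat (q n)" "(\<lambda>n. of_rat (q n) :: real) \<longlonglongrightarrow> t"
        "filterlim (\<lambda>n. of_rat (q n) :: real) (at_right t) sequentially" using right_rationals[of t] by blast
      have "eventually (\<lambda>n. of_rat (p n) < t) sequentially" using p(2) st by (intro order_tendstoD)
      then have ev: "eventually (\<lambda>n. N (of_rat (q n)) \<omega> - N (of_rat (p n)) \<omega> \<in> \<nat> \<and>
          0 \<le> L (of_rat (q n)) \<omega> - L (of_rat (p n)) \<omega>) sequentially"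
      proof eventually_elim
        case (elim n)
        have "(of_rat (p n) :: real) \<le> of_rat (q n)" using elim q(1)[of n] by linarith
        moreover have "0 \<le> (of_rat (p n) :: real)" using st p(1)[of n] by linarith
        ultimately show ?case by (intro inc) (simp_all add: of_rat_less_eq)
      qed
      have "(\<lambda>n. N (of_rat (q n)) \<omega> - N (of_rat (p n)) \<omega>) \<longlonglongrightarrow> N t \<omega> - N s \<omega>"
        using st by (intro tendsto_diff filterlim_compose[OF rc(1)] p q) auto
      from Lim_in_closed_set[OF closed_Nats _ _ this] ev
      have "N t \<omega> - N s \<omega> \<in> \<nat>" by (simp add: eventually_conj_iff)
      moreover have "(\<lambda>n. L (of_rat (q n)) \<omega> - L (of_rat (p n)) \<omega>) \<longlonglongrightarrow> L t \<omega> - L s \<omega>"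
        using st by (intro tendsto_diff filterlim_compose[OF rc(2)] p q) auto
      from tendsto_lowerbound[OF this, of 0] ev
      have "0 \<le> L t \<omega> - L s \<omega>" by (simp add: eventually_conj_iff)
      ultimately show ?thesis by simp
    qed
    show ?case
    proof
      show "N t \<omega> - N s \<omega> \<in> \<nat>" if "0 \<le> s" "s \<le> t" for s t
        using main[of s t] that by (cases "s = t") auto
      show "L s \<omega> \<le> L t \<omega>" if "0 \<le> s" "s \<le> t" for s t
        using main[of s t] that by (cases "s = t") auto
      show "cadlag (\<lambda>t. N t \<omega>)" "cadlag (\<lambda>t. L t \<omega>)"
        using rc ll by (auto simp: cadlag_def)
    qed (use st in simp)
  qed
qed

text \<open>On the event that \<open>N\<close> is \<open>0\<close> at all positive integers,
  \<open>(1 / 2) powr N k\<close> equals \<open>1\<close>. Its probability is thus below the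
  expectation of this variable, which tends to \<open>0\<close> with growing
  \<open>k\<close>.\<close>

lemma AE_N_jumps: "AE \<omega> in M. \<exists>k::nat. 0 < k \<and> N (real k) \<omega> \<noteq> 0"
proof -
  define A where "A = {\<omega>\<in>space M. \<forall>k::nat. 0 < k \<longrightarrow> N (real k) \<omega> = 0}"
  have [measurable]: "N (real k) \<in> borel_measurable M" for k by (intro measurable_N) simp
  have A: "A \<in> events" unfolding A_def by measurable
  have "prob A \<le> exp (- (lam * real (Suc k) * (1 - 1 / 2)))" for k
  proof -
    have "prob A = expectation (indicator A)" using A by simp
    also have "\<dots> \<le> expectation (\<lambda>\<omega>. (1 / 2) powr N (real (Suc k)) \<omega>)"
    proof (rule integral_mono_AE)
      show "integrable M (indicator A :: 'a \<Rightarrow> real)"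
        using A by (intro integrable_real_indicator) (simp_all add: emeasure_eq_measure)
      show "integrable M (\<lambda>\<omega>. (1 / 2) powr N (real (Suc k)) \<omega>)" by (intro integrable_powr_N) auto
      show "AE \<omega> in M. indicator A \<omega> \<le> (1 / 2) powr N (real (Suc k)) \<omega>"
        by (rule AE_I2) (auto simp: A_def indicator_def simp del: of_nat_Suc)
    qed
    also have "\<dots> = exp (- (lam * real (Suc k) * (1 - 1 / 2)))" by (subst laplace_N) auto
    finally show ?thesis .
  qed
  moreover have "(\<lambda>k. exp (- (lam * real (Suc k) * (1 - 1 / 2)))) \<longlonglongrightarrow> 0"
  proof -
    have "(\<lambda>k. exp (- (lam / 2)) ^ Suc k) \<longlonglongrightarrow> 0"
      using rate_N by (intro LIMSEQ_Suc LIMSEQ_power_zero) auto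
    moreover have "exp (- (lam / 2)) ^ Suc k = exp (- (lam * real (Suc k) * (1 - 1 / 2)))" for k
      by (subst exp_of_nat_mult[symmetric]) (simp add: algebra_simps)
    ultimately show ?thesis by (simp only:)
  qed
  ultimately have "prob A \<le> 0" by (intro LIMSEQ_le_const) auto
  then have "prob A = 0" by (simp add: measure_le_0_iff)
  then have "AE \<omega> in M. \<omega> \<notin> A" using AE_prob_1[of "space M - A"] prob_compl[OF A] by (auto elim: eventually_mono)
  then show ?thesis
    by (rule AE_mp) (auto simp: A_def)
qed

end

section \<open>Short time asymptotics\<close>

text \<open>Fubini for the joint law, transported back to \<open>M\<close>, so that both
  integrations run over the same space: the inner one averages over the future with the past held
  fixed.\<close>

lemma (in prob_space) expectation_indep_pair:
  fixes f :: "'b \<Rightarrow> 'b \<Rightarrow> complex"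
  assumes ind: "indep_var S X T Y" and f: "case_prod f \<in> borel_measurable (S \<Otimes>\<^sub>M T)"
    and b: "\<And>x y. cmod (f x y) \<le> B"
  shows "(CLINT \<omega>|M. f (X \<omega>) (Y \<omega>)) = (CLINT \<omega>|M. CLINT \<omega>'|M. f (X \<omega>) (Y \<omega>'))"
proof -
  have [measurable]: "X \<in> measurable M S" "Y \<in> measurable M T"
    using ind by (auto dest: indep_var_rv1 indep_var_rv2)
  note [measurable] = f
  interpret X: prob_space "distr M S X" by (rule prob_space_distr) simp
  interpret Y: prob_space "distr M T Y" by (rule prob_space_distr) simp
  interpret P: pair_prob_space "distr M S X" "distr M T Y" ..
  have "(CLINT \<omega>|M. f (X \<omega>) (Y \<omega>)) = (CLINT z|distr M (S \<Otimes>\<^sub>M T) (\<lambda>\<omega>. (X \<omega>, Y \<omega>)). case_prod f z)"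
    by (subst integral_distr) auto
  also have "\<dots> = (CLINT z|distr M S X \<Otimes>\<^sub>M distr M T Y. case_prod f z)"
    using ind by (simp add: indep_var_distribution_eq)
  also have "\<dots> = (CLINT x|distr M S X. CLINT y|distr M T Y. f x y)"
  proof (subst P.integral_fst'[symmetric])
    show "integrable (distr M S X \<Otimes>\<^sub>M distr M T Y) (case_prod f)"
      using b by (intro P.integrable_const_bound[where B=B]) auto
  qed simp
  also have "\<dots> = (CLINT \<omega>|M. CLINT y|distr M T Y. f (X \<omega>) y)"
    by (subst integral_distr) auto
  also have "\<dots> = (CLINT \<omega>|M. CLINT \<omega>'|M. f (X \<omega>) (Y \<omega>'))"
  proof (rule Bochner_Integration.integral_cong[OF refl])
    fix \<omega> assume "\<omega> \<in> space M"
    from measurable_space[OF \<open>X \<in> measurable M S\<close> this] have [simp]: "X \<omega> \<in> space S" .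
    show "(CLINT y|distr M T Y. f (X \<omega>) y) = (CLINT \<omega>'|M. f (X \<omega>) (Y \<omega>'))"
      by (subst integral_distr) auto
  qed
  finally show ?thesis .
qed

lemma (in prob_space) norm_expectation_le_prob:
  fixes f :: "'a \<Rightarrow> complex"
  assumes "f \<in> borel_measurable M" "Measurable.pred M P" "0 \<le> B"
    and "AE \<omega> in M. cmod (f \<omega>) \<le> (if P \<omega> then B else 0)"
  shows "cmod (expectation f) \<le> B * prob {\<omega>\<in>space M. P \<omega>}"
proof -
  note [measurable] = assms(1,2)
  have bd: "AE \<omega> in M. cmod (f \<omega>) \<le> B"
    using assms(4) by (rule eventually_mono) (use assms(3) in \<open>auto split: if_splits\<close>)
  have "cmod (expectation f) \<le> expectation (\<lambda>\<omega>. cmod (f \<omega>))" by (rule integral_norm_bound)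
  also have "\<dots> \<le> expectation (\<lambda>\<omega>. B * indicator {\<omega>\<in>space M. P \<omega>} \<omega>)"
  proof (rule integral_mono_AE)
    show "integrable M (\<lambda>\<omega>. cmod (f \<omega>))"
      using bd by (intro integrable_norm integrable_const_bound[where B=B]) auto
    show "AE \<omega> in M. cmod (f \<omega>) \<le> B * indicator {\<omega>\<in>space M. P \<omega>} \<omega>"
      using assms(4) AE_space by eventually_elim (auto simp: indicator_def)
    show "integrable M (\<lambda>\<omega>. B * indicator {\<omega>\<in>space M. P \<omega>} \<omega>)"
      by (intro integrable_mult_right integrable_real_indicator) (auto simp: emeasure_eq_measure)
  qed
  finally show ?thesis by simp
qed

lemma norm_exp_minus_linear_le:
  assumes "0 \<le> h" "h \<le> 1" "cmod \<psi> \<le> R"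
  shows "cmod (exp (of_real h * \<psi>) - (1 + of_real h * \<psi>)) \<le> exp R * R\<^sup>2 * h\<^sup>2"
proof -
  have R: "0 \<le> R" using assms(3) norm_ge_zero order_trans by blast
  have n: "cmod (of_real h * \<psi>) \<le> h * R" using assms by (simp add: norm_mult mult_left_mono)
  have "\<bar>Re (of_real h * \<psi>)\<bar> \<le> h * R" using abs_Re_le_cmod n order_trans by blast
  also have "\<dots> \<le> 1 * R" using assms R by (intro mult_right_mono) auto
  finally have e: "exp \<bar>Re (of_real h * \<psi>)\<bar> \<le> exp R" by simp
  have "cmod (exp (of_real h * \<psi>) - (\<Sum>k\<le>1. (of_real h * \<psi>) ^ k / fact k))
      \<le> exp \<bar>Re (of_real h * \<psi>)\<bar> * cmod (of_real h * \<psi>) ^ Suc 1 / fact 1"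
    by (rule Taylor_exp)
  also have "\<dots> \<le> exp R * (h * R) ^ 2"
    using e n by (auto intro!: mult_mono power_mono simp flip: power2_eq_square)
  finally show ?thesis by (simp add: power_mult_distrib mult_ac)
qed

context poisson_pair
begin

text \<open>To first order in \<open>h\<close>, the factor \<open>1 - h * kappa z\<close> weighs a
  step in which \<open>N\<close> stays and \<open>h * beta z\<close> one in which it jumps. Divided
  by \<open>u + v + w\<close> they become \<open>1 - q * iexp z\<close> and
  \<open>p + r * iexp (a * z)\<close>, the denominator and the numerator of the characteristic
  function of \<rho>.\<close>

definition kappa :: "real \<Rightarrow> complex" where
  "kappa z = of_real (u + v + w) - of_real v * iexp z"

definition beta :: "real \<Rightarrow> complex" where
  "beta z = of_real u + of_real w * iexp (a * z)"

definition stay :: "real \<Rightarrow> real \<Rightarrow> complex" where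
  "stay h z = (CLINT \<omega>|M. if N h \<omega> = 0 then iexp (z * L h \<omega>) else 0)"

definition leave :: "real \<Rightarrow> real \<Rightarrow> complex" where
  "leave h z = (CLINT \<omega>|M. if N h \<omega> = 0 then 0 else iexp (z * L h \<omega>))"

text \<open>Two Taylor remainders, with the bound \<open>2 * (u + v + w)\<close> for the joint
  exponent, and \<open>lam\<^sup>2\<close> for two jumps of \<open>N\<close>. Estimating
  \<open>stay\<close> costs one remainder, \<open>leave\<close> a second one.\<close>

definition err_const :: real where
  "err_const = 2 * (exp (2 * (u + v + w)) * (2 * (u + v + w))\<^sup>2) + lam\<^sup>2"

lemma err_const_nonneg: "0 \<le> err_const"
  by (simp add: err_const_def)

lemma norm_joint_exponent_le: "cmod (joint_exponent u v w a z1 z2) \<le> 2 * (u + v + w)"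
proof -
  have *: "cmod (of_real x * (iexp y - 1)) \<le> 2 * x" if "0 \<le> x" for x y
    using norm_triangle_ineq4[of "iexp y" 1] that
    by (simp add: norm_mult mult.commute[of 2] mult_left_mono del: of_real_mult)
  have "cmod (joint_exponent u v w a z1 z2) \<le> 2 * u + 2 * v + 2 * w"
    unfolding joint_exponent_def using rates_nonneg by (intro norm_triangle_mono *) auto
  then show ?thesis by simp
qed

text \<open>For \<open>n = 0\<close> and \<open>n = 1\<close> the average of \<open>iexp 0\<close>
  and \<open>iexp (pi * n)\<close> is the indicator of \<open>n = 0\<close>. Hence
  \<open>stay\<close> is the average of two values of the joint characteristic function, up to the
  event \<open>2 \<le> N h\<close>, and each value is expanded to first order in
  \<open>h\<close>.\<close>

lemma
  assumes h: "0 \<le> h" "h \<le> 1"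
  shows stay_estimate: "cmod (stay h z - (1 - of_real h * kappa z)) \<le> err_const * h\<^sup>2"
    and leave_estimate: "cmod (leave h z - of_real h * beta z) \<le> err_const * h\<^sup>2"
proof -
  note [measurable] = measurable_N[OF h(1)] measurable_L[OF h(1)]
  define C1 where "C1 = exp (2 * (u + v + w)) * (2 * (u + v + w))\<^sup>2"
  define J where "J y = joint_exponent u v w a y z" for y
  define E where "E y = (CLINT \<omega>|M. iexp (y * N h \<omega> + z * L h \<omega>))" for y
  define r where "r = (CLINT \<omega>|M. if 2 \<le> N h \<omega> then (iexp (z * L h \<omega>) + iexp (pi * N h \<omega> + z * L h \<omega>)) / 2 else 0)"
  have C1: "0 \<le> C1" by (simp add: C1_def)
  have ec: "err_const = 2 * C1 + lam\<^sup>2" by (simp only: err_const_def C1_def)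
  have E: "cmod (E y - (1 + of_real h * J y)) \<le> C1 * h\<^sup>2" for y
    unfolding E_def J_def C1_def char_NL[OF h(1)]
    by (intro norm_exp_minus_linear_le h norm_joint_exponent_le)
  have nats: "AE \<omega> in M. N h \<omega> \<in> \<nat>" by (rule AE_N_Nats[OF h(1)])
  have int: "integrable M (\<lambda>\<omega>. iexp (y * N h \<omega> + z * L h \<omega>))" for y
    by (intro integrable_iexp) auto
  have "cmod r \<le> 1 * prob {\<omega>\<in>space M. 2 \<le> N h \<omega>}"
    unfolding r_def
  proof (rule norm_expectation_le_prob)
    have "cmod ((iexp x + iexp y) / 2) \<le> 1" for x y
      using norm_triangle_ineq[of "iexp x" "iexp y"] by (simp add: norm_divide)
    then show "AE \<omega> in M. cmod (if 2 \<le> N h \<omega> then (iexp (z * L h \<omega>) + iexp (pi * N h \<omega> + z * L h \<omega>)) / 2 else 0)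
        \<le> (if 2 \<le> N h \<omega> then 1 else 0)" by (auto simp del: of_real_mult of_real_add)
  qed auto
  then have r: "cmod r \<le> lam\<^sup>2 * h\<^sup>2" using prob_N_ge_2[OF h(1)] by (simp add: power_mult_distrib)
  have "stay h z = (CLINT \<omega>|M. (iexp (0 * N h \<omega> + z * L h \<omega>) + iexp (pi * N h \<omega> + z * L h \<omega>)) / 2
      - (if 2 \<le> N h \<omega> then (iexp (z * L h \<omega>) + iexp (pi * N h \<omega> + z * L h \<omega>)) / 2 else 0))"
    unfolding stay_def
  proof (intro integral_cong_AE)
    show "AE \<omega> in M. (if N h \<omega> = 0 then iexp (z * L h \<omega>) else 0) =
      (iexp (0 * N h \<omega> + z * L h \<omega>) + iexp (pi * N h \<omega> + z * L h \<omega>)) / 2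
      - (if 2 \<le> N h \<omega> then (iexp (z * L h \<omega>) + iexp (pi * N h \<omega> + z * L h \<omega>)) / 2 else 0)"
      using nats
    proof eventually_elim
      case (elim \<omega>)
      then obtain n :: nat where n: "N h \<omega> = real n" by (auto simp: Nats_def)
      consider "n = 0" | "n = 1" | "2 \<le> n" by linarith
      then show ?case
      proof cases
        case 2
        have "iexp (pi * N h \<omega> + z * L h \<omega>) = - iexp (z * L h \<omega>)" using 2 n by (simp add: ring_distribs exp_add)
        then show ?thesis using 2 n by simp
      qed (use n in auto)
    qed
  qed auto
  also have "\<dots> = (E 0 + E pi) / 2 - r"
  proof -
    have i2: "integrable M (\<lambda>\<omega>. (if 2 \<le> N h \<omega> then (iexp (z * L h \<omega>) + iexp (pi * N h \<omega> + z * L h \<omega>)) / 2 else 0))"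
    proof (rule integrable_const_bound[where B=1])
      have "cmod ((iexp x + iexp y) / 2) \<le> 1" for x y
        using norm_triangle_ineq[of "iexp x" "iexp y"] by (simp add: norm_divide)
      then show "AE \<omega> in M. cmod (if 2 \<le> N h \<omega> then (iexp (z * L h \<omega>) + iexp (pi * N h \<omega> + z * L h \<omega>)) / 2 else 0) \<le> 1"
        by (auto simp del: of_real_mult of_real_add)
    qed auto
    have i1: "integrable M (\<lambda>\<omega>. (iexp (0 * N h \<omega> + z * L h \<omega>) + iexp (pi * N h \<omega> + z * L h \<omega>)) / 2)"
      by (intro integrable_divide_zero Bochner_Integration.integrable_add int)
    show ?thesis
      unfolding Bochner_Integration.integral_diff[OF i1 i2] r_def E_def
      using Bochner_Integration.integral_add[OF int[of 0] int[of pi]] by simp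
  qed
  finally have stay: "stay h z = (E 0 + E pi) / 2 - r" .
  \<comment> \<open>At frequency \<open>pi\<close> a jump of \<open>N\<close> contributes the factor
    \<open>-1\<close>. In the average the terms with \<open>w * iexp (a * z)\<close> cancel and
    \<open>- u - w\<close> remains.\<close>
  have sum: "(J 0 + J pi) / 2 = - kappa z" "J 0 + kappa z = beta z"
    by (simp_all add: J_def joint_exponent_def kappa_def beta_def ring_distribs exp_add mult_ac)
  have "stay h z - (1 - of_real h * kappa z) =
      ((E 0 - (1 + of_real h * J 0)) + (E pi - (1 + of_real h * J pi))) / 2 - r"
  proof -
    have k: "kappa z = - ((J 0 + J pi) / 2)" using sum(1) by (simp only: minus_minus)
    show ?thesis unfolding stay k by (simp add: field_simps)
  qed
  also have "cmod \<dots> \<le> cmod (((E 0 - (1 + of_real h * J 0)) + (E pi - (1 + of_real h * J pi))) / 2) + cmod r"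
    by (rule norm_triangle_ineq4)
  also have "\<dots> \<le> C1 * h\<^sup>2 + lam\<^sup>2 * h\<^sup>2"
    using E[of 0] E[of pi] r norm_triangle_ineq[of "E 0 - (1 + of_real h * J 0)" "E pi - (1 + of_real h * J pi)"]
    by (simp add: norm_divide)
  finally have s: "cmod (stay h z - (1 - of_real h * kappa z)) \<le> (C1 + lam\<^sup>2) * h\<^sup>2"
    by (simp add: ring_distribs)
  also have "\<dots> \<le> err_const * h\<^sup>2"
    using C1 by (intro mult_right_mono) (auto simp: ec)
  finally show "cmod (stay h z - (1 - of_real h * kappa z)) \<le> err_const * h\<^sup>2" .
  \<comment> \<open>The event of a jump is handled as the complement: the two parts add up to the
    characteristic function of \<open>L h\<close>.\<close>
  have "stay h z + leave h z = (CLINT \<omega>|M. (if N h \<omega> = 0 then iexp (z * L h \<omega>) else 0) +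
      (if N h \<omega> = 0 then 0 else iexp (z * L h \<omega>)))"
    unfolding stay_def leave_def
    by (intro Bochner_Integration.integral_add[symmetric] integrable_const_bound[where B=1]) auto
  also have "\<dots> = E 0" unfolding E_def by (intro Bochner_Integration.integral_cong) auto
  finally have "leave h z - of_real h * beta z = (E 0 - (1 + of_real h * J 0)) - (stay h z - (1 - of_real h * kappa z))"
    unfolding sum(2)[symmetric] by (simp add: algebra_simps)
  also have "cmod \<dots> \<le> cmod (E 0 - (1 + of_real h * J 0)) + cmod (stay h z - (1 - of_real h * kappa z))"
    by (rule norm_triangle_ineq4)
  also have "\<dots> \<le> C1 * h\<^sup>2 + (C1 + lam\<^sup>2) * h\<^sup>2" using E[of 0] s by simp
  also have "\<dots> = err_const * h\<^sup>2" by (simp add: err_const_def C1_def algebra_simps)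
  finally show "cmod (leave h z - of_real h * beta z) \<le> err_const * h\<^sup>2" .
qed

definition increment :: "real \<Rightarrow> nat \<Rightarrow> 'a \<Rightarrow> real \<times> real" where
  "increment h i \<omega> = (N (real (Suc i) * h) \<omega> - N (real i * h) \<omega>, L (real (Suc i) * h) \<omega> - L (real i * h) \<omega>)"

lemma indep_vars_increment:
  assumes "0 \<le> h"
  shows "indep_vars (\<lambda>_. borel \<Otimes>\<^sub>M borel) (increment h) {..<n}"
proof -
  have "\<forall>n (\<tau> :: nat \<Rightarrow> real). 0 \<le> \<tau> 0 \<and> (\<forall>i<n. \<tau> i \<le> \<tau> (Suc i)) \<longrightarrow>
        indep_vars (\<lambda>_. borel)
          (\<lambda>i \<omega>. (N (\<tau> (Suc i)) \<omega>, L (\<tau> (Suc i)) \<omega>) - (N (\<tau> i) \<omega>, L (\<tau> i) \<omega>)) {..<n}"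
    using levy unfolding levy_process_def by blast
  from this[rule_format, of "\<lambda>i. real i * h" n] assms
  show ?thesis unfolding increment_def[abs_def] borel_prod
    by (simp add: mult_right_mono del: of_nat_Suc)
qed

lemma measurable_increment_mesh:
  "0 \<le> h \<Longrightarrow> increment h i \<in> measurable M (borel \<Otimes>\<^sub>M borel)"
  using indep_vars_increment[of h "Suc i"] unfolding indep_vars_def by auto

lemma integral_increment_mesh:
  fixes f :: "real \<Rightarrow> real \<Rightarrow> 'c::{banach, second_countable_topology}"
  assumes "0 \<le> h" "case_prod f \<in> borel_measurable (borel \<Otimes>\<^sub>M borel)"
  shows "(\<integral>\<omega>. case_prod f (increment h i \<omega>) \<partial>M) = (\<integral>\<omega>. f (N h \<omega>) (L h \<omega>) \<partial>M)"
proof -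
  have "real (Suc i) * h = real i * h + h" by (simp add: ring_distribs)
  then show ?thesis
    using integral_increment[of "real i * h" h "case_prod f"] assms
    unfolding increment_def borel_prod by simp
qed

end

section \<open>The stochastic integral\<close>

text \<open>\<open>N\<close> and the Riemann sum as functions of the sequence of increments alone.
  In this form the dependence on the first \<open>k\<close> increments is explicit and the
  independence of the next one can be used.\<close>

definition nsum :: "(nat \<Rightarrow> real \<times> real) \<Rightarrow> nat \<Rightarrow> real" where
  "nsum x j = (\<Sum>i<j. fst (x i))"

definition ssum :: "real \<Rightarrow> (nat \<Rightarrow> real \<times> real) \<Rightarrow> nat \<Rightarrow> real" where
  "ssum c x j = (\<Sum>i<j. c powr (- nsum x i) * snd (x i))"

lemma nsum_Suc: "nsum x (Suc j) = nsum x j + fst (x j)"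
  and ssum_Suc: "ssum c x (Suc j) = ssum c x j + c powr (- nsum x j) * snd (x j)"
  by (simp_all add: nsum_def ssum_def)

lemma nsum_restrict: "j \<le> k \<Longrightarrow> nsum (restrict x {..<k}) j = nsum x j"
  by (simp add: nsum_def)

lemma ssum_restrict: "j \<le> k \<Longrightarrow> ssum c (restrict x {..<k}) j = ssum c x j"
  by (simp add: ssum_def nsum_restrict)

lemma measurable_nsum:
  assumes "j \<le> k"
  shows "(\<lambda>x. nsum x j) \<in> borel_measurable (PiM {..<k} (\<lambda>_. borel \<Otimes>\<^sub>M borel))"
  unfolding nsum_def
proof (rule borel_measurable_sum)
  fix i assume "i \<in> {..<j}"
  then have "(\<lambda>x. x i) \<in> measurable (PiM {..<k} (\<lambda>_. borel \<Otimes>\<^sub>M borel)) (borel \<Otimes>\<^sub>M borel)"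
    using assms by (intro measurable_component_singleton) auto
  then show "(\<lambda>x. fst (x i)) \<in> borel_measurable (PiM {..<k} (\<lambda>_. borel \<Otimes>\<^sub>M borel))"
    by (rule measurable_compose[OF _ measurable_fst])
qed

lemma measurable_ssum:
  "(\<lambda>x. ssum c x k) \<in> borel_measurable (PiM {..<k} (\<lambda>_. borel \<Otimes>\<^sub>M borel))"
  unfolding ssum_def
proof (rule borel_measurable_sum)
  fix i assume i: "i \<in> {..<k}"
  then have "(\<lambda>x. x i) \<in> measurable (PiM {..<k} (\<lambda>_. borel \<Otimes>\<^sub>M borel)) (borel \<Otimes>\<^sub>M borel)"
    by (intro measurable_component_singleton)
  from measurable_compose[OF this measurable_snd]
  have [measurable]: "(\<lambda>x. snd (x i)) \<in> borel_measurable (PiM {..<k} (\<lambda>_. borel \<Otimes>\<^sub>M borel))" .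
  have [measurable]: "(\<lambda>x. nsum x i) \<in> borel_measurable (PiM {..<k} (\<lambda>_. borel \<Otimes>\<^sub>M borel))"
    using i by (intro measurable_nsum) auto
  show "(\<lambda>x. c powr (- nsum x i) * snd (x i)) \<in> borel_measurable (PiM {..<k} (\<lambda>_. borel \<Otimes>\<^sub>M borel))"
    by measurable
qed

context poisson_pair
begin

abbreviation "path_sum c \<omega> \<equiv> riemann_sum (\<lambda>t. N t \<omega>) (\<lambda>t. L t \<omega>) c"

lemma nsum_increment: "nsum (\<lambda>i. increment h i \<omega>) j = N (real j * h) \<omega> - N 0 \<omega>"
  using sum_lessThan_telescope[of "\<lambda>i. N (real i * h) \<omega>" j] by (simp add: nsum_def increment_def)

lemma ssum_increment:
  assumes "N 0 \<omega> = 0"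
  shows "ssum c (\<lambda>i. increment h i \<omega>) j = path_sum c \<omega> h j"
  by (simp add: ssum_def riemann_sum_def nsum_increment assms) (simp add: increment_def)

end

text \<open>The hypothesis on \<open>F\<close> says that \<open>iexp (z * Z t) * F (z * c powr (- N t))\<close> is a martingale,
  where \<open>Z\<close> is the stochastic integral.\<close>

locale mu_char = poisson_pair +
  fixes c :: real and F :: "real \<Rightarrow> complex"
  assumes c: "1 < c"
    and F_meas [measurable]: "F \<in> borel_measurable borel"
    and F_le_1: "\<And>z. cmod (F z) \<le> 1"
    and F_eq: "\<And>z. beta z * F (z / c) = kappa z * F z"
begin

text \<open>The operator of one time step of length \<open>h\<close> acting on \<open>F\<close>, at
  the current frequency \<open>y\<close>.\<close>

definition step :: "real \<Rightarrow> real \<Rightarrow> complex" where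
  "step h y = (CLINT \<omega>|M. iexp (y * L h \<omega>) * F (y * c powr (- N h \<omega>)))"

text \<open>One \<open>err_const\<close> each for \<open>stay\<close> and \<open>leave\<close>, and
  twice the bound for two jumps, since two values of \<open>F\<close> differ by at most
  \<open>2\<close>.\<close>

definition step_const :: real where
  "step_const = 2 * err_const + 2 * lam\<^sup>2"

text \<open>Without a jump the argument of \<open>F\<close> is \<open>y\<close>, with one jump it is
  \<open>y / c\<close>. The terms of order \<open>h\<close> are
  \<open>beta y * F (y / c) - kappa y * F y\<close>, which vanishes by \<open>F_eq\<close>.\<close>

lemma step_estimate:
  assumes h: "0 \<le> h" "h \<le> 1"
  shows "cmod (step h y - F y) \<le> step_const * h\<^sup>2"
proof -
  note [measurable] = measurable_N[OF h(1)] measurable_L[OF h(1)]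
  let ?s = "\<lambda>\<omega>. if N h \<omega> = 0 then iexp (y * L h \<omega>) else 0"
  let ?l = "\<lambda>\<omega>. if N h \<omega> = 0 then 0 else iexp (y * L h \<omega>)"
  \<comment> \<open>Corrects the value \<open>F (y / c)\<close>, which the main part uses for any
    number of jumps, on the event of two or more.\<close>
  let ?r = "\<lambda>\<omega>. if 2 \<le> N h \<omega> then iexp (y * L h \<omega>) * (F (y * c powr (- N h \<omega>)) - F (y / c)) else 0"
  have b: "cmod (?r \<omega>) \<le> (if 2 \<le> N h \<omega> then 2 else 0)" for \<omega>
    using norm_triangle_ineq4[of "F (y * c powr (- N h \<omega>))" "F (y / c)"] F_le_1[of "y * c powr (- N h \<omega>)"] F_le_1[of "y / c"]
    by (auto simp: norm_mult simp del: of_real_mult)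
  have "cmod (expectation ?r) \<le> 2 * prob {\<omega>\<in>space M. 2 \<le> N h \<omega>}"
    using b by (intro norm_expectation_le_prob) auto
  also have "\<dots> \<le> 2 * (lam\<^sup>2 * h\<^sup>2)"
    using prob_N_ge_2[OF h(1)] by (simp add: power_mult_distrib)
  finally have r: "cmod (expectation ?r) \<le> 2 * lam\<^sup>2 * h\<^sup>2" by simp
  have int: "integrable M ?s" "integrable M ?l"
    by (auto intro!: integrable_const_bound[where B=1])
  have b2: "cmod (?r \<omega>) \<le> 2" for \<omega>
    by (rule order_trans[OF b]) simp
  have intr: "integrable M ?r"
    by (rule integrable_const_bound[where B=2, OF AE_I2[OF b2]]) measurable
  have "step h y = (CLINT \<omega>|M. (?s \<omega> * F y + ?l \<omega> * F (y / c)) + ?r \<omega>)"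
    unfolding step_def
  proof (intro integral_cong_AE)
    show "AE \<omega> in M. iexp (y * L h \<omega>) * F (y * c powr (- N h \<omega>)) = (?s \<omega> * F y + ?l \<omega> * F (y / c)) + ?r \<omega>"
      using AE_N_Nats[OF h(1)]
    proof eventually_elim
      case (elim \<omega>)
      then obtain n :: nat where n: "N h \<omega> = real n" by (auto simp: Nats_def)
      consider "n = 0" | "n = 1" | "2 \<le> n" by linarith
      then show ?case
      proof cases
        case 2
        then show ?thesis using n c by (simp add: powr_minus divide_inverse)
      qed (use n c in \<open>auto simp: algebra_simps\<close>)
    qed
  qed auto
  also have "\<dots> = (stay h y * F y + leave h y * F (y / c)) + expectation ?r"
    using int intr by (simp add: stay_def leave_def)
  finally have step: "step h y = (stay h y * F y + leave h y * F (y / c)) + expectation ?r" .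
  have "step h y - F y = (stay h y - (1 - of_real h * kappa y)) * F y + (leave h y - of_real h * beta y) * F (y / c) + expectation ?r
      + of_real h * (beta y * F (y / c) - kappa y * F y)"
    unfolding step by (simp add: algebra_simps)
  also have "\<dots> = (stay h y - (1 - of_real h * kappa y)) * F y + (leave h y - of_real h * beta y) * F (y / c) + expectation ?r"
    by (simp add: F_eq)
  also have "cmod \<dots> \<le> err_const * h\<^sup>2 * 1 + err_const * h\<^sup>2 * 1 + 2 * lam\<^sup>2 * h\<^sup>2"
    using r stay_estimate[OF h] leave_estimate[OF h] F_le_1 err_const_nonneg
    by (intro norm_triangle_mono norm_mult_ineq[THEN order_trans] mult_mono) auto
  finally show ?thesis by (simp add: step_const_def algebra_simps)
qed

definition mesh_value :: "real \<Rightarrow> real \<Rightarrow> nat \<Rightarrow> complex" where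
  "mesh_value h z k = (CLINT \<omega>|M. iexp (z * ssum c (\<lambda>i. increment h i \<omega>) k) *
      F (z * c powr (- nsum (\<lambda>i. increment h i \<omega>) k)))"

lemma measurable_increments:
  assumes "0 \<le> h"
  shows "(\<lambda>\<omega>. \<lambda>i\<in>{..<k}. increment h i \<omega>) \<in> measurable M (PiM {..<k} (\<lambda>_. borel \<Otimes>\<^sub>M borel))"
  by (intro measurable_restrict measurable_increment_mesh assms)

lemma measurable_nsum_increment:
  assumes "0 \<le> h"
  shows "(\<lambda>\<omega>. nsum (\<lambda>i. increment h i \<omega>) k) \<in> borel_measurable M"
    and "(\<lambda>\<omega>. ssum c (\<lambda>i. increment h i \<omega>) k) \<in> borel_measurable M"
  using measurable_compose[OF measurable_increments[OF assms] measurable_nsum[OF order_refl], of k]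
    measurable_compose[OF measurable_increments[OF assms] measurable_ssum[of c k]]
  by (simp_all add: nsum_restrict ssum_restrict)

text \<open>Conditionally on the first \<open>k\<close> increments the last one acts as a single
  step at the frequency \<open>z * c powr (- nsum)\<close>. The error of a step is uniform in the
  frequency, so the past only contributes factors of modulus \<open>1\<close>.\<close>

lemma mesh_value_step:
  assumes h: "0 \<le> h" "h \<le> 1"
  shows "cmod (mesh_value h z (Suc k) - mesh_value h z k) \<le> step_const * h\<^sup>2"
proof -
  let ?B = "\<lambda>_::nat. borel \<Otimes>\<^sub>M borel :: (real \<times> real) measure"
  let ?S = "PiM {..<k} ?B" and ?T = "PiM {k} ?B"
  let ?W = "\<lambda>\<omega> i. increment h i \<omega>"
  note [measurable] = measurable_nsum_increment[OF h(1), of k]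
  define g where "g y x = iexp (y * snd x) * F (y * c powr (- fst x))" for y and x :: "real \<times> real"
  \<comment> \<open>\<open>x\<close> carries the past and \<open>y\<close> the last increment; the
    past enters the second factor only through the frequency.\<close>
  define f where "f x y = iexp (z * ssum c x k) * g (z * c powr (- nsum x k)) (y k)" for x y :: "nat \<Rightarrow> real \<times> real"
  have ind: "indep_var ?S (\<lambda>\<omega>. restrict (?W \<omega>) {..<k}) ?T (\<lambda>\<omega>. restrict (?W \<omega>) {k})"
    by (rule indep_var_restrict[OF indep_vars_increment[OF h(1), of "Suc k"]]) auto
  have "mesh_value h z (Suc k) = (CLINT \<omega>|M. f (restrict (?W \<omega>) {..<k}) (restrict (?W \<omega>) {k}))"
    unfolding mesh_value_def f_def g_def
    by (intro Bochner_Integration.integral_cong)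
       (simp_all add: nsum_restrict ssum_restrict nsum_Suc ssum_Suc exp_add powr_add[symmetric] algebra_simps)
  also have "\<dots> = (CLINT \<omega>|M. CLINT \<omega>'|M. f (restrict (?W \<omega>) {..<k}) (restrict (?W \<omega>') {k}))"
  proof (rule expectation_indep_pair[OF ind, where B=1])
    have [measurable]: "(\<lambda>x. nsum x k) \<in> borel_measurable ?S" "(\<lambda>x. ssum c x k) \<in> borel_measurable ?S"
      by (auto intro: measurable_nsum measurable_ssum)
    have [measurable]: "(\<lambda>x. x k) \<in> measurable ?T (borel \<Otimes>\<^sub>M borel)"
      by (rule measurable_component_singleton) simp
    show "case_prod f \<in> borel_measurable (?S \<Otimes>\<^sub>M ?T)"
      unfolding f_def g_def by measurable
    show "cmod (f x y) \<le> 1" for x y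
      using F_le_1 by (simp add: f_def g_def norm_mult del: of_real_mult)
  qed
  also have "\<dots> = (CLINT \<omega>|M. iexp (z * ssum c (?W \<omega>) k) * step h (z * c powr (- nsum (?W \<omega>) k)))"
  proof (rule Bochner_Integration.integral_cong[OF refl])
    fix \<omega>
    have "(CLINT \<omega>'|M. g y (increment h k \<omega>')) = step h y" for y
      using integral_increment_mesh[OF h(1), of "\<lambda>p q. g y (p, q)" k]
      unfolding step_def g_def by (simp add: case_prod_beta)
    then show "(CLINT \<omega>'|M. f (restrict (?W \<omega>) {..<k}) (restrict (?W \<omega>') {k})) =
        iexp (z * ssum c (?W \<omega>) k) * step h (z * c powr (- nsum (?W \<omega>) k))"
      by (simp add: f_def nsum_restrict ssum_restrict)
  qed
  finally have *: "mesh_value h z (Suc k) = \<dots>" .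
  note [measurable] = measurable_N[OF h(1)] measurable_L[OF h(1)]
  have [measurable]: "step h \<in> borel_measurable borel"
    unfolding step_def by measurable
  have st: "cmod (step h y) \<le> 1" for y
  proof -
    have "cmod (step h y) \<le> 1 * prob {\<omega>\<in>space M. True}"
      unfolding step_def by (intro norm_expectation_le_prob) (auto simp: norm_mult F_le_1 simp del: of_real_mult)
    then show ?thesis by (simp add: prob_space)
  qed
  have int: "integrable M (\<lambda>\<omega>. iexp (z * ssum c (?W \<omega>) k) * step h (z * c powr (- nsum (?W \<omega>) k)))"
     "integrable M (\<lambda>\<omega>. iexp (z * ssum c (?W \<omega>) k) * F (z * c powr (- nsum (?W \<omega>) k)))"
    using st F_le_1 by (auto intro!: integrable_const_bound[where B=1] simp: norm_mult simp del: of_real_mult)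
  have "cmod (mesh_value h z (Suc k) - mesh_value h z k) = cmod (CLINT \<omega>|M.
     iexp (z * ssum c (?W \<omega>) k) * (step h (z * c powr (- nsum (?W \<omega>) k)) - F (z * c powr (- nsum (?W \<omega>) k))))"
    unfolding * mesh_value_def[of h z k] right_diff_distrib Bochner_Integration.integral_diff[OF int] ..
  also have "\<dots> \<le> step_const * h\<^sup>2 * prob {\<omega>\<in>space M. True}"
  proof (rule norm_expectation_le_prob)
    show "0 \<le> step_const * h\<^sup>2" using step_estimate[OF h, of 0] norm_ge_zero order_trans by blast
    show "AE \<omega> in M. cmod (iexp (z * ssum c (?W \<omega>) k) * (step h (z * c powr (- nsum (?W \<omega>) k)) - F (z * c powr (- nsum (?W \<omega>) k))))
        \<le> (if True then step_const * h\<^sup>2 else 0)"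
      using step_estimate[OF h] by (simp add: norm_mult del: of_real_mult)
  qed auto
  finally show ?thesis by (simp add: prob_space)
qed

text \<open>Local errors add up; over a fixed time the number of steps is of order
  \<open>1 / h\<close>, so the total error is of order \<open>h\<close>.\<close>

lemma mesh_value_estimate:
  assumes h: "0 \<le> h" "h \<le> 1"
  shows "cmod (mesh_value h z k - F z) \<le> real k * step_const * h\<^sup>2"
proof (induction k)
  case 0
  then show ?case using c by (simp add: mesh_value_def nsum_def ssum_def prob_space)
next
  case (Suc k)
  have "cmod (mesh_value h z (Suc k) - F z) \<le> cmod (mesh_value h z (Suc k) - mesh_value h z k) + cmod (mesh_value h z k - F z)"
    using norm_triangle_ineq[of "mesh_value h z (Suc k) - mesh_value h z k" "mesh_value h z k - F z"] by simp
  with Suc mesh_value_step[OF h, of z k] show ?case by (simp add: algebra_simps)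
qed

end

section \<open>Existence of the integral over the whole half line\<close>

context poisson_pair
begin

text \<open>Measurable by construction, as a limit of Riemann sums, and almost surely equal to the
  pathwise integral up to the integer time \<open>k\<close>.\<close>

definition integral_version :: "real \<Rightarrow> nat \<Rightarrow> 'a \<Rightarrow> real" where
  "integral_version c k \<omega> = lim (\<lambda>m. path_sum c \<omega> (mesh m) (k * 2 ^ m))"

lemma measurable_riemann_sum:
  assumes "0 \<le> h"
  shows "(\<lambda>\<omega>. path_sum c \<omega> h k) \<in> borel_measurable M"
proof -
  have [measurable]: "N (real j * h) \<in> borel_measurable M" "L (real j * h) \<in> borel_measurable M" for j
    using assms by (auto intro: measurable_N measurable_L)
  show ?thesis unfolding riemann_sum_def by measurable
qed

lemma measurable_integral_version: "integral_version c k \<in> borel_measurable M"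
  unfolding integral_version_def
  by (intro borel_measurable_lim_metric measurable_riemann_sum) (simp add: less_imp_le)

lemma AE_integral_version:
  assumes c: "1 < c"
  shows "AE \<omega> in M. \<forall>k. (\<lambda>m. path_sum c \<omega> (mesh m) (k * 2 ^ m)) \<longlonglongrightarrow> integral_version c k \<omega> \<and>
     integral_version c k \<omega> = stieltjes_integral c (\<lambda>t. N t \<omega>) (\<lambda>t. L t \<omega>) (real k)"
  using AE_good_path
proof eventually_elim
  case (elim \<omega>)
  then interpret good_path "\<lambda>t. N t \<omega>" "\<lambda>t. L t \<omega>" .
  show ?case
    unfolding integral_version_def limI[OF riemann_sum_tendsto(1)[OF c]]
    using riemann_sum_tendsto(1)[OF c] by blast
qed

text \<open>The bound is uniform in mesh and horizon. The discount at the left end is independent of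
  the increment of \<open>L\<close> that follows and has mean \<open>exp (- (d * t))\<close>; the
  increments have mean at most \<open>h * mean_L\<close>. What remains is a geometric series with
  ratio \<open>exp (- (d * h))\<close>.\<close>

lemma nn_integral_riemann_sum:
  assumes c: "1 < c" and h: "0 < h" "h \<le> 1"
  defines "d \<equiv> lam * (1 - 1 / c)"
  shows "(\<integral>\<^sup>+\<omega>. ennreal (path_sum c \<omega> h k) \<partial>M) \<le> ennreal (mean_L * (1 + d) / d)"
proof -
  have d: "0 < d" using c rate_N by (simp add: d_def)
  have [measurable]: "N (real j * h) \<in> borel_measurable M" "L (real j * h) \<in> borel_measurable M" for j
    using h by (auto intro: measurable_N measurable_L)
  have [measurable]: "N 0 \<in> borel_measurable M" "N h \<in> borel_measurable M" "L h \<in> borel_measurable M"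
    using h by (auto intro: measurable_N measurable_L)
  have summand: "(\<integral>\<^sup>+\<omega>. ennreal (c powr (- N (real j * h) \<omega>) * (L (real (Suc j) * h) \<omega> - L (real j * h) \<omega>)) \<partial>M)
      \<le> ennreal (exp (- (d * h)) ^ j * (h * mean_L))" for j
  proof -
    define t where "t = real j * h"
    have t: "0 \<le> t" "real (Suc j) * h = t + h" using h by (auto simp: t_def ring_distribs)
    have [measurable]: "N t \<in> borel_measurable M" "L t \<in> borel_measurable M" "L (t + h) \<in> borel_measurable M" "N (t + h) \<in> borel_measurable M"
      using t h by (auto intro: measurable_N measurable_L)
    \<comment> \<open>The times \<open>0\<close>, \<open>t\<close>, \<open>t + h\<close>: the first
      increment supplies the discount factor, the second the increment of \<open>L\<close>.\<close>
    define \<tau> where "\<tau> i = (if i = 0 then 0 else if i = Suc 0 then t else t + h)" for i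
    define Y where "Y i x = (if i = 0 then c powr (- fst x) else max 0 (snd x))" for i :: nat and x :: "real \<times> real"
    have "indep_vars (\<lambda>_. borel) (\<lambda>i \<omega>. (N (\<tau> (Suc i)) \<omega>, L (\<tau> (Suc i)) \<omega>) - (N (\<tau> i) \<omega>, L (\<tau> i) \<omega>)) {..<2}"
    proof -
      have "\<forall>n (\<tau> :: nat \<Rightarrow> real). 0 \<le> \<tau> 0 \<and> (\<forall>i<n. \<tau> i \<le> \<tau> (Suc i)) \<longrightarrow>
        indep_vars (\<lambda>_. borel)
          (\<lambda>i \<omega>. (N (\<tau> (Suc i)) \<omega>, L (\<tau> (Suc i)) \<omega>) - (N (\<tau> i) \<omega>, L (\<tau> i) \<omega>)) {..<n}"
        using levy unfolding levy_process_def by blast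
      from this[rule_format, of \<tau> 2] show ?thesis using t h by (simp add: \<tau>_def)
    qed
    then have "indep_vars (\<lambda>_. borel \<Otimes>\<^sub>M borel) (\<lambda>i \<omega>. (N (\<tau> (Suc i)) \<omega> - N (\<tau> i) \<omega>, L (\<tau> (Suc i)) \<omega> - L (\<tau> i) \<omega>)) {..<2}"
      by (simp add: borel_prod)
    then have ind: "indep_vars (\<lambda>_. borel) (\<lambda>i \<omega>. ennreal (Y i (N (\<tau> (Suc i)) \<omega> - N (\<tau> i) \<omega>, L (\<tau> (Suc i)) \<omega> - L (\<tau> i) \<omega>))) {..<2}"
      by (rule indep_vars_compose2) (simp add: Y_def)
    have "(\<integral>\<^sup>+\<omega>. ennreal (c powr (- N t \<omega>) * (L (t + h) \<omega> - L t \<omega>)) \<partial>M) =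
        (\<integral>\<^sup>+\<omega>. (\<Prod>i<2. ennreal (Y i (N (\<tau> (Suc i)) \<omega> - N (\<tau> i) \<omega>, L (\<tau> (Suc i)) \<omega> - L (\<tau> i) \<omega>))) \<partial>M)"
    proof (rule nn_integral_cong_AE)
      show "AE \<omega> in M. ennreal (c powr (- N t \<omega>) * (L (t + h) \<omega> - L t \<omega>)) =
         (\<Prod>i<2. ennreal (Y i (N (\<tau> (Suc i)) \<omega> - N (\<tau> i) \<omega>, L (\<tau> (Suc i)) \<omega> - L (\<tau> i) \<omega>)))"
        using AE_good_path
      proof eventually_elim
        case (elim \<omega>)
        then interpret good_path "\<lambda>t. N t \<omega>" "\<lambda>t. L t \<omega>" .
        have "L t \<omega> \<le> L (t + h) \<omega>" using l_incr[of t "t + h"] t h by simp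
        then show ?case using n0 by (simp add: numeral_2_eq_2 Y_def \<tau>_def ennreal_mult)
      qed
    qed
    also have "\<dots> = (\<Prod>i<2. \<integral>\<^sup>+\<omega>. ennreal (Y i (N (\<tau> (Suc i)) \<omega> - N (\<tau> i) \<omega>, L (\<tau> (Suc i)) \<omega> - L (\<tau> i) \<omega>)) \<partial>M)"
      by (rule indep_vars_nn_integral[OF _ ind]) auto
    also have "\<dots> = (\<integral>\<^sup>+\<omega>. ennreal (c powr (- (N t \<omega> - N 0 \<omega>))) \<partial>M) * (\<integral>\<^sup>+\<omega>. ennreal (max 0 (L (t + h) \<omega> - L t \<omega>)) \<partial>M)"
      by (simp add: numeral_2_eq_2 Y_def \<tau>_def)
    also have "(\<integral>\<^sup>+\<omega>. ennreal (c powr (- (N t \<omega> - N 0 \<omega>))) \<partial>M) = (\<integral>\<^sup>+\<omega>. ennreal ((1 / c) powr N t \<omega>) \<partial>M)"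
      using AE_start c by (intro nn_integral_cong_AE) (auto elim!: eventually_mono simp: powr_minus_divide powr_divide)
    also have "\<dots> = ennreal (expectation (\<lambda>\<omega>. (1 / c) powr N t \<omega>))"
    proof (rule nn_integral_eq_integral)
      show "integrable M (\<lambda>\<omega>. (1 / c) powr N t \<omega>)" using t c by (intro integrable_powr_N) auto
    qed simp
    also have "\<dots> = ennreal (exp (- (d * h)) ^ j)"
      using laplace_N[OF t(1), of "1 / c"] c by (subst exp_of_nat_mult[symmetric]) (simp add: d_def t_def mult_ac)
    also have "(\<integral>\<^sup>+\<omega>. ennreal (max 0 (L (t + h) \<omega> - L t \<omega>)) \<partial>M) = (\<integral>\<^sup>+\<omega>. ennreal (max 0 (L h \<omega>)) \<partial>M)"
      using nn_integral_increment[OF t(1), of h "\<lambda>x. ennreal (max 0 (snd x))"] h by (simp add: borel_prod[symmetric])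
    also have "\<dots> = (\<integral>\<^sup>+\<omega>. ennreal (L h \<omega>) \<partial>M)"
      by (intro nn_integral_cong) (simp add: max_def ennreal_neg)
    finally have "(\<integral>\<^sup>+\<omega>. ennreal (c powr (- N t \<omega>) * (L (t + h) \<omega> - L t \<omega>)) \<partial>M) =
        ennreal (exp (- (d * h)) ^ j) * (\<integral>\<^sup>+\<omega>. ennreal (L h \<omega>) \<partial>M)" .
    also have "\<dots> \<le> ennreal (exp (- (d * h)) ^ j) * ennreal (h * mean_L)"
      using h by (intro mult_left_mono nn_integral_L) auto
    finally show ?thesis unfolding t t_def[symmetric] by (simp add: ennreal_mult')
  qed
  have "(\<integral>\<^sup>+\<omega>. ennreal (path_sum c \<omega> h k) \<partial>M) \<le>
      (\<integral>\<^sup>+\<omega>. (\<Sum>j<k. ennreal (c powr (- N (real j * h) \<omega>) * (L (real (Suc j) * h) \<omega> - L (real j * h) \<omega>))) \<partial>M)"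
  proof (rule nn_integral_mono_AE)
    show "AE \<omega> in M. ennreal (path_sum c \<omega> h k) \<le>
      (\<Sum>j<k. ennreal (c powr (- N (real j * h) \<omega>) * (L (real (Suc j) * h) \<omega> - L (real j * h) \<omega>)))"
      using AE_good_path
    proof eventually_elim
      case (elim \<omega>)
      then interpret good_path "\<lambda>t. N t \<omega>" "\<lambda>t. L t \<omega>" .
      have "L (real j * h) \<omega> \<le> L (real (Suc j) * h) \<omega>" for j
        using h by (intro l_incr mult_right_mono) auto
      then show ?case unfolding riemann_sum_def by (subst sum_ennreal) (auto simp del: of_nat_Suc)
    qed
  qed
  also have "\<dots> = (\<Sum>j<k. \<integral>\<^sup>+\<omega>. ennreal (c powr (- N (real j * h) \<omega>) * (L (real (Suc j) * h) \<omega> - L (real j * h) \<omega>)) \<partial>M)"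
    by (intro nn_integral_sum) (simp del: of_nat_Suc)
  also have "\<dots> \<le> (\<Sum>j<k. ennreal (exp (- (d * h)) ^ j * (h * mean_L)))"
    by (intro sum_mono summand)
  also have "\<dots> = ennreal ((\<Sum>j<k. exp (- (d * h)) ^ j) * (h * mean_L))"
    using h mean_L_nonneg by (subst sum_ennreal) (auto simp: sum_distrib_right)
  also have "\<dots> \<le> ennreal (mean_L * (1 + d) / d)"
  proof (rule ennreal_leI)
    have dh: "0 < d * h" using d h by simp
    have e1: "exp (- (d * h)) < 1" using dh by simp
    have "(\<Sum>j<k. exp (- (d * h)) ^ j) \<le> (\<Sum>j. exp (- (d * h)) ^ j)"
      using e1 by (intro sum_le_suminf summable_geometric) auto
    also have "\<dots> = 1 / (1 - exp (- (d * h)))" using e1 by (intro suminf_geometric) auto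
    \<comment> \<open>From \<open>exp (- x) \<le> 1 / (1 + x)\<close>, where
      \<open>h \<le> 1\<close> replaces \<open>1 + d * h\<close> by \<open>1 + d\<close>. The
      remaining \<open>1 / h\<close> cancels against the mean \<open>h * mean_L\<close>.\<close>
    also have "\<dots> \<le> (1 + d) / (d * h)"
    proof -
      have "exp (- (d * h)) \<le> 1 / (1 + d * h)"
        using exp_ge_add_one_self[of "d * h"] dh by (simp add: exp_minus field_simps)
      then have "d * h / (1 + d * h) \<le> 1 - exp (- (d * h))" using dh by (simp add: field_simps)
      moreover have "d * h / (1 + d) \<le> d * h / (1 + d * h)"
        using d h dh by (intro divide_left_mono) (auto simp: mult_left_le intro!: mult_pos_pos add_pos_pos)
      ultimately have "d * h / (1 + d) \<le> 1 - exp (- (d * h))" by simp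
      then show ?thesis using e1 dh d by (simp add: field_simps)
    qed
    finally have "(\<Sum>j<k. exp (- (d * h)) ^ j) * (h * mean_L) \<le> (1 + d) / (d * h) * (h * mean_L)"
      using h mean_L_nonneg by (intro mult_right_mono) auto
    also have "\<dots> = mean_L * (1 + d) / d" using h d by (simp add: field_simps)
    finally show "(\<Sum>j<k. exp (- (d * h)) ^ j) * (h * mean_L) \<le> mean_L * (1 + d) / d" .
  qed
  finally show ?thesis .
qed

text \<open>Fatou carries the bound on the Riemann sums to the integrals up to integer times,
  monotone convergence to their supremum. The supremum is therefore almost surely finite, and the
  pathwise integral, being nondecreasing in \<open>t\<close>, converges.\<close>

lemma exists_stochastic_integral:
  assumes c: "1 < c"
  shows "\<exists>Z\<in>borel_measurable M. AE \<omega> in M.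
    ((\<lambda>t. stieltjes_integral c (\<lambda>s. N s \<omega>) (\<lambda>s. L s \<omega>) t) \<longlongrightarrow> Z \<omega>) at_top"
proof
  define Z where "Z \<omega> = lim (\<lambda>k. integral_version c k \<omega>)" for \<omega>
  define B where "B = mean_L * (1 + lam * (1 - 1 / c)) / (lam * (1 - 1 / c))"
  note [measurable] = measurable_integral_version
  show "Z \<in> borel_measurable M" unfolding Z_def by (intro borel_measurable_lim_metric) measurable
  have Bk: "(\<integral>\<^sup>+\<omega>. ennreal (integral_version c k \<omega>) \<partial>M) \<le> ennreal B" for k
  proof -
    have "(\<integral>\<^sup>+\<omega>. ennreal (integral_version c k \<omega>) \<partial>M) =
      (\<integral>\<^sup>+\<omega>. liminf (\<lambda>m. ennreal (path_sum c \<omega> (mesh m) (k * 2 ^ m))) \<partial>M)"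
    proof (rule nn_integral_cong_AE)
      show "AE \<omega> in M. ennreal (integral_version c k \<omega>) =
        liminf (\<lambda>m. ennreal (path_sum c \<omega> (mesh m) (k * 2 ^ m)))"
        using AE_integral_version[OF c]
      proof eventually_elim
        case (elim \<omega>)
        have "(\<lambda>m. path_sum c \<omega> (mesh m) (k * 2 ^ m)) \<longlonglongrightarrow> integral_version c k \<omega>"
          using elim by blast
        then show ?case by (intro lim_imp_Liminf[symmetric] tendsto_ennrealI) auto
      qed
    qed
    also have "\<dots> \<le> liminf (\<lambda>m. \<integral>\<^sup>+\<omega>. ennreal (path_sum c \<omega> (mesh m) (k * 2 ^ m)) \<partial>M)"
      by (intro nn_integral_liminf measurable_compose[OF measurable_riemann_sum measurable_ennreal]) (simp add: less_imp_le)
    also have "\<dots> \<le> liminf (\<lambda>m::nat. ennreal B)"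
      unfolding B_def by (intro Liminf_mono always_eventually allI nn_integral_riemann_sum c mesh_pos mesh_le_1)
    also have "\<dots> = ennreal B" by (simp add: Liminf_const)
    finally show ?thesis .
  qed
  have mono: "AE \<omega> in M. integral_version c k \<omega> \<le> integral_version c (Suc k) \<omega>" for k
    using AE_integral_version[OF c] AE_good_path
  proof eventually_elim
    case (elim \<omega>)
    interpret good_path "\<lambda>t. N t \<omega>" "\<lambda>t. L t \<omega>" by (rule elim(2))
    show ?case using elim(1) stieltjes_integral_mono(1)[OF c, of "real k" "real (Suc k)"] by simp
  qed
  have "(\<integral>\<^sup>+\<omega>. (SUP k. ennreal (integral_version c k \<omega>)) \<partial>M) = (SUP k. \<integral>\<^sup>+\<omega>. ennreal (integral_version c k \<omega>) \<partial>M)"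
    by (intro nn_integral_monotone_convergence_SUP_AE) (rule eventually_mono[OF mono ennreal_leI], measurable)
  also have "\<dots> \<le> ennreal B" by (intro SUP_least Bk)
  finally have "AE \<omega> in M. (SUP k. ennreal (integral_version c k \<omega>)) \<noteq> \<infinity>"
    by (intro nn_integral_PInf_AE) (auto simp: top_unique)
  then show "AE \<omega> in M. ((\<lambda>t. stieltjes_integral c (\<lambda>s. N s \<omega>) (\<lambda>s. L s \<omega>) t) \<longlongrightarrow> Z \<omega>) at_top"
    using AE_integral_version[OF c] AE_good_path
  proof eventually_elim
    case (elim \<omega>)
    interpret good_path "\<lambda>t. N t \<omega>" "\<lambda>t. L t \<omega>" by (rule elim(3))
    let ?I = "stieltjes_integral c (\<lambda>s. N s \<omega>) (\<lambda>s. L s \<omega>)"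
    have I: "integral_version c k \<omega> = ?I (real k)" for k using elim(2) by blast
    have "?I (real k) \<le> enn2real (SUP k. ennreal (integral_version c k \<omega>))" for k
    proof -
      have le: "ennreal (?I (real k)) \<le> (SUP k. ennreal (integral_version c k \<omega>))"
        unfolding I by (intro SUP_upper) simp
      have "enn2real (ennreal (?I (real k))) \<le> enn2real (SUP k. ennreal (integral_version c k \<omega>))"
        using elim(1) unfolding infinity_ennreal_def less_top by (rule enn2real_mono[OF le])
      then show ?thesis using stieltjes_integral_mono(2)[OF c, of "real k" "real k"] by simp
    qed
    from stieltjes_integral_tendsto[OF c this] obtain z where z: "(?I \<longlongrightarrow> z) at_top" by blast
    have "(\<lambda>k. ?I (real k)) \<longlonglongrightarrow> z" by (rule filterlim_compose[OF z filterlim_real_sequentially])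
    then have "Z \<omega> = z" unfolding Z_def I by (rule limI)
    with z show ?case by simp
  qed
qed

end

section \<open>The characteristic function of the stochastic integral\<close>

context mu_char
begin

text \<open>At an integer time \<open>nsum\<close> equals \<open>N (real k)\<close> on every mesh,
  so the argument of \<open>F\<close> does not move and only the Riemann sum has to converge. There
  are \<open>k * 2 ^ m\<close> steps with an error of order \<open>(mesh m)\<^sup>2\<close>
  each.\<close>

lemma integral_version_martingale:
  "(CLINT \<omega>|M. iexp (z * integral_version c k \<omega>) * F (z * c powr (- N (real k) \<omega>))) = F z"
    (is "?E = F z")
proof (rule LIMSEQ_unique)
  note [measurable] = measurable_integral_version measurable_N[OF of_nat_0_le_iff]
  show "(\<lambda>m. mesh_value (mesh m) z (k * 2 ^ m)) \<longlonglongrightarrow> ?E"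
    unfolding mesh_value_def
  proof (rule integral_dominated_convergence[where w="\<lambda>_. 1"])
    show "AE \<omega> in M. (\<lambda>m. iexp (z * ssum c (\<lambda>i. increment (mesh m) i \<omega>) (k * 2 ^ m)) *
      F (z * c powr (- nsum (\<lambda>i. increment (mesh m) i \<omega>) (k * 2 ^ m)))) \<longlonglongrightarrow>
      iexp (z * integral_version c k \<omega>) * F (z * c powr (- N (real k) \<omega>))"
      using AE_integral_version[OF c] AE_start
    proof eventually_elim
      case (elim \<omega>)
      have "nsum (\<lambda>i. increment (mesh m) i \<omega>) (k * 2 ^ m) = N (real k) \<omega>" for m
        unfolding nsum_increment using elim by (simp add: mesh_def)
      moreover have "ssum c (\<lambda>i. increment (mesh m) i \<omega>) (k * 2 ^ m) =
          path_sum c \<omega> (mesh m) (k * 2 ^ m)" for m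
        using elim by (intro ssum_increment) auto
      moreover have "(\<lambda>m. path_sum c \<omega> (mesh m) (k * 2 ^ m)) \<longlonglongrightarrow> integral_version c k \<omega>"
        using elim(1) by blast
      ultimately show ?case by (simp only:) (intro tendsto_intros)
    qed
    show "(\<lambda>\<omega>. iexp (z * ssum c (\<lambda>i. increment (mesh m) i \<omega>) (k * 2 ^ m)) *
      F (z * c powr (- nsum (\<lambda>i. increment (mesh m) i \<omega>) (k * 2 ^ m)))) \<in> borel_measurable M" for m
    proof -
      note [measurable] = measurable_nsum_increment[OF less_imp_le[OF mesh_pos], of m "k * 2 ^ m"]
      show ?thesis by measurable
    qed
  qed (auto simp: norm_mult F_le_1 simp del: of_real_mult)
  show "(\<lambda>m. mesh_value (mesh m) z (k * 2 ^ m)) \<longlonglongrightarrow> F z"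
  proof (rule LIM_zero_cancel, rule Lim_null_comparison)
    show "\<forall>\<^sub>F m in sequentially. cmod (mesh_value (mesh m) z (k * 2 ^ m) - F z) \<le> real k * step_const * mesh m"
    proof (intro always_eventually allI)
      fix m
      have "real (k * 2 ^ m) * step_const * (mesh m)\<^sup>2 = real k * step_const * mesh m"
      proof -
        have "2 ^ m * (mesh m)\<^sup>2 = mesh m" by (simp add: mesh_def power2_eq_square)
        then have "real k * step_const * (2 ^ m * (mesh m)\<^sup>2) = real k * step_const * mesh m" by (simp only:)
        then show ?thesis by (simp add: mult_ac)
      qed
      then show "cmod (mesh_value (mesh m) z (k * 2 ^ m) - F z) \<le> real k * step_const * mesh m"
        using mesh_value_estimate[OF less_imp_le[OF mesh_pos] mesh_le_1, of m z "k * 2 ^ m"] by (simp only:)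
    qed
    show "(\<lambda>m. real k * step_const * mesh m) \<longlonglongrightarrow> 0"
      using tendsto_mult[OF tendsto_const mesh_tendsto] by simp
  qed
qed

text \<open>In the martingale identity the factor \<open>F (z * c powr (- N k))\<close> is replaced
  by \<open>1\<close>. By the Lipschitz bound this costs at most \<open>m * \<bar>z\<bar>\<close>
  times the mean of the discount factor, which decays exponentially in \<open>k\<close>.\<close>

lemma char_stochastic_integral:
  assumes lip: "\<And>x. cmod (F x - 1) \<le> m * \<bar>x\<bar>"
    and Z: "Z \<in> borel_measurable M"
    and lim: "AE \<omega> in M. ((\<lambda>t. stieltjes_integral c (\<lambda>s. N s \<omega>) (\<lambda>s. L s \<omega>) t) \<longlongrightarrow> Z \<omega>) at_top"
  shows "char (distr M borel Z) z = F z"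
proof (rule LIMSEQ_unique)
  note [measurable] = measurable_integral_version Z measurable_N[OF of_nat_0_le_iff]
  have "(\<lambda>k. CLINT \<omega>|M. iexp (z * integral_version c k \<omega>)) \<longlonglongrightarrow> (CLINT \<omega>|M. iexp (z * Z \<omega>))"
  proof (rule integral_dominated_convergence[where w="\<lambda>_. 1"])
    show "AE \<omega> in M. (\<lambda>k. iexp (z * integral_version c k \<omega>)) \<longlonglongrightarrow> iexp (z * Z \<omega>)"
      using AE_integral_version[OF c] lim
    proof eventually_elim
      case (elim \<omega>)
      have "(\<lambda>k. stieltjes_integral c (\<lambda>s. N s \<omega>) (\<lambda>s. L s \<omega>) (real k)) \<longlonglongrightarrow> Z \<omega>"
        by (rule filterlim_compose[OF elim(2) filterlim_real_sequentially])
      then have "(\<lambda>k. integral_version c k \<omega>) \<longlonglongrightarrow> Z \<omega>" using elim(1) by simp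
      then show ?case by (intro tendsto_intros)
    qed
  qed (auto simp del: of_real_mult)
  also have "(CLINT \<omega>|M. iexp (z * Z \<omega>)) = char (distr M borel Z) z"
    unfolding char_def by (subst integral_distr) auto
  finally show "(\<lambda>k. CLINT \<omega>|M. iexp (z * integral_version c k \<omega>)) \<longlonglongrightarrow> char (distr M borel Z) z" .
  show "(\<lambda>k. CLINT \<omega>|M. iexp (z * integral_version c k \<omega>)) \<longlonglongrightarrow> F z"
  proof (rule LIM_zero_cancel, rule Lim_null_comparison)
    let ?d = "lam * (1 - 1 / c)"
    show "\<forall>\<^sub>F k in sequentially. cmod ((CLINT \<omega>|M. iexp (z * integral_version c k \<omega>)) - F z) \<le> m * \<bar>z\<bar> * exp (- ?d) ^ k"
    proof (intro always_eventually allI)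
      fix k :: nat
      let ?f = "\<lambda>\<omega>. iexp (z * integral_version c k \<omega>) * (1 - F (z * c powr (- N (real k) \<omega>)))"
      have pw: "c powr (- x) = (1 / c) powr x" for x using c by (simp add: powr_minus_divide powr_divide)
      have int: "integrable M (\<lambda>\<omega>. (1 / c) powr N (real k) \<omega>)" using c by (intro integrable_powr_N) auto
      have i1: "integrable M (\<lambda>\<omega>. iexp (z * integral_version c k \<omega>))"
        "integrable M (\<lambda>\<omega>. iexp (z * integral_version c k \<omega>) * F (z * c powr (- N (real k) \<omega>)))"
        by (auto intro!: integrable_const_bound[where B=1] simp: norm_mult F_le_1 simp del: of_real_mult)
      have "(CLINT \<omega>|M. iexp (z * integral_version c k \<omega>)) - F z = expectation ?f"
        unfolding integral_version_martingale[of z k, symmetric]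
        using i1 by (subst Bochner_Integration.integral_diff[symmetric]) (auto simp: algebra_simps)
      also have "cmod \<dots> \<le> expectation (\<lambda>\<omega>. cmod (?f \<omega>))" by (rule integral_norm_bound)
      also have "\<dots> \<le> expectation (\<lambda>\<omega>. m * \<bar>z\<bar> * (1 / c) powr N (real k) \<omega>)"
      proof (rule integral_mono)
        show "integrable M (\<lambda>\<omega>. cmod (?f \<omega>))"
        proof (intro integrable_norm integrable_const_bound[where B=2] AE_I2)
          show "cmod (?f \<omega>) \<le> 2" for \<omega>
            using norm_triangle_ineq4[of 1 "F (z * c powr (- N (real k) \<omega>))"] F_le_1[of "z * c powr (- N (real k) \<omega>)"]
            by (simp add: norm_mult del: of_real_mult)
        qed measurable
        show "cmod (?f \<omega>) \<le> m * \<bar>z\<bar> * (1 / c) powr N (real k) \<omega>" for \<omega>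
          using lip[of "z * c powr (- N (real k) \<omega>)"]
          by (simp add: norm_mult norm_minus_commute abs_mult pw mult_ac del: of_real_mult)
      qed (use int in simp)
      also have "\<dots> = m * \<bar>z\<bar> * exp (- ?d) ^ k"
        using laplace_N[of "real k" "1 / c"] c by (subst exp_of_nat_mult[symmetric]) (simp add: mult_ac)
      finally show "cmod ((CLINT \<omega>|M. iexp (z * integral_version c k \<omega>)) - F z) \<le> m * \<bar>z\<bar> * exp (- ?d) ^ k" .
    qed
    have "(\<lambda>k. exp (- ?d) ^ k) \<longlonglongrightarrow> 0"
      using c rate_N by (intro LIMSEQ_power_zero) auto
    then show "(\<lambda>k. m * \<bar>z\<bar> * exp (- ?d) ^ k) \<longlonglongrightarrow> 0"
      using tendsto_mult[OF tendsto_const, of _ 0 sequentially "m * \<bar>z\<bar>"] by simp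
  qed
qed

end

section \<open>The first jump\<close>

lemma prod_if_iexp:
  assumes "finite A"
  shows "(\<Prod>i\<in>A. if P i then iexp (f i) else 0) = (if \<forall>i\<in>A. P i then iexp (\<Sum>i\<in>A. f i) else 0)"
  using assms by (induction A rule: finite_induct) (auto simp: ring_distribs exp_add)

context poisson_pair
begin

text \<open>\<open>LEAST\<close> is unspecified on paths that vanish at all mesh points; by
  \<open>AE_N_jumps\<close> these form a null set.\<close>

definition first_step :: "real \<Rightarrow> 'a \<Rightarrow> nat" where
  "first_step h \<omega> = (LEAST j. N (real j * h) \<omega> \<noteq> 0)"

lemma measurable_L_first_step:
  assumes h: "0 \<le> h"
  shows "(\<lambda>\<omega>. L (real (first_step h \<omega>) * h) \<omega>) \<in> borel_measurable M"
proof -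
  have [measurable]: "N (real j * h) \<in> borel_measurable M" "L (real j * h) \<in> borel_measurable M" for j
    using h by (auto intro: measurable_N measurable_L)
  have "first_step h \<in> measurable M (count_space UNIV)" unfolding first_step_def by measurable
  from measurable_compose_countable[OF _ this, of "\<lambda>j \<omega>. L (real j * h) \<omega>" borel]
  show ?thesis by simp
qed

text \<open>The value \<open>iexp (z * L)\<close> on the event that the first \<open>j\<close>
  increments of \<open>N\<close> vanish and the next one does not, that is,
  \<open>first_step\<close> is \<open>Suc j\<close>; on all other paths it is \<open>0\<close>.
  Written as a product over increments so that independence factorises its mean.\<close>

definition exit_term :: "real \<Rightarrow> real \<Rightarrow> nat \<Rightarrow> 'a \<Rightarrow> complex" where
  "exit_term h z j \<omega> = (\<Prod>i<Suc j.
     if (fst (increment h i \<omega>) = 0) = (i < j) then iexp (z * snd (increment h i \<omega>)) else 0)"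

lemma exit_term_eq:
  assumes "N 0 \<omega> = 0" "L 0 \<omega> = 0" "N (real k * h) \<omega> \<noteq> 0"
  shows "exit_term h z j \<omega> = (if Suc j = first_step h \<omega> then iexp (z * L (real (first_step h \<omega>) * h) \<omega>) else 0)"
proof -
  have tel: "(\<Sum>i<j. fst (increment h i \<omega>)) = N (real j * h) \<omega>" "(\<Sum>i<j. snd (increment h i \<omega>)) = L (real j * h) \<omega>" for j
    using sum_lessThan_telescope[of "\<lambda>i. N (real i * h) \<omega>" j] sum_lessThan_telescope[of "\<lambda>i. L (real i * h) \<omega>" j] assms
    by (simp_all add: increment_def)
  have zero: "(\<forall>i<j. fst (increment h i \<omega>) = 0) \<longleftrightarrow> (\<forall>i\<le>j. N (real i * h) \<omega> = 0)" for j
  proof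
    assume *: "\<forall>i<j. fst (increment h i \<omega>) = 0"
    show "\<forall>i\<le>j. N (real i * h) \<omega> = 0"
    proof (intro allI impI)
      fix i assume "i \<le> j"
      then show "N (real i * h) \<omega> = 0" unfolding tel(1)[of i, symmetric] using * by (intro sum.neutral) auto
    qed
  qed (simp add: increment_def Suc_leI less_imp_le del: of_nat_Suc)
  have *: "(\<forall>i\<in>{..<Suc j}. P i = (i < j)) \<longleftrightarrow> (\<forall>i<j. P i) \<and> \<not> P j" for P :: "nat \<Rightarrow> bool"
  proof -
    have "(\<forall>i\<in>{..<j}. P i = (i < j)) \<longleftrightarrow> (\<forall>i\<in>{..<j}. P i)" by (rule ball_cong) simp_all
    then show ?thesis by (simp only: lessThan_Suc ball_simps less_irrefl lessThan_iff) blast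
  qed
  have "(\<forall>i\<in>{..<Suc j}. (fst (increment h i \<omega>) = 0) = (i < j)) \<longleftrightarrow>
      (\<forall>i<j. fst (increment h i \<omega>) = 0) \<and> fst (increment h j \<omega>) \<noteq> 0"
    by (rule *)
  also have "\<dots> \<longleftrightarrow> (\<forall>i\<le>j. N (real i * h) \<omega> = 0) \<and> N (real (Suc j) * h) \<omega> \<noteq> 0"
    unfolding zero
  proof (rule conj_cong[OF refl])
    assume "\<forall>i\<le>j. N (real i * h) \<omega> = 0"
    then have "N (real j * h) \<omega> = 0" by blast
    then show "fst (increment h j \<omega>) \<noteq> 0 \<longleftrightarrow> N (real (Suc j) * h) \<omega> \<noteq> 0" by (simp add: increment_def)
  qed
  also have "\<dots> \<longleftrightarrow> Suc j = first_step h \<omega>"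
  proof
    assume *: "(\<forall>i\<le>j. N (real i * h) \<omega> = 0) \<and> N (real (Suc j) * h) \<omega> \<noteq> 0"
    show "Suc j = first_step h \<omega>"
      unfolding first_step_def
    proof (rule Least_equality[symmetric])
      show "Suc j \<le> i" if "N (real i * h) \<omega> \<noteq> 0" for i
        using * that by (meson not_less_eq_eq)
    qed (use * in blast)
  next
    assume *: "Suc j = first_step h \<omega>"
    have "N (real (first_step h \<omega>) * h) \<omega> \<noteq> 0"
      unfolding first_step_def using assms(3) by (rule LeastI)
    moreover have "N (real i * h) \<omega> = 0" if "i \<le> j" for i
      using not_less_Least[of i "\<lambda>j. N (real j * h) \<omega> \<noteq> 0"] that * by (simp add: first_step_def)
    ultimately show "(\<forall>i\<le>j. N (real i * h) \<omega> = 0) \<and> N (real (Suc j) * h) \<omega> \<noteq> 0"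
      unfolding * by blast
  qed
  finally have iff: "(\<forall>i\<in>{..<Suc j}. (fst (increment h i \<omega>) = 0) = (i < j)) \<longleftrightarrow> Suc j = first_step h \<omega>" .
  have "exit_term h z j \<omega> = (if Suc j = first_step h \<omega> then iexp (\<Sum>i<Suc j. z * snd (increment h i \<omega>)) else 0)"
    unfolding exit_term_def by (subst prod_if_iexp) (simp_all only: iff finite_lessThan)
  also have "(\<Sum>i<Suc j. z * snd (increment h i \<omega>)) = z * L (real (Suc j) * h) \<omega>"
    unfolding sum_distrib_left[symmetric] tel(2) ..
  finally show ?thesis by auto
qed

lemma exit_factor_measurable:
  "(\<lambda>x. if (fst x = 0) = b then iexp (z * snd x) else 0) \<in> borel_measurable (borel \<Otimes>\<^sub>M borel :: (real \<times> real) measure)"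
  by measurable

lemma expectation_exit_term:
  assumes h: "0 \<le> h"
  shows "expectation (exit_term h z j) = stay h z ^ j * leave h z"
    and "exit_term h z j \<in> borel_measurable M"
proof -
  let ?f = "\<lambda>i x. if (fst x = 0) = (i < j) then iexp (z * snd x) else 0"
  have m: "(\<lambda>\<omega>. ?f i (increment h i \<omega>)) \<in> borel_measurable M" for i
    by (rule measurable_compose[OF measurable_increment_mesh[OF h] exit_factor_measurable])
  then show "exit_term h z j \<in> borel_measurable M"
    unfolding exit_term_def[abs_def] by (intro borel_measurable_prod) 
  have ind: "indep_vars (\<lambda>_. borel) (\<lambda>i \<omega>. ?f i (increment h i \<omega>)) {..<Suc j}"
    by (rule indep_vars_compose2[OF indep_vars_increment[OF h] exit_factor_measurable])
  have "expectation (exit_term h z j) = (\<Prod>i<Suc j. expectation (\<lambda>\<omega>. ?f i (increment h i \<omega>)))"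
    unfolding exit_term_def
  proof (rule indep_vars_lebesgue_integral[OF _ ind])
    show "integrable M (\<lambda>\<omega>. ?f i (increment h i \<omega>))" for i
      using m by (intro integrable_const_bound[where B=1]) (auto simp del: of_real_mult)
  qed simp
  also have "\<dots> = (\<Prod>i<Suc j. if i < j then stay h z else leave h z)"
  proof (rule prod.cong[OF refl])
    fix i
    have "expectation (\<lambda>\<omega>. ?f i (increment h i \<omega>)) = expectation (\<lambda>\<omega>. ?f i (N h \<omega>, L h \<omega>))"
      using integral_increment_mesh[OF h, of "\<lambda>p q. ?f i (p, q)" i] exit_factor_measurable[of "i < j" z]
      by (simp add: case_prod_beta cong: if_cong)
    also have "\<dots> = (if i < j then stay h z else leave h z)"
      unfolding stay_def leave_def by (auto intro!: Bochner_Integration.integral_cong)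
    finally show "expectation (\<lambda>\<omega>. ?f i (increment h i \<omega>)) = (if i < j then stay h z else leave h z)" .
  qed
  also have "\<dots> = stay h z ^ j * leave h z" by simp
  finally show "expectation (exit_term h z j) = stay h z ^ j * leave h z" .
qed

text \<open>Gives convergence of the geometric series over the exit step. The indicator of
  \<open>N h = 0\<close> is dominated by \<open>(1 / 2) powr N h\<close>.\<close>

lemma norm_stay_less_1:
  assumes h: "0 < h"
  shows "cmod (stay h z) < 1"
proof -
  note [measurable] = measurable_N[OF less_imp_le[OF h]] measurable_L[OF less_imp_le[OF h]]
  have "cmod (stay h z) \<le> expectation (\<lambda>\<omega>. cmod (if N h \<omega> = 0 then iexp (z * L h \<omega>) else 0))"
    unfolding stay_def by (rule integral_norm_bound)
  also have "\<dots> \<le> expectation (\<lambda>\<omega>. (1 / 2) powr N h \<omega>)"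
  proof (rule integral_mono)
    show "integrable M (\<lambda>\<omega>. cmod (if N h \<omega> = 0 then iexp (z * L h \<omega>) else 0))"
      by (intro integrable_norm integrable_const_bound[where B=1]) (auto simp del: of_real_mult)
    show "integrable M (\<lambda>\<omega>. (1 / 2) powr N h \<omega>)" using h by (intro integrable_powr_N) auto
  qed (simp del: of_real_mult)
  also have "\<dots> = exp (- (lam * h * (1 - 1 / 2)))" using h by (intro laplace_N) auto
  also have "\<dots> < 1" using rate_N h by simp
  finally show ?thesis .
qed

text \<open>Decomposition by the step at which \<open>N\<close> leaves \<open>0\<close>: the means
  of the exit terms are \<open>stay ^ j * leave\<close>. A partial sum is \<open>iexp\<close> cut
  off to exits up to step \<open>n\<close>, hence bounded by \<open>1\<close>.\<close>

lemma char_L_first_step: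
  "(CLINT \<omega>|M. iexp (z * L (real (first_step (mesh m) \<omega>) * mesh m) \<omega>)) = leave (mesh m) z / (1 - stay (mesh m) z)"
proof (rule LIMSEQ_unique)
  let ?h = "mesh m" let ?Y = "\<lambda>\<omega>. L (real (first_step (mesh m) \<omega>) * mesh m) \<omega>"
  have h: "0 \<le> ?h" by (simp add: less_imp_le)
  have ex: "AE \<omega> in M. \<forall>j. exit_term ?h z j \<omega> = (if Suc j = first_step ?h \<omega> then iexp (z * ?Y \<omega>) else 0)"
    using AE_start AE_N_jumps
  proof eventually_elim
    case (elim \<omega>)
    from elim(2) obtain k :: nat where "N (real k) \<omega> \<noteq> 0" by blast
    then have "N (real (k * 2 ^ m) * ?h) \<omega> \<noteq> 0" by (simp add: mesh_def)
    then show ?case using elim(1) by (intro allI exit_term_eq[where k="k * 2 ^ m"]) auto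
  qed
  have pos: "AE \<omega> in M. first_step ?h \<omega> \<noteq> 0"
    using AE_start AE_N_jumps
  proof eventually_elim
    case (elim \<omega>)
    from elim(2) obtain k :: nat where "N (real k) \<omega> \<noteq> 0" by blast
    then have "N (real (k * 2 ^ m) * ?h) \<omega> \<noteq> 0" by (simp add: mesh_def)
    then have "N (real (first_step ?h \<omega>) * ?h) \<omega> \<noteq> 0" unfolding first_step_def by (rule LeastI)
    then show ?case using elim(1) by (metis mult_zero_left of_nat_0)
  qed
  have part: "(\<Sum>j<n. exit_term ?h z j \<omega>) = (if first_step ?h \<omega> \<le> n then iexp (z * ?Y \<omega>) else 0)"
    if ex: "\<forall>j. exit_term ?h z j \<omega> = (if Suc j = first_step ?h \<omega> then iexp (z * ?Y \<omega>) else 0)"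
      and pos: "first_step ?h \<omega> \<noteq> 0" for \<omega> n
  proof -
    obtain i where i: "first_step ?h \<omega> = Suc i" using pos not0_implies_Suc by blast
    show ?thesis unfolding ex[rule_format] i by (simp add: Suc_le_eq)
  qed
  show "(\<lambda>n. CLINT \<omega>|M. (\<Sum>j<n. exit_term ?h z j \<omega>)) \<longlonglongrightarrow> (CLINT \<omega>|M. iexp (z * ?Y \<omega>))"
  proof (rule integral_dominated_convergence[where w="\<lambda>_. 1"])
    show "AE \<omega> in M. (\<lambda>n. \<Sum>j<n. exit_term ?h z j \<omega>) \<longlonglongrightarrow> iexp (z * ?Y \<omega>)"
      using ex pos
    proof eventually_elim
      case (elim \<omega>)
      have "\<forall>\<^sub>F n in sequentially. (\<Sum>j<n. exit_term ?h z j \<omega>) = iexp (z * ?Y \<omega>)"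
        using eventually_ge_at_top[of "first_step ?h \<omega>"] by eventually_elim (simp add: part[OF elim])
      then show ?case by (rule tendsto_eventually)
    qed
    show "AE \<omega> in M. cmod (\<Sum>j<n. exit_term ?h z j \<omega>) \<le> 1" for n
      using ex pos
    proof eventually_elim
      case (elim \<omega>)
      show ?case unfolding part[OF elim] by (simp del: of_real_mult)
    qed
    show "(\<lambda>\<omega>. iexp (z * ?Y \<omega>)) \<in> borel_measurable M"
      using measurable_L_first_step[OF h] by measurable
  qed (auto intro!: borel_measurable_sum expectation_exit_term h)
  have int: "integrable M (exit_term ?h z j)" for j
  proof (rule integrable_const_bound[where B=1])
    show "AE \<omega> in M. cmod (exit_term ?h z j \<omega>) \<le> 1" using ex by (rule eventually_mono) (simp del: of_real_mult)
  qed (intro expectation_exit_term h)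
  have "(\<lambda>n. (\<Sum>j<n. stay ?h z ^ j) * leave ?h z) \<longlonglongrightarrow> 1 / (1 - stay ?h z) * leave ?h z"
    using geometric_sums[OF norm_stay_less_1[OF mesh_pos]] unfolding sums_def by (intro tendsto_intros)
  moreover have "(CLINT \<omega>|M. (\<Sum>j<n. exit_term ?h z j \<omega>)) = (\<Sum>j<n. stay ?h z ^ j) * leave ?h z" for n
    using int by (subst Bochner_Integration.integral_sum) (auto simp: expectation_exit_term(1)[OF h] sum_distrib_right)
  ultimately show "(\<lambda>n. CLINT \<omega>|M. (\<Sum>j<n. exit_term ?h z j \<omega>)) \<longlonglongrightarrow> leave ?h z / (1 - stay ?h z)" by simp
qed

lemma kappa_nonzero: "kappa z \<noteq> 0"
proof
  assume "kappa z = 0"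
  then have "complex_of_real (u + v + w) = of_real v * iexp z" by (simp add: kappa_def)
  then have "cmod (complex_of_real (u + v + w)) = cmod (of_real v * iexp z)" by (simp only:)
  then show False using rates_nonneg rate_N by (simp add: norm_mult del: of_real_add)
qed

lemma scaled_limit:
  assumes "\<And>h. 0 \<le> h \<Longrightarrow> h \<le> 1 \<Longrightarrow> cmod (f h - of_real h * x) \<le> C * h\<^sup>2"
  shows "(\<lambda>m. f (mesh m) / of_real (mesh m)) \<longlonglongrightarrow> x"
proof (rule LIM_zero_cancel, rule Lim_null_comparison)
  show "(\<lambda>m. C * mesh m) \<longlonglongrightarrow> 0" using tendsto_mult[OF tendsto_const mesh_tendsto] by simp
  show "\<forall>\<^sub>F m in sequentially. cmod (f (mesh m) / of_real (mesh m) - x) \<le> C * mesh m"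
  proof (intro always_eventually allI)
    fix m
    have "f (mesh m) / of_real (mesh m) - x = (f (mesh m) - of_real (mesh m) * x) / of_real (mesh m)"
      using mesh_pos[of m] by (simp add: field_simps)
    also have "cmod \<dots> = cmod (f (mesh m) - of_real (mesh m) * x) / mesh m"
      by (simp add: norm_divide abs_of_pos)
    also have "\<dots> \<le> C * (mesh m)\<^sup>2 / mesh m"
      using mesh_pos[of m] assms[OF _ mesh_le_1, of m] by (intro divide_right_mono) auto
    finally show "cmod (f (mesh m) / of_real (mesh m) - x) \<le> C * mesh m"
      using mesh_pos[of m] by (simp add: power2_eq_square)
  qed
qed

lemma AE_L_first_step_tendsto:
  "AE \<omega> in M. (\<lambda>m. L (real (first_step (mesh m) \<omega>) * mesh m) \<omega>) \<longlonglongrightarrow> L (first_jump_time (\<lambda>t. N t \<omega>)) \<omega>"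
  using AE_good_path AE_N_jumps
proof eventually_elim
  case (elim \<omega>)
  interpret good_path "\<lambda>t. N t \<omega>" "\<lambda>t. L t \<omega>" by (rule elim(1))
  obtain k :: nat where "0 < real k" "N (real k) \<omega> \<noteq> 0" using elim(2) by auto
  from first_jump_mesh_tendsto[OF this] show ?case unfolding first_step_def .
qed

text \<open>The limit along the mesh is a measurable version, which bypasses the measurability of
  the first jump time and of \<open>L\<close> evaluated there.\<close>

lemma exists_L_first_jump:
  "\<exists>Y\<in>borel_measurable M. AE \<omega> in M. Y \<omega> = L (first_jump_time (\<lambda>t. N t \<omega>)) \<omega>"
proof
  show "(\<lambda>\<omega>. lim (\<lambda>m. L (real (first_step (mesh m) \<omega>) * mesh m) \<omega>)) \<in> borel_measurable M"
    by (intro borel_measurable_lim_metric measurable_L_first_step) (simp add: less_imp_le)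
  show "AE \<omega> in M. lim (\<lambda>m. L (real (first_step (mesh m) \<omega>) * mesh m) \<omega>) = L (first_jump_time (\<lambda>t. N t \<omega>)) \<omega>"
    using AE_L_first_step_tendsto by (rule eventually_mono) (rule limI)
qed

text \<open>Numerator and denominator of \<open>leave / (1 - stay)\<close> both vanish with the
  mesh; divided by its size they tend to \<open>beta z\<close> and \<open>kappa z\<close>.\<close>

lemma char_L_first_jump:
  assumes Y: "Y \<in> borel_measurable M"
    and eq: "AE \<omega> in M. Y \<omega> = L (first_jump_time (\<lambda>t. N t \<omega>)) \<omega>"
  shows "char (distr M borel Y) z = beta z / kappa z"
proof (rule LIMSEQ_unique)
  note [measurable] = Y
  have "(\<lambda>m. CLINT \<omega>|M. iexp (z * L (real (first_step (mesh m) \<omega>) * mesh m) \<omega>)) \<longlonglongrightarrow> (CLINT \<omega>|M. iexp (z * Y \<omega>))"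
  proof (rule integral_dominated_convergence[where w="\<lambda>_. 1"])
    show "AE \<omega> in M. (\<lambda>m. iexp (z * L (real (first_step (mesh m) \<omega>) * mesh m) \<omega>)) \<longlonglongrightarrow> iexp (z * Y \<omega>)"
      using AE_L_first_step_tendsto eq
    proof eventually_elim
      case (elim \<omega>)
      show ?case unfolding elim(2) by (intro tendsto_intros elim(1))
    qed
    show "(\<lambda>\<omega>. iexp (z * L (real (first_step (mesh m) \<omega>) * mesh m) \<omega>)) \<in> borel_measurable M" for m
      using measurable_L_first_step[OF less_imp_le[OF mesh_pos], of m] by measurable
  qed (auto simp del: of_real_mult)
  also have "(CLINT \<omega>|M. iexp (z * Y \<omega>)) = char (distr M borel Y) z"
    unfolding char_def by (subst integral_distr) auto
  finally show "(\<lambda>m. leave (mesh m) z / (1 - stay (mesh m) z)) \<longlonglongrightarrow> char (distr M borel Y) z"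
    unfolding char_L_first_step .
  have "(\<lambda>m. (1 - stay (mesh m) z) / of_real (mesh m)) \<longlonglongrightarrow> kappa z"
  proof (rule scaled_limit)
    show "cmod ((1 - stay h z) - of_real h * kappa z) \<le> err_const * h\<^sup>2" if "0 \<le> h" "h \<le> 1" for h
      using stay_estimate[OF that, of z] by (simp add: norm_minus_commute algebra_simps)
  qed
  moreover have "(\<lambda>m. leave (mesh m) z / of_real (mesh m)) \<longlonglongrightarrow> beta z"
    by (rule scaled_limit[OF leave_estimate])
  ultimately have "(\<lambda>m. (leave (mesh m) z / of_real (mesh m)) / ((1 - stay (mesh m) z) / of_real (mesh m))) \<longlonglongrightarrow> beta z / kappa z"
    using kappa_nonzero by (intro tendsto_divide)
  moreover have "complex_of_real (mesh m) \<noteq> 0" for m using mesh_pos[of m] by simp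
  ultimately show "(\<lambda>m. leave (mesh m) z / (1 - stay (mesh m) z)) \<longlonglongrightarrow> beta z / kappa z"
    by simp
qed

end

section \<open>Independence from characteristic functions\<close>

text \<open>Change of measure: under the density \<open>H / expectation H\<close> the variable
  \<open>X\<close> keeps its characteristic function, hence its law, and the claim compares the two
  masses of \<open>A\<close>.\<close>

lemma (in prob_space) iexp_indep_imp_indicator_nonneg:
  fixes X H :: "'a \<Rightarrow> real"
  assumes [measurable]: "X \<in> borel_measurable M" "H \<in> borel_measurable M" and A[measurable]: "A \<in> sets borel"
    and H: "\<And>\<omega>. 1 \<le> H \<omega>" "\<And>\<omega>. H \<omega> \<le> 3"
    and eq: "\<And>z. expectation (\<lambda>\<omega>. iexp (z * X \<omega>) * of_real (H \<omega>)) = expectation (\<lambda>\<omega>. iexp (z * X \<omega>)) * of_real (expectation H)"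
  shows "expectation (\<lambda>\<omega>. indicator A (X \<omega>) * H \<omega>) = prob (X -` A \<inter> space M) * expectation H"
proof -
  have H0: "0 \<le> H \<omega>" for \<omega> using H(1)[of \<omega>] by simp
  have intH: "integrable M H" using H H0 by (intro integrable_const_bound[where B=3]) auto
  define h where "h = expectation H"
  have h: "1 \<le> h" unfolding h_def using H intH by (intro integral_ge_const) auto
  define Q where "Q = density M (\<lambda>\<omega>. ennreal (H \<omega> / h))"
  have "emeasure Q (space Q) = (\<integral>\<^sup>+\<omega>. ennreal (H \<omega> / h) \<partial>M)"
    unfolding Q_def by (subst emeasure_density) (auto intro!: nn_integral_cong split: split_indicator)
  also have "\<dots> = ennreal (expectation (\<lambda>\<omega>. H \<omega> / h))"
    using intH H0 h by (intro nn_integral_eq_integral) auto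
  also have "\<dots> = 1" using h by (simp add: h_def)
  finally interpret Q: prob_space Q by (rule prob_spaceI)
  have [measurable_cong]: "sets Q = sets M" by (simp add: Q_def)
  have Qint: "integral\<^sup>L Q f = expectation (\<lambda>\<omega>. (H \<omega> / h) *\<^sub>R f \<omega>)" if "f \<in> borel_measurable M" for f :: "'a \<Rightarrow> 'z::{banach, second_countable_topology}"
    unfolding Q_def using that H0 h by (intro integral_density) auto
  have "distr Q borel X = distr M borel X"
  proof (rule Levy_uniqueness)
    show "char (distr Q borel X) = char (distr M borel X)"
    proof
      fix z
      have "char (distr Q borel X) z = integral\<^sup>L Q (\<lambda>\<omega>. iexp (z * X \<omega>))"
        unfolding char_def by (subst integral_distr) auto
      also have "\<dots> = expectation (\<lambda>\<omega>. (H \<omega> / h) *\<^sub>R iexp (z * X \<omega>))" by (rule Qint) measurable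
      also have "\<dots> = expectation (\<lambda>\<omega>. iexp (z * X \<omega>) * of_real (H \<omega>) / of_real h)"
        by (intro Bochner_Integration.integral_cong) (auto simp: scaleR_conv_of_real)
      also have "\<dots> = expectation (\<lambda>\<omega>. iexp (z * X \<omega>) * of_real (H \<omega>)) / of_real h" by (rule integral_divide_zero)
      also have "\<dots> = expectation (\<lambda>\<omega>. iexp (z * X \<omega>))" unfolding eq h_def[symmetric] using h by simp
      also have "\<dots> = char (distr M borel X) z"
        unfolding char_def by (subst integral_distr) auto
      finally show "char (distr Q borel X) z = char (distr M borel X) z" .
    qed
  qed (auto intro: real_distribution_distr Q.real_distribution_distr)
  then have "measure (distr Q borel X) A = measure (distr M borel X) A" by simp
  then have "integral\<^sup>L Q (\<lambda>\<omega>. indicator A (X \<omega>) :: real) = prob (X -` A \<inter> space M)"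
  proof -
    assume *: "measure (distr Q borel X) A = measure (distr M borel X) A"
    have "integral\<^sup>L Q (\<lambda>\<omega>. indicator A (X \<omega>) :: real) = integral\<^sup>L (distr Q borel X) (indicator A)"
      by (subst integral_distr) auto
    also have "\<dots> = measure (distr Q borel X) A" by simp
    finally show ?thesis using * by (simp add: measure_distr)
  qed
  also have "integral\<^sup>L Q (\<lambda>\<omega>. indicator A (X \<omega>) :: real) = expectation (\<lambda>\<omega>. (H \<omega> / h) *\<^sub>R indicator A (X \<omega>))"
    by (rule Qint) measurable
  also have "\<dots> = expectation (\<lambda>\<omega>. indicator A (X \<omega>) * H \<omega>) / h"
    by (simp add: mult.commute)
  finally show ?thesis using h by (simp add: field_simps h_def)
qed

text \<open>A bounded complex \<open>G\<close> is split into \<open>Re G\<close> and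
  \<open>Im G = Re (- \<i> * G)\<close>. The hypothesis passes to the conjugate by changing the sign
  of \<open>z\<close>, and hence to the real part.\<close>

lemma (in prob_space) iexp_indep_imp_indicator:
  fixes X :: "'a \<Rightarrow> real" and G :: "'a \<Rightarrow> complex"
  assumes X[measurable]: "X \<in> borel_measurable M" and G[measurable]: "G \<in> borel_measurable M" and A[measurable]: "A \<in> sets borel"
    and b: "\<And>\<omega>. cmod (G \<omega>) \<le> 1"
    and eq: "\<And>z. expectation (\<lambda>\<omega>. iexp (z * X \<omega>) * G \<omega>) = expectation (\<lambda>\<omega>. iexp (z * X \<omega>)) * expectation G"
  shows "expectation (\<lambda>\<omega>. indicator A (X \<omega>) * G \<omega>) = prob (X -` A \<inter> space M) * expectation G"
proof -
  have part: "expectation (\<lambda>\<omega>. indicator A (X \<omega>) * Re (F \<omega>)) = prob (X -` A \<inter> space M) * Re (expectation F)"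
    if [measurable]: "F \<in> borel_measurable M" and b: "\<And>\<omega>. cmod (F \<omega>) \<le> 1"
      and eq: "\<And>z. expectation (\<lambda>\<omega>. iexp (z * X \<omega>) * F \<omega>) = expectation (\<lambda>\<omega>. iexp (z * X \<omega>)) * expectation F" for F
  proof -
    have "cnj \<in> borel_measurable borel"
      by (intro borel_measurable_continuous_onI continuous_intros)
    from measurable_compose[OF \<open>F \<in> borel_measurable M\<close> this]
    have [measurable]: "(\<lambda>\<omega>. cnj (F \<omega>)) \<in> borel_measurable M" .
    have int: "integrable M F" "integrable M (\<lambda>\<omega>. iexp (z * X \<omega>) * F \<omega>)" "integrable M (\<lambda>\<omega>. iexp (z * X \<omega>))"
      "integrable M (\<lambda>\<omega>. iexp (z * X \<omega>) * cnj (F \<omega>))" "integrable M (\<lambda>\<omega>. Re (F \<omega>))" for z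
      using b abs_Re_le_cmod[THEN order_trans, OF b]
      by (auto intro!: integrable_const_bound[where B=1] simp: norm_mult simp del: of_real_mult)
    have cnj: "expectation (\<lambda>\<omega>. iexp (z * X \<omega>) * cnj (F \<omega>)) = expectation (\<lambda>\<omega>. iexp (z * X \<omega>)) * cnj (expectation F)" for z
    proof -
      have c: "cnj (iexp (- z * X \<omega>)) = iexp (z * X \<omega>)" for \<omega> by (simp add: exp_cnj)
      have "expectation (\<lambda>\<omega>. iexp (z * X \<omega>) * cnj (F \<omega>)) = expectation (\<lambda>\<omega>. cnj (iexp (- z * X \<omega>) * F \<omega>))"
        by (simp only: c complex_cnj_mult)
      also have "\<dots> = cnj (expectation (\<lambda>\<omega>. iexp (- z * X \<omega>) * F \<omega>))" by (rule Bochner_Integration.integral_cnj)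
      also have "\<dots> = cnj (expectation (\<lambda>\<omega>. iexp (- z * X \<omega>))) * cnj (expectation F)" by (simp only: eq complex_cnj_mult)
      also have "cnj (expectation (\<lambda>\<omega>. iexp (- z * X \<omega>))) = expectation (\<lambda>\<omega>. iexp (z * X \<omega>))"
        unfolding Bochner_Integration.integral_cnj[symmetric] by (simp only: c)
      finally show ?thesis .
    qed
    \<comment> \<open>The shift by \<open>2\<close> moves \<open>Re (F \<omega>)\<close> from
      \<open>{-1..1}\<close> into \<open>{1..3}\<close>, so that \<open>?H\<close> can serve as a
      density.\<close>
    let ?H = "\<lambda>\<omega>. Re (F \<omega>) + 2"
    have "expectation (\<lambda>\<omega>. indicator A (X \<omega>) * ?H \<omega>) = prob (X -` A \<inter> space M) * expectation ?H"
    proof (rule iexp_indep_imp_indicator_nonneg)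
      show "1 \<le> ?H \<omega>" "?H \<omega> \<le> 3" for \<omega>
        using abs_Re_le_cmod[of "F \<omega>"] b[of \<omega>] by linarith+
      fix z
      have H: "of_real (?H \<omega>) = (F \<omega> + cnj (F \<omega>)) / 2 + 2" for \<omega> by (simp add: complex_add_cnj)
      have alg: "e * ((x + y) / 2 + 2) = (e * x + e * y) / 2 + 2 * e" for e x y :: complex
        by (simp add: algebra_simps add_divide_distrib)
      have "expectation (\<lambda>\<omega>. iexp (z * X \<omega>) * of_real (?H \<omega>)) =
        expectation (\<lambda>\<omega>. (iexp (z * X \<omega>) * F \<omega> + iexp (z * X \<omega>) * cnj (F \<omega>)) / 2 + 2 * iexp (z * X \<omega>))"
        by (simp only: H alg)
      also have "\<dots> = (expectation (\<lambda>\<omega>. iexp (z * X \<omega>) * F \<omega>) + expectation (\<lambda>\<omega>. iexp (z * X \<omega>) * cnj (F \<omega>))) / 2 +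
          2 * expectation (\<lambda>\<omega>. iexp (z * X \<omega>))"
        using int by (simp del: of_real_mult)
      also have "\<dots> = expectation (\<lambda>\<omega>. iexp (z * X \<omega>)) * ((expectation F + cnj (expectation F)) / 2 + 2)"
        unfolding eq cnj by (simp add: algebra_simps)
      also have "(expectation F + cnj (expectation F)) / 2 + 2 = of_real (expectation ?H)"
        using int by (simp add: complex_add_cnj prob_space integral_Re)
      finally show "expectation (\<lambda>\<omega>. iexp (z * X \<omega>) * of_real (?H \<omega>)) = expectation (\<lambda>\<omega>. iexp (z * X \<omega>)) * of_real (expectation ?H)" .
    qed measurable
    moreover have "integrable M (\<lambda>\<omega>. indicator A (X \<omega>) * Re (F \<omega>))" "integrable M (\<lambda>\<omega>. indicator A (X \<omega>) * 2 :: real)"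
    proof -
      have re: "\<bar>Re (F \<omega>)\<bar> \<le> 1" for \<omega> using abs_Re_le_cmod[of "F \<omega>"] b[of \<omega>] by linarith
      have "norm (indicator A (X \<omega>) * Re (F \<omega>)) \<le> 1" for \<omega> using re[of \<omega>] by (simp add: indicator_def)
      then show "integrable M (\<lambda>\<omega>. indicator A (X \<omega>) * Re (F \<omega>))"
        by (intro integrable_const_bound[where B=1] AE_I2) measurable
      show "integrable M (\<lambda>\<omega>. indicator A (X \<omega>) * 2 :: real)"
        by (intro integrable_const_bound[where B=2] AE_I2) (auto simp: indicator_def)
    qed
    moreover have "expectation (\<lambda>\<omega>. indicator A (X \<omega>) * 2 :: real) = 2 * prob (X -` A \<inter> space M)"
    proof -
      have "expectation (\<lambda>\<omega>. indicator A (X \<omega>) * 2 :: real) = expectation (\<lambda>\<omega>. 2 * indicator (X -` A \<inter> space M) \<omega>)"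
        by (intro Bochner_Integration.integral_cong) (auto simp: indicator_def)
      then show ?thesis by simp
    qed
    ultimately show ?thesis using int by (simp add: ring_distribs prob_space integral_Re)
  qed
  have int: "integrable M (\<lambda>\<omega>. indicator A (X \<omega>) * G \<omega>)" "integrable M G" "integrable M (\<lambda>\<omega>. - \<i> * G \<omega>)"
    using b by (auto intro!: integrable_const_bound[where B=1] simp: indicator_def norm_mult)
  have "Re (expectation (\<lambda>\<omega>. indicator A (X \<omega>) * G \<omega>)) = expectation (\<lambda>\<omega>. indicator A (X \<omega>) * Re (G \<omega>))"
    unfolding integral_Re[OF int(1), symmetric] by (intro Bochner_Integration.integral_cong) (auto simp: indicator_def)
  also have "\<dots> = prob (X -` A \<inter> space M) * Re (expectation G)" by (rule part[OF G b eq])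
  finally have re: "Re (expectation (\<lambda>\<omega>. indicator A (X \<omega>) * G \<omega>)) = prob (X -` A \<inter> space M) * Re (expectation G)" .
  have "Im (expectation (\<lambda>\<omega>. indicator A (X \<omega>) * G \<omega>)) = expectation (\<lambda>\<omega>. indicator A (X \<omega>) * Re (- \<i> * G \<omega>))"
    unfolding integral_Im[OF int(1), symmetric] by (intro Bochner_Integration.integral_cong) (auto simp: indicator_def)
  also have "\<dots> = prob (X -` A \<inter> space M) * Re (expectation (\<lambda>\<omega>. - \<i> * G \<omega>))"
  proof (rule part)
    show "expectation (\<lambda>\<omega>. iexp (z * X \<omega>) * (- \<i> * G \<omega>)) = expectation (\<lambda>\<omega>. iexp (z * X \<omega>)) * expectation (\<lambda>\<omega>. - \<i> * G \<omega>)" for z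
    proof -
      have "expectation (\<lambda>\<omega>. iexp (z * X \<omega>) * (- \<i> * G \<omega>)) = expectation (\<lambda>\<omega>. - \<i> * (iexp (z * X \<omega>) * G \<omega>))"
        by (simp only: mult.left_commute)
      also have "\<dots> = - \<i> * expectation (\<lambda>\<omega>. iexp (z * X \<omega>) * G \<omega>)" by (rule integral_mult_right_zero)
      finally show ?thesis unfolding eq integral_mult_right_zero by (simp only: mult.left_commute)
    qed
  qed (use b in \<open>auto simp: norm_mult\<close>)
  also have "Re (expectation (\<lambda>\<omega>. - \<i> * G \<omega>)) = Im (expectation G)"
    unfolding integral_mult_right_zero by simp
  finally show ?thesis using re by (simp add: complex_eq_iff)
qed

text \<open>Kac's criterion, by replacing the exponentials with indicators one index at a time:
  \<open>S\<close> is the set of indices already replaced. When all are replaced, the factorisation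
  is that of the probabilities of rectangles.\<close>

lemma (in prob_space) indep_vars_char:
  fixes X :: "'i \<Rightarrow> 'a \<Rightarrow> real"
  assumes I: "finite I" "I \<noteq> {}" and X: "\<And>i. i \<in> I \<Longrightarrow> X i \<in> borel_measurable M"
    and eq: "\<And>z. expectation (\<lambda>\<omega>. \<Prod>i\<in>I. iexp (z i * X i \<omega>)) = (\<Prod>i\<in>I. expectation (\<lambda>\<omega>. iexp (z i * X i \<omega>)))"
  shows "indep_vars (\<lambda>_. borel) X I"
proof -
  have mixed: "expectation (\<lambda>\<omega>. (\<Prod>i\<in>S. indicator (A i) (X i \<omega>)) * (\<Prod>i\<in>I - S. iexp (z i * X i \<omega>))) =
      (\<Prod>i\<in>S. of_real (prob (X i -` A i \<inter> space M))) * (\<Prod>i\<in>I - S. expectation (\<lambda>\<omega>. iexp (z i * X i \<omega>)))"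
    if S: "finite S" "S \<subseteq> I" and A: "\<And>i. i \<in> I \<Longrightarrow> A i \<in> sets borel" for S A z
    using S
  proof (induction S arbitrary: z rule: finite_induct)
    case empty
    show ?case using eq by simp
  next
    case (insert k S)
    then have k: "k \<in> I" "k \<notin> S" "S \<subseteq> I" by auto
    let ?ch = "\<lambda>i t. expectation (\<lambda>\<omega>. iexp (t * X i \<omega>))"
    let ?P = "\<Prod>i\<in>S. complex_of_real (prob (X i -` A i \<inter> space M))"
    let ?C = "\<Prod>i\<in>I - insert k S. ?ch i (z i)"
    define G where "G \<omega> = (\<Prod>i\<in>S. indicator (A i) (X i \<omega>)) * (\<Prod>i\<in>I - insert k S. iexp (z i * X i \<omega>))" for \<omega>
    have IS: "I - S = insert k (I - insert k S)" using k by auto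
    have fin: "finite (I - insert k S)" "k \<notin> I - insert k S" using I by auto
    \<comment> \<open>The induction hypothesis holds for all frequencies, so that of
      \<open>k\<close> can be varied alone; this gives factorisation of
      \<open>iexp (t * X k)\<close> against the rest \<open>G\<close> for every
      \<open>t\<close>.\<close>
    have G_iexp: "expectation (\<lambda>\<omega>. iexp (t * X k \<omega>) * G \<omega>) = ?ch k t * (?P * ?C)" for t
    proof -
      have 1: "(\<Prod>i\<in>I - insert k S. iexp ((z(k := t)) i * X i \<omega>)) = (\<Prod>i\<in>I - insert k S. iexp (z i * X i \<omega>))" for \<omega>
        by (intro prod.cong) auto
      have 2: "(\<Prod>i\<in>I - insert k S. ?ch i ((z(k := t)) i)) = ?C"
        by (intro prod.cong) auto
      show ?thesis
        using insert.IH[OF k(3), of "z(k := t)"] unfolding IS prod.insert[OF fin] 1 2 fun_upd_same G_def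
        by (simp only: mult_ac)
    qed
    have "expectation G = ?ch k 0 * (?P * ?C)" using G_iexp[of 0] by simp
    then have EG: "expectation G = ?P * ?C" by (simp add: prob_space)
    have Gm: "G \<in> borel_measurable M"
    proof -
      have "(\<lambda>\<omega>. indicator (A i) (X i \<omega>) :: complex) \<in> borel_measurable M" if "i \<in> S" for i
        using X[of i] A[of i] that k(3) by (intro borel_measurable_indicator' ) auto
      moreover have "(\<lambda>\<omega>. iexp (z i * X i \<omega>)) \<in> borel_measurable M" if "i \<in> I - insert k S" for i
      proof -
        have [measurable]: "X i \<in> borel_measurable M" using that by (intro X) blast
        show ?thesis by measurable
      qed
      ultimately show ?thesis unfolding G_def by (intro borel_measurable_times borel_measurable_prod) auto
    qed
    have Gb: "cmod (G \<omega>) \<le> 1" for \<omega>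
      unfolding G_def norm_mult prod_norm[symmetric]
      by (intro mult_le_one prod_le_1 prod_nonneg) (auto simp: indicator_def simp del: of_real_mult)
    have "expectation (\<lambda>\<omega>. indicator (A k) (X k \<omega>) * G \<omega>) = prob (X k -` A k \<inter> space M) * expectation G"
      using G_iexp EG by (intro iexp_indep_imp_indicator X A k(1) Gm Gb) simp
    then show ?case
      unfolding prod.insert[OF insert.hyps(1,2)] EG by (simp only: G_def mult_ac)
  qed
  have rect: "prob (\<Inter>i\<in>I. X i -` A i \<inter> space M) = (\<Prod>i\<in>I. prob (X i -` A i \<inter> space M))"
    if A: "\<And>i. i \<in> I \<Longrightarrow> A i \<in> sets borel" for A
  proof -
    have e: "(\<Inter>i\<in>I. X i -` A i \<inter> space M) \<in> events" using I X A by (intro sets.finite_INT measurable_sets) auto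
    let ?E = "\<Inter>i\<in>I. X i -` A i \<inter> space M"
    have "complex_of_real (prob ?E) = complex_of_real (expectation (indicator ?E))"
      unfolding Bochner_Integration.integral_indicator using sets.sets_into_space[OF e] by (simp only: Int_absorb2)
    also have "\<dots> = expectation (\<lambda>\<omega>. indicator ?E \<omega>)"
      unfolding integral_complex_of_real[symmetric] by (intro Bochner_Integration.integral_cong) (simp_all add: indicator_def)
    also have "\<dots> = expectation (\<lambda>\<omega>. \<Prod>i\<in>I. indicator (A i) (X i \<omega>))"
    proof (rule Bochner_Integration.integral_cong[OF refl])
      fix \<omega> assume "\<omega> \<in> space M"
      then show "indicator (\<Inter>i\<in>I. X i -` A i \<inter> space M) \<omega> = (\<Prod>i\<in>I. indicator (A i) (X i \<omega>) :: complex)"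
        using I by (auto simp: indicator_def prod_zero_iff)
    qed
    also have "\<dots> = complex_of_real (\<Prod>i\<in>I. prob (X i -` A i \<inter> space M))"
    proof -
      have "expectation (\<lambda>\<omega>. (\<Prod>i\<in>I. indicator (A i) (X i \<omega>)) * (\<Prod>i\<in>I - I. iexp (0 * X i \<omega>))) =
          (\<Prod>i\<in>I. complex_of_real (prob (X i -` A i \<inter> space M))) * (\<Prod>i\<in>I - I. expectation (\<lambda>\<omega>. iexp (0 * X i \<omega>)))"
        by (rule mixed[OF I(1) order_refl A])
      then show ?thesis by simp
    qed
    finally show ?thesis by (simp only: of_real_eq_iff)
  qed
  show ?thesis
    unfolding indep_vars_def2
  proof (intro conjI ballI X)
    show "indep_sets (\<lambda>i. {X i -` A \<inter> space M |A. A \<in> sets borel}) I"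
    proof (rule indep_setsI)
      show "{X i -` A \<inter> space M |A. A \<in> sets borel} \<subseteq> events" if "i \<in> I" for i
        using X[OF that] by (auto intro: measurable_sets)
      fix E J assume J: "J \<noteq> {}" "J \<subseteq> I" "finite J" and E: "\<forall>j\<in>J. E j \<in> {X j -` A \<inter> space M |A. A \<in> sets borel}"
      then obtain A where A: "\<And>j. j \<in> J \<Longrightarrow> A j \<in> sets borel" "\<And>j. j \<in> J \<Longrightarrow> E j = X j -` A j \<inter> space M"
        by (simp only: mem_Collect_eq) metis
      \<comment> \<open>Indices outside \<open>J\<close> impose no condition, so the rectangle over
        \<open>J\<close> becomes one over the whole of \<open>I\<close>.\<close>
      define A' where "A' j = (if j \<in> J then A j else UNIV)" for j
      have "(\<Inter>j\<in>J. E j) = (\<Inter>i\<in>I. X i -` A' i \<inter> space M)"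
      proof (intro set_eqI iffI)
        fix \<omega> assume \<omega>: "\<omega> \<in> (\<Inter>j\<in>J. E j)"
        obtain j where "j \<in> J" using J by blast
        with \<omega> A(2) have "\<omega> \<in> space M" by blast
        then show "\<omega> \<in> (\<Inter>i\<in>I. X i -` A' i \<inter> space M)" using A(2) \<omega> by (auto simp: A'_def simp del: INT_simps)
      next
        fix \<omega> assume "\<omega> \<in> (\<Inter>i\<in>I. X i -` A' i \<inter> space M)"
        then show "\<omega> \<in> (\<Inter>j\<in>J. E j)" using A(2) J(2) by (force simp: A'_def simp del: INT_simps)
      qed
      also have "prob \<dots> = (\<Prod>i\<in>I. prob (X i -` A' i \<inter> space M))" using A by (intro rect) (auto simp: A'_def)
      also have "\<dots> = (\<Prod>j\<in>J. prob (E j))"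
        using J A I by (intro prod.mono_neutral_cong_right) (auto simp: A'_def prob_space)
      finally show "prob (\<Inter>j\<in>J. E j) = (\<Prod>j\<in>J. prob (E j))" .
    qed
  qed
qed

section \<open>Poisson points\<close>

text \<open>The coordinate \<open>block_index y m 0\<close> of a sample is the number of points of type \<open>y\<close> in
  \<open>{real m..real m + 1}\<close>, and \<open>block_index y m (Suc j)\<close> is the distance of the \<open>j\<close>-th one from \<open>m\<close>.\<close>

definition block_index :: "nat \<Rightarrow> nat \<Rightarrow> nat \<Rightarrow> nat" where
  "block_index y m j = prod_encode (prod_encode (y, m), j)"

lemma block_index_eq_iff [simp]: "block_index y m j = block_index y' m' j' \<longleftrightarrow> y = y' \<and> m = m' \<and> j = j'"
  by (simp add: block_index_def)

text \<open>The product of \<open>g\<close> over the points of one block. Its mean is the Laplace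
  functional of the Poisson process on that block; \<open>nat\<close> and the floor read the number
  of points off a real coordinate.\<close>

definition points_prod :: "nat \<Rightarrow> nat \<Rightarrow> (real \<Rightarrow> complex) \<Rightarrow> (nat \<Rightarrow> real) \<Rightarrow> complex" where
  "points_prod y m g \<omega> = (\<Prod>j<nat \<lfloor>\<omega> (block_index y m 0)\<rfloor>. g (\<omega> (block_index y m (Suc j))))"

abbreviation uniform01 :: "real measure" where
  "uniform01 \<equiv> uniform_measure lborel {0..1}"

lemma real_distribution_uniform01: "real_distribution uniform01"
proof -
  interpret prob_space uniform01 by (intro prob_space_uniform_measure) auto
  show ?thesis by standard auto
qed

definition block_measure :: "(nat \<Rightarrow> real) \<Rightarrow> nat \<Rightarrow> real measure" where
  "block_measure rate i = (if snd (prod_decode i) = 0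
     then distr (measure_pmf (poisson_pmf (rate (fst (prod_decode (fst (prod_decode i))))))) borel real
     else uniform01)"

lemma block_measure_index:
  "block_measure rate (block_index y m 0) = distr (measure_pmf (poisson_pmf (rate y))) borel real"
  "block_measure rate (block_index y m (Suc j)) = uniform01"
  by (simp_all add: block_measure_def block_index_def)

lemma real_distribution_block_measure: "real_distribution (block_measure rate i)"
  unfolding block_measure_def
  using real_distribution_uniform01 prob_space.real_distribution_distr[OF prob_space_measure_pmf, of real] by auto

definition block_space :: "(nat \<Rightarrow> real) \<Rightarrow> (nat \<Rightarrow> real) measure" where
  "block_space rate = PiM UNIV (block_measure rate)"

locale poisson_blocks =
  fixes rate :: "nat \<Rightarrow> real" and M :: "(nat \<Rightarrow> real) measure"
  assumes rate_pos: "\<And>y. 0 < rate y"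
  defines "M \<equiv> block_space rate"
begin

sublocale prob_space M
  unfolding M_def block_space_def
  by (intro prob_space_PiM real_distribution.axioms(1) real_distribution_block_measure)

lemma sets_M [measurable_cong]: "sets M = sets (PiM UNIV (\<lambda>_. borel))"
proof -
  have "sets (block_measure rate i) = sets borel" for i
    using real_distribution_block_measure[of rate i] by (simp add: real_distribution.events_eq_borel)
  then show ?thesis unfolding M_def block_space_def by (intro sets_PiM_cong) auto
qed

lemma measurable_coordinate [measurable]: "(\<lambda>\<omega>. \<omega> i) \<in> borel_measurable M"
  by (subst measurable_cong_sets[OF sets_M refl]) simp

lemma distr_coordinate: "distr M borel (\<lambda>\<omega>. \<omega> i) = block_measure rate i"
proof -
  have "distr M borel (\<lambda>\<omega>. \<omega> i) = distr M (block_measure rate i) (\<lambda>\<omega>. \<omega> i)"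
    using real_distribution_block_measure[of rate i] by (intro distr_cong) (simp_all add: real_distribution.events_eq_borel)
  also have "\<dots> = block_measure rate i"
    unfolding M_def block_space_def
    by (intro distr_PiM_component real_distribution.axioms(1) real_distribution_block_measure) auto
  finally show ?thesis .
qed

lemma indep_coordinates: "indep_vars (\<lambda>_. borel) (\<lambda>i \<omega>. \<omega> i) UNIV"
proof -
  have "indep_vars (block_measure rate) (\<lambda>i \<omega>. \<omega> i) UNIV"
    unfolding M_def block_space_def
    by (intro indep_vars_PiM_component real_distribution.axioms(1) real_distribution_block_measure) auto
  from indep_vars_compose2[OF this, of "\<lambda>_ x. x" "\<lambda>_. borel"] real_distribution_block_measure
  show ?thesis by (simp add: measurable_ident_sets real_distribution.events_eq_borel)
qed

lemma measurable_points_prod_PiM: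
  assumes [measurable]: "g \<in> borel_measurable borel" and A: "\<And>j. block_index y m j \<in> A"
  shows "points_prod y m g \<in> borel_measurable (PiM A (\<lambda>_. borel))"
proof -
  have c: "(\<lambda>\<omega>. \<omega> (block_index y m j)) \<in> borel_measurable (PiM A (\<lambda>_. borel))" for j
    using A by (intro measurable_component_singleton)
  have n: "(\<lambda>x::real. nat \<lfloor>x\<rfloor>) \<in> measurable borel (count_space UNIV)" by measurable
  have "(\<lambda>\<omega>. \<Prod>j<k. g (\<omega> (block_index y m (Suc j)))) \<in> borel_measurable (PiM A (\<lambda>_. borel))" for k
    by (intro borel_measurable_prod measurable_compose[OF c assms(1)])
  from measurable_compose_countable[OF this measurable_compose[OF c n]]
  show ?thesis unfolding points_prod_def[abs_def] .
qed

lemma measurable_points_prod: "g \<in> borel_measurable borel \<Longrightarrow> points_prod y m g \<in> borel_measurable M"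
  by (subst measurable_cong_sets[OF sets_M refl]) (intro measurable_points_prod_PiM, auto)

lemma norm_points_prod_le:
  assumes "\<And>x. cmod (g x) \<le> 1"
  shows "cmod (points_prod y m g \<omega>) \<le> 1"
  unfolding points_prod_def prod_norm[symmetric] using assms by (intro prod_le_1) auto

text \<open>Count and positions use disjoint coordinates. Given the count \<open>n\<close> the mean
  is the \<open>n\<close>-th power of the mean of \<open>g\<close> under the uniform law, and
  averaging over the Poisson count gives the exponential.\<close>

lemma expectation_points_prod:
  assumes g[measurable]: "g \<in> borel_measurable borel" and b: "\<And>x. cmod (g x) \<le> 1"
  shows "expectation (points_prod y m g) = exp (of_real (rate y) * ((CLINT x|uniform01. g x) - 1))"
proof -
  let ?A = "{block_index y m 0}" and ?B = "range (\<lambda>j. block_index y m (Suc j))"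
  let ?r = "\<lambda>A \<omega>. restrict (\<lambda>i. \<omega> i) A :: nat \<Rightarrow> real"
  define f where "f x z = (\<Prod>j<nat \<lfloor>x (block_index y m 0)\<rfloor>. g (z (block_index y m (Suc j))))" for x z :: "nat \<Rightarrow> real"
  have ind: "indep_var (PiM ?A (\<lambda>_. borel)) (?r ?A) (PiM ?B (\<lambda>_. borel)) (?r ?B)"
    by (rule indep_var_restrict[OF indep_coordinates]) auto
  let ?c = "CLINT x|uniform01. g x"
  have "expectation (points_prod y m g) = expectation (\<lambda>\<omega>. f (?r ?A \<omega>) (?r ?B \<omega>))"
    by (simp add: points_prod_def[abs_def] f_def)
  also have "\<dots> = expectation (\<lambda>\<omega>. expectation (\<lambda>\<omega>'. f (?r ?A \<omega>) (?r ?B \<omega>')))"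
  proof (rule expectation_indep_pair[OF ind, where B=1])
    show "cmod (f x z) \<le> 1" for x z unfolding f_def prod_norm[symmetric] using b by (intro prod_le_1) auto
    let ?P = "PiM ?A (\<lambda>_. borel) \<Otimes>\<^sub>M PiM ?B (\<lambda>_. borel) :: ((nat \<Rightarrow> real) \<times> (nat \<Rightarrow> real)) measure"
    have [measurable]: "(\<lambda>x. x (block_index y m 0)) \<in> borel_measurable (PiM ?A (\<lambda>_. borel))"
      by (intro measurable_component_singleton) auto
    have [measurable]: "(\<lambda>x. x (block_index y m (Suc j))) \<in> borel_measurable (PiM ?B (\<lambda>_. borel))" for j
      by (intro measurable_component_singleton) auto
    have "(\<lambda>p. nat \<lfloor>fst p (block_index y m 0)\<rfloor>) \<in> measurable ?P (count_space UNIV)" by measurable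
    from measurable_compose_countable[OF _ this, of "\<lambda>k p. \<Prod>j<k. g (snd p (block_index y m (Suc j)))" borel]
    show "case_prod f \<in> borel_measurable ?P" unfolding f_def case_prod_beta by measurable
  qed
  also have "\<dots> = expectation (\<lambda>\<omega>. ?c ^ nat \<lfloor>\<omega> (block_index y m 0)\<rfloor>)"
  proof (rule Bochner_Integration.integral_cong[OF refl])
    fix \<omega> :: "nat \<Rightarrow> real"
    let ?k = "nat \<lfloor>\<omega> (block_index y m 0)\<rfloor>"
    have "expectation (\<lambda>\<omega>'. f (?r ?A \<omega>) (?r ?B \<omega>')) = expectation (\<lambda>\<omega>'. \<Prod>j<?k. g (\<omega>' (block_index y m (Suc j))))"
      by (simp add: f_def)
    also have "\<dots> = (\<Prod>j<?k. expectation (\<lambda>\<omega>'. g (\<omega>' (block_index y m (Suc j)))))"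
    proof (rule indep_vars_lebesgue_integral)
      have "indep_vars (\<lambda>j. PiM {block_index y m (Suc j)} (\<lambda>_. borel)) (\<lambda>j \<omega>. ?r {block_index y m (Suc j)} \<omega>) {..<?k}"
        by (rule indep_vars_restrict[OF indep_coordinates]) (auto simp: disjoint_family_on_def)
      note * = indep_vars_compose2[OF this, of "\<lambda>j x. g (x (block_index y m (Suc j)))" "\<lambda>_. borel"]
      show "indep_vars (\<lambda>_. borel) (\<lambda>j \<omega>. g (\<omega> (block_index y m (Suc j)))) {..<?k}"
      proof -
        have "(\<lambda>x. g (x i)) \<in> borel_measurable (PiM {i} (\<lambda>_. borel))" for i :: nat
          by (rule measurable_compose[OF _ g]) (intro measurable_component_singleton, simp)
        with * show ?thesis by simp
      qed
    qed (use b in \<open>auto intro!: integrable_const_bound[where B=1]\<close>)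
    also have "\<dots> = ?c ^ ?k"
    proof -
      have "expectation (\<lambda>\<omega>'. g (\<omega>' (block_index y m (Suc j)))) = ?c" for j
        unfolding block_measure_index(2)[of rate y m j, symmetric] distr_coordinate[symmetric]
        by (subst integral_distr) auto
      then show ?thesis by simp
    qed
    finally show "expectation (\<lambda>\<omega>'. f (?r ?A \<omega>) (?r ?B \<omega>')) = ?c ^ ?k" .
  qed
  also have "\<dots> = (CLINT x|distr M borel (\<lambda>\<omega>. \<omega> (block_index y m 0)). ?c ^ nat \<lfloor>x\<rfloor>)"
    by (subst integral_distr) auto
  also have "\<dots> = (CLINT n|measure_pmf (poisson_pmf (rate y)). ?c ^ n)"
    unfolding distr_coordinate block_measure_index by (subst integral_distr) auto
  also have "\<dots> = exp (of_real (rate y) * (?c - 1))"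
  proof (rule sums_unique2[OF sums_measure_pmf_nat poisson_exp_sums[OF rate_pos]])
    interpret U: real_distribution uniform01 by (rule real_distribution_uniform01)
    have "cmod ?c \<le> (\<integral>x. cmod (g x) \<partial>uniform01)" by (rule integral_norm_bound)
    also have "\<dots> \<le> 1"
      using b by (intro U.integral_le_const U.integrable_const_bound[where B=1]) auto
    finally show "norm (?c ^ n) \<le> 1" for n by (simp add: norm_power power_le_one)
  qed
  finally show ?thesis .
qed

lemma expectation_prod_points_prod:
  assumes g[measurable]: "\<And>p. g p \<in> borel_measurable borel" and b: "\<And>p x. cmod (g p x) \<le> 1" and P: "finite P"
  shows "expectation (\<lambda>\<omega>. \<Prod>p\<in>P. points_prod (fst p) (snd p) (g p) \<omega>) =
     (\<Prod>p\<in>P. exp (of_real (rate (fst p)) * ((CLINT x|uniform01. g p x) - 1)))"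
proof -
  let ?K = "\<lambda>p. range (block_index (fst p) (snd p))"
  have "indep_vars (\<lambda>p. PiM (?K p) (\<lambda>_. borel)) (\<lambda>p \<omega>. restrict (\<lambda>i. \<omega> i) (?K p)) P"
    by (rule indep_vars_restrict[OF indep_coordinates]) (auto simp: disjoint_family_on_def prod_eq_iff)
  from indep_vars_compose2[OF this, of "\<lambda>p. points_prod (fst p) (snd p) (g p)" "\<lambda>_. borel"]
  have ind: "indep_vars (\<lambda>_. borel) (\<lambda>p \<omega>. points_prod (fst p) (snd p) (g p) \<omega>) P"
    by (simp add: measurable_points_prod_PiM) (simp add: points_prod_def)
  have "expectation (\<lambda>\<omega>. \<Prod>p\<in>P. points_prod (fst p) (snd p) (g p) \<omega>) = (\<Prod>p\<in>P. expectation (points_prod (fst p) (snd p) (g p)))"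
    by (intro indep_vars_lebesgue_integral ind P integrable_const_bound[where B=1])
       (auto intro!: measurable_points_prod norm_points_prod_le b)
  then show ?thesis using expectation_points_prod[OF g b] by simp
qed

end

text \<open>\<open>d i\<close> indicates that \<open>s\<close> lies in the interval from \<tau> i
  (excluded) to \<tau> (Suc i) (included). These intervals are disjoint, so at most one summand is
  nonzero and \<open>iexp\<close> of the sum becomes a sum.\<close>

lemma iexp_step_function:
  fixes \<tau> z :: "nat \<Rightarrow> real" and s :: real
  assumes "\<And>i. i < n \<Longrightarrow> \<tau> i \<le> \<tau> (Suc i)"
  defines "d \<equiv> \<lambda>i. of_bool (s \<le> \<tau> (Suc i)) - of_bool (s \<le> \<tau> i) :: real"
  shows "iexp (\<Sum>i<n. z i * d i) = 1 + (\<Sum>i<n. of_real (d i) * (iexp (z i) - 1))"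
  using assms(1)
proof (induction n)
  case (Suc n)
  have mono: "\<tau> i \<le> \<tau> j" if "i \<le> j" "j \<le> Suc n" for i j
    using that by (induction j rule: dec_induct) (use Suc.prems in \<open>auto intro: order_trans simp: less_Suc_eq_le\<close>)
  show ?case
  proof (cases "s \<le> \<tau> n")
    case True
    then have "d n = 0" using Suc.prems[of n] by (simp add: d_def)
    then show ?thesis using Suc by simp
  next
    case False
    have 0: "d i = 0" if "i < n" for i
      using False mono[of i n] mono[of "Suc i" n] that by (auto simp: d_def)
    then have "(\<Sum>i<n. z i * d i) = 0" "(\<Sum>i<n. of_real (d i) * (iexp (z i) - 1)) = 0" by simp_all
    then show ?thesis using False by (simp add: d_def)
  qed
qed simp

text \<open>The length of the part of \<open>{real m..real m + 1}\<close> to the left of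
  \<open>s\<close>, which is also the distribution function of a uniform point of block
  \<open>m\<close>.\<close>

definition clip :: "nat \<Rightarrow> real \<Rightarrow> real" where
  "clip m s = min 1 (max 0 (s - real m))"

lemma sum_clip: "0 \<le> s \<Longrightarrow> s \<le> real K \<Longrightarrow> (\<Sum>m<K. clip m s) = s"
proof -
  have "(\<Sum>m<K. clip m s) = min s (real K)" if "0 \<le> s" for K
    using that by (induction K) (auto simp: clip_def)
  then show "0 \<le> s \<Longrightarrow> s \<le> real K \<Longrightarrow> (\<Sum>m<K. clip m s) = s" by simp
qed

lemma integral_uniform01_step:
  "(\<integral>x. of_bool (real m + x \<le> s) \<partial>uniform01) = clip m s"
proof -
  interpret U: real_distribution uniform01 by (rule real_distribution_uniform01)
  have "(\<integral>x. of_bool (real m + x \<le> s) \<partial>uniform01) = (\<integral>x. indicator {..s - real m} x \<partial>uniform01)"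
    by (intro Bochner_Integration.integral_cong) (auto simp: indicator_def)
  also have "\<dots> = measure uniform01 {..s - real m}" by simp
  also have "\<dots> = measure lborel ({0..1} \<inter> {..s - real m})"
    by (subst measure_uniform_measure) auto
  also have "{0..1} \<inter> {..s - real m} = {0..min 1 (s - real m)}" by auto
  also have "measure lborel {0..min 1 (s - real m)} = clip m s"
    by (auto simp: clip_def measure_def min_def max_def)
  finally show ?thesis .
qed

section \<open>Cadlag paths and the counting processes\<close>

lemma cadlag_sum:
  fixes f :: "'i \<Rightarrow> real \<Rightarrow> 'b::real_normed_vector"
  assumes "\<And>i. i \<in> I \<Longrightarrow> cadlag (f i)"
  shows "cadlag (\<lambda>t. \<Sum>i\<in>I. f i t)"
proof -
  have "\<exists>l. ((\<lambda>t. \<Sum>i\<in>I. f i t) \<longlongrightarrow> l) (at_left t)" if t: "0 < t" for t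
  proof -
    have "\<exists>l. \<forall>i\<in>I. (f i \<longlongrightarrow> l i) (at_left t)"
      using assms t unfolding cadlag_def by (intro bchoice) auto
    then show ?thesis using tendsto_sum[of I f _ "at_left t"] by blast
  qed
  moreover have "((\<lambda>t. \<Sum>i\<in>I. f i t) \<longlongrightarrow> (\<Sum>i\<in>I. f i t)) (at_right t)" if "0 \<le> t" for t
    using assms that unfolding cadlag_def by (intro tendsto_sum) auto
  ultimately show ?thesis unfolding cadlag_def by (intro conjI allI impI)
qed

lemma cadlag_jump: "cadlag (\<lambda>t. of_bool (s \<le> t) :: real)"
  unfolding cadlag_def
proof (intro conjI allI impI)
  fix t :: real
  show "((\<lambda>t. of_bool (s \<le> t) :: real) \<longlongrightarrow> of_bool (s \<le> t)) (at_right t)"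
  proof (cases "s \<le> t")
    case True
    have "eventually (\<lambda>x. of_bool (s \<le> x) = (of_bool (s \<le> t) :: real)) (at_right t)"
      using eventually_at_right_less[of t] by eventually_elim (use True in auto)
    then show ?thesis by (rule tendsto_eventually)
  next
    case False
    then have "eventually (\<lambda>x. x \<in> {t<..<s}) (at_right t)" by (intro eventually_at_right_real) auto
    then have "eventually (\<lambda>x. of_bool (s \<le> x) = (of_bool (s \<le> t) :: real)) (at_right t)"
      by eventually_elim (use False in auto)
    then show ?thesis by (rule tendsto_eventually)
  qed
  show "\<exists>l. ((\<lambda>t. of_bool (s \<le> t) :: real) \<longlongrightarrow> l) (at_left t)"
  proof (cases "s < t")
    case True
    then have "eventually (\<lambda>x. x \<in> {s<..<t}) (at_left t)" by (intro eventually_at_left_real) auto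
    then have "eventually (\<lambda>x. of_bool (s \<le> x) = (1 :: real)) (at_left t)" by eventually_elim auto
    then show ?thesis by (intro exI tendsto_eventually)
  next
    case False
    have "eventually (\<lambda>x. x \<in> {t - 1<..<t}) (at_left t)" by (intro eventually_at_left_real) auto
    then have "eventually (\<lambda>x. of_bool (s \<le> x) = (0 :: real)) (at_left t)"
      by eventually_elim (use False in auto)
    then show ?thesis by (intro exI tendsto_eventually)
  qed
qed

text \<open>The number of blocks summed in a counting path grows with \<open>t\<close>; up to a
  bounded time it agrees with a fixed finite sum of jump functions, and being cadlag is a local
  property.\<close>

lemma cadlag_local:
  assumes "\<And>t. 0 \<le> t \<Longrightarrow> \<exists>g. cadlag g \<and> (\<forall>x<t + 1. f x = g x)"
  shows "cadlag f"
  unfolding cadlag_def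
proof (intro conjI allI impI)
  fix t :: real assume t: "0 \<le> t"
  from assms[OF t] obtain g where g: "cadlag g" "\<And>x. x < t + 1 \<Longrightarrow> f x = g x" by blast
  have "eventually (\<lambda>x. x \<in> {t<..<t + 1}) (at_right t)" by (intro eventually_at_right_real) auto
  then have "eventually (\<lambda>x. g x = f x) (at_right t)" by eventually_elim (simp add: g)
  moreover have "(g \<longlongrightarrow> f t) (at_right t)" using g t by (simp add: cadlag_def)
  ultimately show "(f \<longlongrightarrow> f t) (at_right t)" by (rule Lim_transform_eventually[rotated])
next
  fix t :: real assume t: "0 < t"
  from assms[of t] t obtain g where g: "cadlag g" "\<And>x. x < t + 1 \<Longrightarrow> f x = g x" by auto
  have "eventually (\<lambda>x. x \<in> {0<..<t}) (at_left t)" using t by (intro eventually_at_left_real) auto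
  then have ev: "eventually (\<lambda>x. g x = f x) (at_left t)" by eventually_elim (simp add: g)
  obtain l where "(g \<longlongrightarrow> l) (at_left t)" using g t by (auto simp: cadlag_def)
  from Lim_transform_eventually[OF this ev] show "\<exists>l. (f \<longlongrightarrow> l) (at_left t)" by blast
qed

context poisson_blocks
begin

definition block_count :: "nat \<Rightarrow> nat \<Rightarrow> real \<Rightarrow> (nat \<Rightarrow> real) \<Rightarrow> real" where
  "block_count y m t \<omega> = (\<Sum>j<nat \<lfloor>\<omega> (block_index y m 0)\<rfloor>. of_bool (real m + \<omega> (block_index y m (Suc j)) \<le> t))"

definition count_process :: "nat \<Rightarrow> real \<Rightarrow> (nat \<Rightarrow> real) \<Rightarrow> real" where
  "count_process y t \<omega> = (\<Sum>m<nat \<lceil>t\<rceil>. block_count y m t \<omega>)"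

abbreviation count_increment :: "nat \<Rightarrow> real \<Rightarrow> real \<Rightarrow> (nat \<Rightarrow> real) \<Rightarrow> real" where
  "count_increment y s t \<omega> \<equiv> count_process y t \<omega> - count_process y s \<omega>"

lemma measurable_block_count [measurable]: "block_count y m t \<in> borel_measurable M"
proof -
  have n: "(\<lambda>x::real. nat \<lfloor>x\<rfloor>) \<in> measurable borel (count_space UNIV)" by measurable
  have "(\<lambda>\<omega>. \<Sum>j<k. of_bool (real m + \<omega> (block_index y m (Suc j)) \<le> t) :: real) \<in> borel_measurable M" for k
    by measurable
  from measurable_compose_countable[OF this measurable_compose[OF measurable_coordinate n]]
  show ?thesis unfolding block_count_def[abs_def] .
qed

lemma measurable_count_process [measurable]: "count_process y t \<in> borel_measurable M"
  unfolding count_process_def[abs_def] by measurable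

lemma AE_coordinates_pos: "AE \<omega> in M. \<forall>y m j. 0 < \<omega> (block_index y m (Suc j))"
  unfolding AE_all_countable
proof (intro allI)
  fix y m j
  have "AE x in uniform01. 0 < x"
  proof -
    have "AE x in lborel. x \<noteq> (0::real)" by (rule AE_lborel_singleton)
    then show ?thesis by (auto simp: AE_uniform_measure elim: eventually_mono)
  qed
  then show "AE \<omega> in M. 0 < \<omega> (block_index y m (Suc j))"
    unfolding block_measure_index(2)[of rate y m j, symmetric] distr_coordinate[symmetric]
    by (subst (asm) AE_distr_iff) auto
qed

text \<open>The points of block \<open>m\<close> lie strictly to the right of \<open>m\<close>, so
  blocks with \<open>t \<le> m\<close> count \<open>0\<close>. All times of a finite sequence can
  thus be treated with a common number \<open>K\<close> of blocks.\<close>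

lemma count_process_eq:
  assumes "\<forall>y m j. 0 < \<omega> (block_index y m (Suc j))" "t \<le> real K"
  shows "count_process y t \<omega> = (\<Sum>m<K. block_count y m t \<omega>)"
  unfolding count_process_def
proof (rule sum.mono_neutral_left)
  show "{..<nat \<lceil>t\<rceil>} \<subseteq> {..<K}" using assms(2) by (simp add: nat_le_iff ceiling_le_iff)
  show "\<forall>m\<in>{..<K} - {..<nat \<lceil>t\<rceil>}. block_count y m t \<omega> = 0"
  proof
    fix m assume "m \<in> {..<K} - {..<nat \<lceil>t\<rceil>}"
    then have "t \<le> real m" by (simp add: not_less nat_le_iff ceiling_le_iff)
    then have "\<not> real m + \<omega> (block_index y m (Suc j)) \<le> t" for j
      using assms(1)[rule_format, of y m j] by linarith
    then show "block_count y m t \<omega> = 0" by (simp add: block_count_def)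
  qed
qed simp

lemma AE_count_process_cadlag: "AE \<omega> in M. \<forall>y. cadlag (\<lambda>t. count_process y t \<omega>)"
  using AE_coordinates_pos
proof eventually_elim
  case (elim \<omega>)
  show ?case
  proof (intro allI cadlag_local)
    fix y and t :: real assume "0 \<le> t"
    let ?K = "nat \<lceil>t + 1\<rceil>"
    have "cadlag (\<lambda>t. \<Sum>m<?K. block_count y m t \<omega>)"
      unfolding block_count_def by (intro cadlag_sum cadlag_jump)
    moreover have "count_process y x \<omega> = (\<Sum>m<?K. block_count y m x \<omega>)" if "x < t + 1" for x
      using that real_nat_ceiling_ge[of "t + 1"] by (intro count_process_eq elim) simp
    ultimately show "\<exists>g. cadlag g \<and> (\<forall>x<t + 1. count_process y x \<omega> = g x)" by blast
  qed
qed

text \<open>One formula for the law of the increments and for their independence over time and over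
  types. The exponent is a sum over single points, so \<open>iexp\<close> factorises over blocks
  into products over points; in each block the means of the step functions are differences of
  \<open>clip\<close>, which add up over the blocks to \<tau> (Suc i) - \<tau> i.\<close>

lemma joint_char_count_process:
  fixes \<tau> :: "nat \<Rightarrow> real" and z :: "nat \<Rightarrow> nat \<Rightarrow> real"
  assumes \<tau>0: "0 \<le> \<tau> 0" and mono: "\<And>i. i < n \<Longrightarrow> \<tau> i \<le> \<tau> (Suc i)" and Y: "finite Y"
  shows "expectation (\<lambda>\<omega>. iexp (\<Sum>y\<in>Y. \<Sum>i<n. z y i * count_increment y (\<tau> i) (\<tau> (Suc i)) \<omega>)) =
    (\<Prod>y\<in>Y. \<Prod>i<n. exp (of_real (rate y * (\<tau> (Suc i) - \<tau> i)) * (iexp (z y i) - 1)))"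
proof -
  have mono': "\<tau> i \<le> \<tau> j" if "i \<le> j" "j \<le> n" for i j
    using that by (induction j rule: dec_induct) (use mono in \<open>auto intro: order_trans simp: Suc_le_eq\<close>)
  have \<tau>: "0 \<le> \<tau> i" "\<tau> i \<le> \<tau> n" if "i \<le> n" for i
    using mono'[of 0 i] mono'[of i n] that \<tau>0 by simp_all
  define K where "K = nat \<lceil>\<tau> n\<rceil>"
  have K: "\<tau> i \<le> real K" if "i \<le> n" for i
    using \<tau>(2)[OF that] real_nat_ceiling_ge[of "\<tau> n"] by (simp add: K_def)
  define d where "d i s = (of_bool (s \<le> \<tau> (Suc i)) - of_bool (s \<le> \<tau> i) :: real)" for i s
  define g where "g p x = iexp (\<Sum>i<n. z (fst p) i * d i (real (snd p) + x))" for p :: "nat \<times> nat" and x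
  have g_meas: "g p \<in> borel_measurable borel" for p unfolding g_def d_def by measurable
  have g_b: "cmod (g p x) \<le> 1" for p x by (simp add: g_def del: of_real_sum)
  have "expectation (\<lambda>\<omega>. iexp (\<Sum>y\<in>Y. \<Sum>i<n. z y i * count_increment y (\<tau> i) (\<tau> (Suc i)) \<omega>)) =
      expectation (\<lambda>\<omega>. \<Prod>p\<in>Y \<times> {..<K}. points_prod (fst p) (snd p) (g p) \<omega>)"
  proof (rule integral_cong_AE)
    show "AE \<omega> in M. iexp (\<Sum>y\<in>Y. \<Sum>i<n. z y i * count_increment y (\<tau> i) (\<tau> (Suc i)) \<omega>) =
       (\<Prod>p\<in>Y \<times> {..<K}. points_prod (fst p) (snd p) (g p) \<omega>)"
      using AE_coordinates_pos
    proof eventually_elim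
      case (elim \<omega>)
      let ?k = "\<lambda>y m. nat \<lfloor>\<omega> (block_index y m 0)\<rfloor>" and ?U = "\<lambda>y m j. \<omega> (block_index y m (Suc j))"
      have cp: "count_process y (\<tau> i) \<omega> = (\<Sum>m<K. block_count y m (\<tau> i) \<omega>)" if "i \<le> n" for y i
        by (rule count_process_eq[OF elim K[OF that]])
      have "(\<Sum>y\<in>Y. \<Sum>i<n. z y i * count_increment y (\<tau> i) (\<tau> (Suc i)) \<omega>) =
          (\<Sum>y\<in>Y. \<Sum>i<n. \<Sum>m<K. \<Sum>j<?k y m. z y i * d i (real m + ?U y m j))"
        by (intro sum.cong refl)
           (simp add: cp block_count_def d_def sum_subtractf[symmetric] sum_distrib_left del: sum_of_bool_eq)
      also have "\<dots> = (\<Sum>y\<in>Y. \<Sum>m<K. \<Sum>j<?k y m. \<Sum>i<n. z y i * d i (real m + ?U y m j))"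
      proof (rule sum.cong[OF refl])
        fix y
        have "(\<Sum>i<n. \<Sum>m<K. \<Sum>j<?k y m. z y i * d i (real m + ?U y m j)) =
            (\<Sum>m<K. \<Sum>i<n. \<Sum>j<?k y m. z y i * d i (real m + ?U y m j))" by (rule sum.swap)
        also have "\<dots> = (\<Sum>m<K. \<Sum>j<?k y m. \<Sum>i<n. z y i * d i (real m + ?U y m j))"
          by (rule sum.cong[OF refl], rule sum.swap)
        finally show "(\<Sum>i<n. \<Sum>m<K. \<Sum>j<?k y m. z y i * d i (real m + ?U y m j)) = \<dots>" .
      qed
      finally have "iexp (\<Sum>y\<in>Y. \<Sum>i<n. z y i * count_increment y (\<tau> i) (\<tau> (Suc i)) \<omega>) =
         (\<Prod>y\<in>Y. \<Prod>m<K. \<Prod>j<?k y m. iexp (\<Sum>i<n. z y i * d i (real m + ?U y m j)))"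
        using Y by (simp only: of_real_sum sum_distrib_left exp_sum finite_lessThan)
      also have "\<dots> = (\<Prod>p\<in>Y \<times> {..<K}. points_prod (fst p) (snd p) (g p) \<omega>)"
        by (simp add: points_prod_def g_def prod.cartesian_product case_prod_beta)
      finally show ?case .
    qed
  qed (auto intro!: borel_measurable_prod measurable_points_prod g_meas)
  also have "\<dots> = (\<Prod>p\<in>Y \<times> {..<K}. exp (of_real (rate (fst p)) * ((CLINT x|uniform01. g p x) - 1)))"
    using Y by (intro expectation_prod_points_prod g_meas g_b) auto
  also have "\<dots> = (\<Prod>y\<in>Y. \<Prod>m<K. exp (of_real (rate y) * (\<Sum>i<n. of_real (clip m (\<tau> (Suc i)) - clip m (\<tau> i)) * (iexp (z y i) - 1))))"
  proof -
    interpret U: real_distribution uniform01 by (rule real_distribution_uniform01)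
    have "(CLINT x|uniform01. g (y, m) x) = 1 + (\<Sum>i<n. of_real (clip m (\<tau> (Suc i)) - clip m (\<tau> i)) * (iexp (z y i) - 1))" for y m
    proof -
      have int: "integrable uniform01 (\<lambda>x. of_bool (real m + x \<le> s) :: real)" for s
        by (intro U.integrable_const_bound[where B=1]) auto
      have "g (y, m) x = 1 + (\<Sum>i<n. of_real (d i (real m + x)) * (iexp (z y i) - 1))" for x
        unfolding g_def d_def fst_conv snd_conv by (rule iexp_step_function) (rule mono)
      then have "(CLINT x|uniform01. g (y, m) x) = (CLINT x|uniform01. 1 + (\<Sum>i<n. of_real (d i (real m + x)) * (iexp (z y i) - 1)))"
        by (simp only:)
      also have "\<dots> = 1 + (\<Sum>i<n. of_real (\<integral>x. d i (real m + x) \<partial>uniform01) * (iexp (z y i) - 1))"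
        using int unfolding d_def
        by (subst Bochner_Integration.integral_add) (auto simp: U.prob_space[simplified])
      also have "(\<lambda>i. \<integral>x. d i (real m + x) \<partial>uniform01) = (\<lambda>i. clip m (\<tau> (Suc i)) - clip m (\<tau> i))"
        using int unfolding d_def by (simp add: integral_uniform01_step)
      finally show ?thesis by (simp add: fun_eq_iff)
    qed
    then show ?thesis unfolding prod.cartesian_product by (intro prod.cong refl) auto
  qed
  also have "\<dots> = (\<Prod>y\<in>Y. \<Prod>i<n. exp (of_real (rate y * (\<tau> (Suc i) - \<tau> i)) * (iexp (z y i) - 1)))"
  proof (rule prod.cong[OF refl])
    fix y
    have "(\<Sum>m<K. of_real (rate y) * (\<Sum>i<n. of_real (clip m (\<tau> (Suc i)) - clip m (\<tau> i)) * (iexp (z y i) - 1))) =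
      (\<Sum>i<n. of_real (rate y * (\<Sum>m<K. clip m (\<tau> (Suc i)) - clip m (\<tau> i))) * (iexp (z y i) - 1))"
      unfolding sum_distrib_left of_real_mult of_real_sum sum_distrib_right
      by (subst sum.swap) (simp add: mult_ac)
    also have "\<dots> = (\<Sum>i<n. of_real (rate y * (\<tau> (Suc i) - \<tau> i)) * (iexp (z y i) - 1))"
      using \<tau> K by (intro sum.cong refl) (simp add: sum_subtractf sum_clip)
    finally show "(\<Prod>m<K. exp (of_real (rate y) * (\<Sum>i<n. of_real (clip m (\<tau> (Suc i)) - clip m (\<tau> i)) * (iexp (z y i) - 1)))) =
       (\<Prod>i<n. exp (of_real (rate y * (\<tau> (Suc i) - \<tau> i)) * (iexp (z y i) - 1)))"
      by (simp only: exp_sum[symmetric] finite_lessThan)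
  qed
  finally show ?thesis .
qed

end

section \<open>Existence of a realisation\<close>

context poisson_blocks
begin

lemma char_count_increment:
  assumes "0 \<le> s" "s \<le> t"
  shows "expectation (\<lambda>\<omega>. iexp (z * count_increment y s t \<omega>)) =
    exp (of_real (rate y * (t - s)) * (iexp z - 1))"
proof -
  have "expectation (\<lambda>\<omega>. iexp (\<Sum>y\<in>{y}. \<Sum>i<1. z * count_increment y ((\<lambda>i. if i = 0 then s else t) i) ((\<lambda>i. if i = 0 then s else t) (Suc i)) \<omega>)) =
    (\<Prod>y\<in>{y}. \<Prod>i<1. exp (of_real (rate y * ((\<lambda>i. if i = 0 then s else t) (Suc i) - (\<lambda>i. if i = 0 then s else t) i)) * (iexp z - 1)))"
    by (rule joint_char_count_process) (use assms in auto)
  then show ?thesis by simp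
qed

lemma indep_count_increments:
  fixes \<tau> :: "nat \<Rightarrow> real"
  assumes "0 \<le> \<tau> 0" and mono: "\<And>i. i < n \<Longrightarrow> \<tau> i \<le> \<tau> (Suc i)" and Y: "finite Y"
  shows "indep_vars (\<lambda>_. borel) (\<lambda>p \<omega>. count_increment (fst p) (\<tau> (snd p)) (\<tau> (Suc (snd p))) \<omega>) (Y \<times> {..<n})"
\<comment> \<open>\<open>indep_vars_char\<close> is stated for nonempty index sets.\<close>
proof (cases "Y \<times> {..<n} = {}")
  case True
  then show ?thesis by (simp only: True) (auto simp: indep_vars_def2 indep_sets_def)
next
  case False
  have nonneg: "0 \<le> \<tau> i" if "i \<le> n" for i
    using that by (induction i) (use mono assms(1) in \<open>auto simp: Suc_le_eq intro: order_trans less_imp_le\<close>)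
  show ?thesis
  proof (rule indep_vars_char[OF _ False])
    fix z :: "nat \<times> nat \<Rightarrow> real"
    have "expectation (\<lambda>\<omega>. \<Prod>p\<in>Y \<times> {..<n}. iexp (z p * count_increment (fst p) (\<tau> (snd p)) (\<tau> (Suc (snd p))) \<omega>)) =
      expectation (\<lambda>\<omega>. iexp (\<Sum>y\<in>Y. \<Sum>i<n. z (y, i) * count_increment y (\<tau> i) (\<tau> (Suc i)) \<omega>))"
    proof (rule Bochner_Integration.integral_cong[OF refl])
      fix \<omega>
      have "(\<Prod>p\<in>Y \<times> {..<n}. iexp (z p * count_increment (fst p) (\<tau> (snd p)) (\<tau> (Suc (snd p))) \<omega>)) =
        iexp (\<Sum>p\<in>Y \<times> {..<n}. z p * count_increment (fst p) (\<tau> (snd p)) (\<tau> (Suc (snd p))) \<omega>)"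
        using Y by (simp only: of_real_sum sum_distrib_left exp_sum finite_cartesian_product finite_lessThan)
      then show "(\<Prod>p\<in>Y \<times> {..<n}. iexp (z p * count_increment (fst p) (\<tau> (snd p)) (\<tau> (Suc (snd p))) \<omega>)) =
        iexp (\<Sum>y\<in>Y. \<Sum>i<n. z (y, i) * count_increment y (\<tau> i) (\<tau> (Suc i)) \<omega>)"
        by (simp only: sum.cartesian_product case_prod_unfold prod.collapse)
    qed
    also have "\<dots> = (\<Prod>y\<in>Y. \<Prod>i<n. exp (of_real (rate y * (\<tau> (Suc i) - \<tau> i)) * (iexp (z (y, i)) - 1)))"
      by (rule joint_char_count_process[OF assms(1) mono Y])
    also have "\<dots> = (\<Prod>y\<in>Y. \<Prod>i<n. expectation (\<lambda>\<omega>. iexp (z (y, i) * count_increment y (\<tau> i) (\<tau> (Suc i)) \<omega>)))"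
    proof (intro prod.cong refl)
      fix y i assume "i \<in> {..<n}"
      then show "exp (of_real (rate y * (\<tau> (Suc i) - \<tau> i)) * (iexp (z (y, i)) - 1)) =
          expectation (\<lambda>\<omega>. iexp (z (y, i) * count_increment y (\<tau> i) (\<tau> (Suc i)) \<omega>))"
        using mono[of i] nonneg[of i] by (subst char_count_increment) auto
    qed
    finally show "expectation (\<lambda>\<omega>. \<Prod>p\<in>Y \<times> {..<n}. iexp (z p * count_increment (fst p) (\<tau> (snd p)) (\<tau> (Suc (snd p))) \<omega>)) =
      (\<Prod>p\<in>Y \<times> {..<n}. expectation (\<lambda>\<omega>. iexp (z p * count_increment (fst p) (\<tau> (snd p)) (\<tau> (Suc (snd p))) \<omega>)))"
      by (simp only: prod.cartesian_product case_prod_unfold prod.collapse)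
  qed (use Y in auto)
qed

lemma distr_count_increment:
  assumes "0 \<le> s" "0 \<le> t"
  shows "distr M borel (\<lambda>\<omega>. count_increment y s (s + t) \<omega>) =
    distr M borel (\<lambda>\<omega>. count_increment y 0 t \<omega>)"
proof (rule Levy_uniqueness)
  show "char (distr M borel (\<lambda>\<omega>. count_increment y s (s + t) \<omega>)) =
    char (distr M borel (\<lambda>\<omega>. count_increment y 0 t \<omega>))"
  proof
    fix z
    have "char (distr M borel (\<lambda>\<omega>. count_increment y p q \<omega>)) z =
       expectation (\<lambda>\<omega>. iexp (z * count_increment y p q \<omega>))" for p q
      unfolding char_def by (subst integral_distr) auto
    then show "char (distr M borel (\<lambda>\<omega>. count_increment y s (s + t) \<omega>)) z =
      char (distr M borel (\<lambda>\<omega>. count_increment y 0 t \<omega>)) z"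
      using char_count_increment[of s "s + t" z y] char_count_increment[of 0 t z y] assms by simp
  qed
qed (auto intro!: real_distribution_distr)

text \<open>Type \<open>0\<close> points are jumps of the first coordinate only, type \<open>1\<close> of the second only, and type
  \<open>2\<close> of both, by the vector \<open>(1, a)\<close>.\<close>

definition combine :: "real \<Rightarrow> (nat \<Rightarrow> real) \<Rightarrow> real \<times> real" where
  "combine a x = (x 0 + x 2, x 1 + a * x 2)"

definition pair_process :: "real \<Rightarrow> real \<Rightarrow> (nat \<Rightarrow> real) \<Rightarrow> real \<times> real" where
  "pair_process a t \<omega> = combine a (\<lambda>y. count_process y t \<omega>)"

lemma pair_process_diff:
  "pair_process a t \<omega> - pair_process a s \<omega> = combine a (\<lambda>y. count_increment y s t \<omega>)"
  by (simp add: pair_process_def combine_def algebra_simps)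

lemma measurable_pair_process: "pair_process a t \<in> borel_measurable M"
  unfolding pair_process_def[abs_def] combine_def borel_prod[symmetric] by measurable

text \<open>The increment is the image under \<open>combine\<close> of three independent counts, so
  its law is determined by their one-dimensional laws, for which stationarity follows from
  characteristic functions.\<close>

lemma distr_pair_increment:
  assumes st: "0 \<le> s" "0 \<le> t"
  shows "distr M borel (\<lambda>\<omega>. pair_process a (s + t) \<omega> - pair_process a s \<omega>) = distr M borel (pair_process a t)"
proof -
  let ?P = "PiM {..<3::nat} (\<lambda>_. borel :: real measure)"
  define X where "X p q y \<omega> = count_increment y p q \<omega>" for p q y \<omega>
  have comb: "combine a \<in> borel_measurable ?P"
  proof -
    have [measurable]: "(\<lambda>x. x y) \<in> borel_measurable ?P" if "y < 3" for y
      using that by (intro measurable_component_singleton) auto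
    have [measurable]: "(\<lambda>x. x 0) \<in> borel_measurable ?P" "(\<lambda>x. x 1) \<in> borel_measurable ?P" "(\<lambda>x. x 2) \<in> borel_measurable ?P"
      by (intro measurable_component_singleton; simp)+
    show ?thesis unfolding combine_def[abs_def] borel_prod[symmetric] by measurable
  qed
  have joint: "distr M borel (\<lambda>\<omega>. pair_process a q \<omega> - pair_process a p \<omega>) =
      distr (PiM {..<3} (\<lambda>y. distr M borel (X p q y))) borel (combine a)" if pq: "0 \<le> p" "p \<le> q" for p q
  proof -
    have Xm: "X p q y \<in> borel_measurable M" for y unfolding X_def[abs_def] by measurable
    have ind: "indep_vars (\<lambda>_. borel) (X p q) {..<3}"
    proof -
      have "indep_vars (\<lambda>_. borel) (\<lambda>r \<omega>. count_increment (fst r) ((\<lambda>i. if i = 0 then p else q) (snd r)) ((\<lambda>i. if i = 0 then p else q) (Suc (snd r))) \<omega>) ({..<3} \<times> {..<1})"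
        by (rule indep_count_increments) (use pq in auto)
      from indep_vars_restrict[OF this, of "{..<3}" "\<lambda>y. {(y, 0)}"]
      have "indep_vars (\<lambda>y. PiM {(y, 0)} (\<lambda>_. borel)) (\<lambda>y \<omega>. \<lambda>r\<in>{(y, 0)}. count_increment (fst r) ((\<lambda>i. if i = 0 then p else q) (snd r)) ((\<lambda>i. if i = 0 then p else q) (Suc (snd r))) \<omega>) {..<3::nat}"
        by (simp add: disjoint_family_on_def)
      from indep_vars_compose2[OF this, of "\<lambda>y x. x (y, 0)" "\<lambda>_. borel"]
      show ?thesis unfolding X_def[abs_def] by (simp add: measurable_component_singleton)
    qed
    have "distr M borel (\<lambda>\<omega>. pair_process a q \<omega> - pair_process a p \<omega>) = distr M borel (\<lambda>\<omega>. combine a (\<lambda>y\<in>{..<3}. X p q y \<omega>))"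
      by (simp add: pair_process_diff X_def combine_def)
    also have "\<dots> = distr (distr M ?P (\<lambda>\<omega>. \<lambda>y\<in>{..<3}. X p q y \<omega>)) borel (combine a)"
      by (subst distr_distr[OF comb]) (auto intro!: measurable_restrict Xm simp: comp_def)
    also have "distr M ?P (\<lambda>\<omega>. \<lambda>y\<in>{..<3}. X p q y \<omega>) = PiM {..<3} (\<lambda>y. distr M borel (X p q y))"
      using ind by (subst (asm) indep_vars_iff_distr_eq_PiM') (auto intro: Xm simp: lessThan_empty_iff)
    finally show ?thesis .
  qed
  have "pair_process a 0 \<omega> = 0" for \<omega>
    by (simp add: pair_process_def combine_def count_process_def zero_prod_def)
  then have "distr M borel (pair_process a t) = distr M borel (\<lambda>\<omega>. pair_process a t \<omega> - pair_process a 0 \<omega>)"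
    by simp
  also have "\<dots> = distr (PiM {..<3} (\<lambda>y. distr M borel (X 0 t y))) borel (combine a)" using st by (intro joint) auto
  also have "(\<lambda>y. distr M borel (X 0 t y)) = (\<lambda>y. distr M borel (X s (s + t) y))"
    using distr_count_increment[OF st] by (simp add: X_def[abs_def])
  also have "distr (PiM {..<3} \<dots>) borel (combine a) = distr M borel (\<lambda>\<omega>. pair_process a (s + t) \<omega> - pair_process a s \<omega>)"
    using st by (intro joint[symmetric]) auto
  finally show ?thesis by simp
qed

lemma levy_process_pair: "levy_process M (pair_process a)"
  unfolding levy_process_def
proof (intro conjI allI impI)
  show "prob_space M" by (rule prob_space_axioms)
  show "pair_process a t \<in> borel_measurable M" for t by (rule measurable_pair_process)
  show "AE \<omega> in M. pair_process a 0 \<omega> = 0"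
    by (simp add: pair_process_def combine_def count_process_def zero_prod_def)
  show "AE \<omega> in M. cadlag (\<lambda>t. pair_process a t \<omega>)"
    using AE_count_process_cadlag
  proof eventually_elim
    case (elim \<omega>)
    have rc: "((\<lambda>t. count_process y t \<omega>) \<longlongrightarrow> count_process y t \<omega>) (at_right t)" if "0 \<le> t" for y t
      using elim that by (simp add: cadlag_def)
    have ll: "\<exists>l. ((\<lambda>t. count_process y t \<omega>) \<longlongrightarrow> l) (at_left t)" if "0 < t" for y t
      using elim that by (simp add: cadlag_def)
    show ?case
      unfolding cadlag_def
    proof (intro conjI allI impI)
      fix t :: real
      show "((\<lambda>t. pair_process a t \<omega>) \<longlongrightarrow> pair_process a t \<omega>) (at_right t)" if "0 \<le> t"
        unfolding pair_process_def combine_def by (intro tendsto_intros rc that)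
      assume t: "0 < t"
      obtain l where "\<And>y. ((\<lambda>t. count_process y t \<omega>) \<longlongrightarrow> l y) (at_left t)"
        using ll[OF t] by metis
      then have "((\<lambda>t. pair_process a t \<omega>) \<longlongrightarrow> combine a l) (at_left t)"
        unfolding pair_process_def combine_def by (intro tendsto_intros)
      then show "\<exists>l. ((\<lambda>t. pair_process a t \<omega>) \<longlongrightarrow> l) (at_left t)" by blast
    qed
  qed
  show "distr M borel (\<lambda>\<omega>. pair_process a (s + t) \<omega> - pair_process a s \<omega>) = distr M borel (pair_process a t)"
    if "0 \<le> s" "0 \<le> t" for s t using that by (rule distr_pair_increment)
  fix n and \<tau> :: "nat \<Rightarrow> real"
  assume "0 \<le> \<tau> 0 \<and> (\<forall>i<n. \<tau> i \<le> \<tau> (Suc i))"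
  then have \<tau>: "0 \<le> \<tau> 0" "\<And>i. i < n \<Longrightarrow> \<tau> i \<le> \<tau> (Suc i)" by auto
  \<comment> \<open>Increments of the three types over the \<open>i\<close>-th interval form one
    group; different groups are independent.\<close>
  let ?K = "\<lambda>i::nat. {..<3::nat} \<times> {i}"
  have "indep_vars (\<lambda>i. PiM (?K i) (\<lambda>_. borel)) (\<lambda>i \<omega>. \<lambda>p\<in>?K i. count_increment (fst p) (\<tau> (snd p)) (\<tau> (Suc (snd p))) \<omega>) {..<n}"
    by (rule indep_vars_restrict[OF indep_count_increments[OF \<tau>, where Y="{..<3}"]]) (auto simp: disjoint_family_on_def)
  then have "indep_vars (\<lambda>_. borel) (\<lambda>i \<omega>. combine a (\<lambda>y. (\<lambda>p\<in>?K i. count_increment (fst p) (\<tau> (snd p)) (\<tau> (Suc (snd p))) \<omega>) (y, i))) {..<n}"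
  proof (rule indep_vars_compose2[where Y="\<lambda>i x. combine a (\<lambda>y. x (y, i))"])
    fix i
    have [measurable]: "(\<lambda>x. x (0, i)) \<in> borel_measurable (PiM (?K i) (\<lambda>_. borel :: real measure))"
        "(\<lambda>x. x (1, i)) \<in> borel_measurable (PiM (?K i) (\<lambda>_. borel :: real measure))" 
        "(\<lambda>x. x (2, i)) \<in> borel_measurable (PiM (?K i) (\<lambda>_. borel :: real measure))"
      by (intro measurable_component_singleton; simp)+
    show "(\<lambda>x. combine a (\<lambda>y. x (y, i))) \<in> borel_measurable (PiM (?K i) (\<lambda>_. borel))"
      unfolding combine_def borel_prod[symmetric] by measurable
  qed
  then show "indep_vars (\<lambda>_. borel) (\<lambda>i \<omega>. pair_process a (\<tau> (Suc i)) \<omega> - pair_process a (\<tau> i) \<omega>) {..<n}"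
    unfolding pair_process_diff by (simp add: combine_def)
qed

lemma char_pair_process:
  assumes t: "0 \<le> t"
  shows "expectation (\<lambda>\<omega>. iexp (z1 * fst (pair_process a t \<omega>) + z2 * snd (pair_process a t \<omega>))) =
    exp (of_real t * joint_exponent (rate 0) (rate 1) (rate 2) a z1 z2)"
proof -
  \<comment> \<open>The frequencies dual to \<open>combine\<close>: a point of type \<open>2\<close>
    moves both coordinates and sees \<open>z1 + a * z2\<close>.\<close>
  define z where "z y = (if y = 0 then z1 else if y = 1 then z2 else z1 + a * z2)" for y :: nat
  have three: "{..<3::nat} = {0, 1, 2}" by auto
  have "expectation (\<lambda>\<omega>. iexp (\<Sum>y<3. \<Sum>i<1. z y * count_increment y ((\<lambda>i. if i = 0 then 0 else t) i) ((\<lambda>i. if i = 0 then 0 else t) (Suc i)) \<omega>)) =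
    (\<Prod>y<3. \<Prod>i<1. exp (of_real (rate y * ((\<lambda>i. if i = 0 then 0 else t) (Suc i) - (\<lambda>i. if i = 0 then 0 else t) i)) * (iexp (z y) - 1)))"
    by (rule joint_char_count_process) (use t in auto)
  moreover have "(\<Sum>y<3. \<Sum>i<1. z y * count_increment y ((\<lambda>i. if i = 0 then 0 else t) i) ((\<lambda>i. if i = 0 then 0 else t) (Suc i)) \<omega>) = z1 * fst (pair_process a t \<omega>) + z2 * snd (pair_process a t \<omega>)" for \<omega>
    by (simp add: three z_def pair_process_def combine_def count_process_def algebra_simps)
  moreover have "(\<Prod>y<3. \<Prod>i<1. exp (of_real (rate y * ((\<lambda>i. if i = 0 then 0 else t) (Suc i) - (\<lambda>i. if i = 0 then 0 else t) i)) * (iexp (z y) - 1)))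
     = exp (of_real t * joint_exponent (rate 0) (rate 1) (rate 2) a z1 z2)"
    unfolding joint_exponent_def by (simp add: three z_def exp_add[symmetric] algebra_simps)
  ultimately show ?thesis by (simp only:)
qed

lemma poisson_pair_process:
  assumes "0 \<le> a"
  shows "poisson_pair M (\<lambda>t \<omega>. fst (pair_process a t \<omega>)) (\<lambda>t \<omega>. snd (pair_process a t \<omega>)) (rate 0) (rate 1) (rate 2) a"
  using levy_process_pair char_pair_process rate_pos[of 0] rate_pos[of 1] rate_pos[of 2] assms
  by unfold_locales auto

end

section \<open>The law of \<open>L\<close> at the first jump\<close>

lemma emeasure_convolution_sum:
  assumes "real_distribution D" "real_distribution E" "A \<in> sets borel"
  shows "emeasure (D \<star> E) A = emeasure (D \<Otimes>\<^sub>M E) {z. fst z + snd z \<in> A}"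
proof -
  interpret D: real_distribution D by fact
  interpret E: real_distribution E by fact
  have [measurable]: "(\<lambda>(x, y). x + y) \<in> borel_measurable (D \<Otimes>\<^sub>M E)" by measurable
  have "emeasure (D \<star> E) A = emeasure (D \<Otimes>\<^sub>M E) ((\<lambda>(x, y). x + y) -` A \<inter> space (D \<Otimes>\<^sub>M E))"
    unfolding convolution_def using assms(3) by (intro emeasure_distr) auto
  also have "(\<lambda>(x, y). x + y) -` A \<inter> space (D \<Otimes>\<^sub>M E) = {z. fst z + snd z \<in> A}"
    by (auto simp: space_pair_measure)
  finally show ?thesis .
qed

text \<open>If \<open>\<rho> = \<eta> \<star> \<eta>\<close> then \<open>\<eta>\<close> has atoms at \<open>0\<close> and at \<open>a\<close>, so that \<open>\<rho>\<close> has an atom at \<open>2 a\<close>.\<close>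

lemma not_ID_if_no_double_atom:
  assumes \<rho>: "real_distribution \<rho>" and a: "0 < a"
    and neg: "emeasure \<rho> {..<0} = 0" and gap: "emeasure \<rho> {0<..<a} = 0"
    and atoms: "emeasure \<rho> {0} \<noteq> 0" "emeasure \<rho> {a} \<noteq> 0" and no_atom: "emeasure \<rho> {2 * a} = 0"
  shows "\<rho> \<notin> ID"
proof
  assume "\<rho> \<in> ID"
  then have "\<forall>n\<ge>1. \<exists>\<eta>. real_distribution \<eta> \<and> \<rho> = convolution_power \<eta> n"
    unfolding ID_def by blast
  then have "\<exists>\<eta>. real_distribution \<eta> \<and> \<rho> = convolution_power \<eta> 2"
    using one_le_numeral by blast
  then obtain \<eta> where \<eta>: "real_distribution \<eta>" and \<rho>2: "\<rho> = convolution_power \<eta> 2"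
    by blast
  interpret \<eta>: real_distribution \<eta> by fact
  interpret P: pair_prob_space \<eta> \<eta> ..
  \<comment> \<open>The first power is the convolution of \<eta> with the point mass at
    \<open>0\<close>; comparing characteristic functions identifies it with \<eta>.\<close>
  have "convolution_power \<eta> 1 = \<eta>"
    by (intro Levy_uniqueness char_convolution_power \<eta> ext) (simp add: char_convolution_power(2)[OF \<eta>] del: convolution_power.simps)
  then have "\<rho> = (\<eta> \<star> \<eta>)" unfolding \<rho>2 by (simp add: numeral_2_eq_2)
  then have em: "emeasure \<rho> A = emeasure (\<eta> \<Otimes>\<^sub>M \<eta>) {z. fst z + snd z \<in> A}" if "A \<in> sets borel" for A
    using emeasure_convolution_sum[OF \<eta> \<eta> that] by simp
  have sumset: "{z. fst z + snd z \<in> A} \<in> sets (\<eta> \<Otimes>\<^sub>M \<eta>)" if "A \<in> sets borel" for A :: "real set"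
  proof -
    have "(\<lambda>z. fst z + snd z) \<in> borel_measurable (\<eta> \<Otimes>\<^sub>M \<eta>)" by measurable
    from measurable_sets[OF this that] show ?thesis by (simp add: vimage_def space_pair_measure)
  qed
  have ge: "emeasure \<eta> A * emeasure \<eta> B \<le> emeasure \<rho> C"
    if "A \<in> sets borel" "B \<in> sets borel" "C \<in> sets borel" "\<And>x y. x \<in> A \<Longrightarrow> y \<in> B \<Longrightarrow> x + y \<in> C" for A B C
  proof -
    have "emeasure \<eta> A * emeasure \<eta> B = emeasure (\<eta> \<Otimes>\<^sub>M \<eta>) (A \<times> B)"
      using that by (intro \<eta>.emeasure_pair_measure_Times[symmetric]) auto
    also have "\<dots> \<le> emeasure \<rho> C"
      unfolding em[OF that(3)] using that by (intro emeasure_mono sumset) auto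
    finally show ?thesis .
  qed
  have null: "A \<times> UNIV \<in> null_sets (\<eta> \<Otimes>\<^sub>M \<eta>)" "UNIV \<times> A \<in> null_sets (\<eta> \<Otimes>\<^sub>M \<eta>)"
    if "A \<in> sets borel" "emeasure \<eta> A = 0" for A
    using that \<eta>.emeasure_pair_measure_Times[of A \<eta> UNIV] \<eta>.emeasure_pair_measure_Times[of UNIV \<eta> A]
    by (auto intro!: null_setsI pair_measureI)
  have n: "emeasure \<eta> {..<0} = 0"
    using ge[of "{..<0}" "{..<0}" "{..<0}"] neg by auto
  \<comment> \<open>A sum equal to \<open>0\<close> has a negative summand or two vanishing ones;
    were \<open>0\<close> not an atom of \<eta>, all such pairs would be null.\<close>
  have atom0: "emeasure \<eta> {0} \<noteq> 0"
  proof
    assume "emeasure \<eta> {0} = 0"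
    then have "emeasure \<rho> {0} \<le> emeasure (\<eta> \<Otimes>\<^sub>M \<eta>) ({..<0} \<times> UNIV \<union> UNIV \<times> {..<0} \<union> {0} \<times> UNIV)"
      unfolding em[OF borel_singleton[OF sets.empty_sets]]
      by (intro emeasure_mono) (auto intro!: sets.Un pair_measureI)
    also have "\<dots> = 0"
      using n \<open>emeasure \<eta> {0} = 0\<close> by (intro null_setsD1 null_sets.Un null) auto
    finally show False using atoms by simp
  qed
  \<comment> \<open>Since \<open>0 + y = y\<close>, the atom at \<open>0\<close> makes a null set of
    \<rho> null for \<eta> as well.\<close>
  have g: "emeasure \<eta> {0<..<a} = 0"
    using ge[of "{0}" "{0<..<a}" "{0<..<a}"] gap atom0 by auto
  have atoma: "emeasure \<eta> {a} \<noteq> 0"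
  proof
    assume 0: "emeasure \<eta> {a} = 0"
    have "emeasure \<rho> {a} \<le> emeasure (\<eta> \<Otimes>\<^sub>M \<eta>) ({..<0} \<times> UNIV \<union> UNIV \<times> {..<0} \<union> {0<..<a} \<times> UNIV \<union> {a} \<times> UNIV \<union> UNIV \<times> {a})"
      unfolding em[OF borel_singleton[OF sets.empty_sets]]
    proof (intro emeasure_mono subsetI)
      \<comment> \<open>If the first summand is \<open>0\<close> the second is \<open>a\<close>; if
        it exceeds \<open>a\<close> the second is negative; in all other cases the first summand
        itself lies in one of the listed sets.\<close>
      fix z :: "real \<times> real" assume "z \<in> {z. fst z + snd z \<in> {a}}"
      then show "z \<in> {..<0} \<times> UNIV \<union> UNIV \<times> {..<0} \<union> {0<..<a} \<times> UNIV \<union> {a} \<times> UNIV \<union> UNIV \<times> {a}"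
        by (cases z) auto
    qed (auto intro!: sets.Un pair_measureI)
    also have "\<dots> = 0"
      using n g 0 by (intro null_setsD1 null_sets.Un null) auto
    finally show False using atoms by simp
  qed
  show False
    using ge[of "{a}" "{a}" "{2 * a}"] no_atom atoma by simp
qed

text \<open>The law \<rho> for \<open>r = p * q\<close>: then \<open>p + r * iexp y\<close> is
  \<open>(1 - q)\<close> times the characteristic function \<open>(1 + q * iexp y) / (1 + q)\<close>
  of a Bernoulli variable with success probability \<open>q / (1 + q)\<close>.\<close>

definition geometric_bernoulli :: "real \<Rightarrow> real \<Rightarrow> real measure" where
  "geometric_bernoulli q a = distr (measure_pmf (pair_pmf (geometric_pmf (1 - q)) (bernoulli_pmf (q / (1 + q)))))
     borel (\<lambda>(n, b). real n + of_bool b * a)"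

context
  fixes q a :: real
  assumes q: "0 < q" "q < 1"
begin

lemma real_distribution_geometric_bernoulli: "real_distribution (geometric_bernoulli q a)"
  unfolding geometric_bernoulli_def by (intro prob_space.real_distribution_distr prob_space_measure_pmf) simp

lemma geometric_bernoulli_convolution:
  "geometric_bernoulli q a = (distr (measure_pmf (geometric_pmf (1 - q))) borel real \<star>
     distr (measure_pmf (bernoulli_pmf (q / (1 + q)))) borel (\<lambda>b. of_bool b * a))"
    (is "_ = (?D \<star> ?E)")
proof (rule measure_eqI)
  interpret D: real_distribution ?D by (intro prob_space.real_distribution_distr prob_space_measure_pmf) simp
  interpret E: real_distribution ?E by (intro prob_space.real_distribution_distr prob_space_measure_pmf) simp
  show "sets (geometric_bernoulli q a) = sets (?D \<star> ?E)" by (simp add: geometric_bernoulli_def)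
  fix A assume "A \<in> sets (geometric_bernoulli q a)"
  then have [measurable]: "A \<in> sets borel" by (simp add: geometric_bernoulli_def)
  have "emeasure (?D \<star> ?E) A = (\<integral>\<^sup>+x. \<integral>\<^sup>+y. indicator A (x + y) \<partial>?E \<partial>?D)"
    by (intro convolution_emeasure' D.finite_measure_axioms E.finite_measure_axioms) auto
  also have "\<dots> = (\<integral>\<^sup>+n. \<integral>\<^sup>+b. indicator A (real n + of_bool b * a)
      \<partial>measure_pmf (bernoulli_pmf (q / (1 + q))) \<partial>measure_pmf (geometric_pmf (1 - q)))"
    by (simp add: nn_integral_distr)
  also have "\<dots> = emeasure (geometric_bernoulli q a) A"
    unfolding geometric_bernoulli_def nn_integral_indicator[symmetric, OF \<open>A \<in> sets (geometric_bernoulli q a)\<close>[unfolded geometric_bernoulli_def]]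
    by (subst nn_integral_distr) (auto simp: nn_integral_pair_pmf' case_prod_beta)
  finally show "emeasure (geometric_bernoulli q a) A = emeasure (?D \<star> ?E) A" by simp
qed

lemma char_geometric_bernoulli:
  "char (geometric_bernoulli q a) z = exp (log_exponent q z - log_exponent (- q) (a * z))"
proof -
  let ?G = "geometric_pmf (1 - q)" and ?B = "bernoulli_pmf (q / (1 + q))"
  have q1: "q / (1 + q) \<le> 1" "0 \<le> q / (1 + q)" using q by auto
  have "char (geometric_bernoulli q a) z =
      char (distr (measure_pmf ?G) borel real) z * char (distr (measure_pmf ?B) borel (\<lambda>b. of_bool b * a)) z"
    unfolding geometric_bernoulli_convolution
    by (intro char_convolution prob_space.real_distribution_distr prob_space_measure_pmf) simp_all
  also have "\<dots> = (CLINT n|measure_pmf ?G. iexp (z * real n)) * (CLINT b|measure_pmf ?B. iexp (z * (of_bool b * a)))"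
    unfolding char_def by (simp add: integral_distr)
  also have "(CLINT n|measure_pmf ?G. iexp (z * real n)) = exp (log_exponent q z)"
  proof -
    have "cmod (of_real q * iexp z) < 1" using q by (simp add: norm_mult)
    from sums_mult[OF geometric_sums[OF this], of "of_real (1 - q)"]
    have "(\<lambda>n. pmf ?G n *\<^sub>R iexp (z * real n)) sums exp (log_exponent q z)"
      using q by (simp add: exp_log_exponent scaleR_conv_of_real power_mult_distrib mult_ac exp_of_nat_mult[symmetric])
    then show ?thesis
      using sums_measure_pmf_nat[of "\<lambda>n. iexp (z * real n)" 1 ?G] sums_unique2 by (fastforce simp del: of_real_mult)
  qed
  also have "(CLINT b|measure_pmf ?B. iexp (z * (of_bool b * a))) = 1 / exp (log_exponent (- q) (a * z))"
  proof -
    have "(CLINT b|measure_pmf ?B. iexp (z * (of_bool b * a))) = of_real (q / (1 + q)) * iexp (a * z) + of_real (1 - q / (1 + q))"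
      using q1 by (subst integral_measure_pmf[of UNIV]) (auto simp: UNIV_bool scaleR_conv_of_real mult_ac)
    also have "\<dots> = (1 + of_real q * iexp (a * z)) / (1 + of_real q)"
    proof -
      have "complex_of_real (1 - q / (1 + q)) = 1 / (1 + of_real q)"
      proof -
        have "1 - q / (1 + q) = 1 / (1 + q)" using q by (simp add: field_simps)
        then have "complex_of_real (1 - q / (1 + q)) = complex_of_real (1 / (1 + q))" by (simp only:)
        then show ?thesis by simp
      qed
      then show ?thesis by (simp add: add_divide_distrib)
    qed
    finally show ?thesis using q by (simp add: exp_log_exponent)
  qed
  finally show ?thesis by (simp add: exp_diff)
qed

text \<open>Both discrete laws have full support, so a null set is one that avoids every
  value.\<close>

lemma emeasure_geometric_bernoulli_eq_0:
  assumes "A \<in> sets borel"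
  shows "emeasure (geometric_bernoulli q a) A = 0 \<longleftrightarrow> (\<forall>n::nat. real n \<notin> A \<and> real n + a \<notin> A)"
proof -
  have b: "set_pmf (bernoulli_pmf (q / (1 + q))) = UNIV"
    using q by (intro set_pmf_bernoulli) auto
  have g: "set_pmf (geometric_pmf (1 - q)) = UNIV"
    using q by (intro set_pmf_geometric) auto
  have "emeasure (geometric_bernoulli q a) A = 0 \<longleftrightarrow>
     set_pmf (pair_pmf (geometric_pmf (1 - q)) (bernoulli_pmf (q / (1 + q)))) \<inter> (\<lambda>(n, b). real n + of_bool b * a) -` A = {}"
    unfolding geometric_bernoulli_def using assms
    by (subst emeasure_distr) (simp_all only: measure_pmf.emeasure_eq_measure measure_pmf_zero_iff ennreal_eq_0_iff
        space_measure_pmf Int_UNIV_right measure_le_0_iff, simp_all)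
  also have "\<dots> \<longleftrightarrow> (\<forall>n b. real n + of_bool b * a \<notin> A)"
    by (simp only: set_pair_pmf g b UNIV_Times_UNIV Int_UNIV_left vimage_def Collect_empty_eq split_paired_All case_prod_conv)
  also have "\<dots> \<longleftrightarrow> (\<forall>n::nat. real n \<notin> A \<and> real n + a \<notin> A)"
    by (simp add: all_bool_eq conj_commute)
  finally show ?thesis .
qed


text \<open>The weight of \<open>Suc j / 3\<close> in the quasi-Levy measure of \<open>geometric_bernoulli q (1 / 3)\<close>.\<close>

definition rho_weight :: "nat \<Rightarrow> real" where
  "rho_weight j = (if 3 dvd Suc j then q ^ (Suc j div 3) / real (Suc j div 3) else 0) - (- q) ^ Suc j / real (Suc j)"

text \<open>Moves the integer jumps of the geometric factor onto the enumeration
  \<open>Suc j / 3\<close> of the finer lattice, so that they share an index with the jumps from the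
  Bernoulli factor.\<close>

lemma third_reindex:
  fixes f :: "nat \<Rightarrow> 'a::{t2_space, comm_monoid_add}"
  shows "(\<lambda>n. f (Suc n)) sums s \<longleftrightarrow> (\<lambda>j. if 3 dvd Suc j then f (Suc j div 3) else 0) sums s"
proof -
  \<comment> \<open>The integer \<open>Suc n\<close> is the lattice point \<open>Suc j / 3\<close>
    with \<open>j = 3 * n + 2\<close>.\<close>
  let ?g = "\<lambda>n::nat. 3 * n + 2"
  have g: "3 dvd Suc (?g n)" "Suc (?g n) div 3 = Suc n" for n by presburger+
  have "strict_mono ?g" by (auto simp: strict_mono_def)
  moreover have "(if 3 dvd Suc j then f (Suc j div 3) else 0) = 0" if "j \<notin> range ?g" for j
  proof -
    have "\<not> 3 dvd Suc j"
    proof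
      assume "3 dvd Suc j"
      then have "j = ?g (Suc j div 3 - 1)" by presburger
      with that show False by blast
    qed
    then show ?thesis by simp
  qed
  ultimately have "(\<lambda>n. if 3 dvd Suc (?g n) then f (Suc (?g n) div 3) else 0) sums s \<longleftrightarrow>
      (\<lambda>j. if 3 dvd Suc j then f (Suc j div 3) else 0) sums s"
    by (rule sums_mono_reindex)
  then show ?thesis by (simp only: g if_True)
qed

lemma rho_weight_sums:
  "(\<lambda>j. of_real (rho_weight j) * (iexp (z * (real (Suc j) / 3)) - 1)) sums (log_exponent q z - log_exponent (- q) (1 / 3 * z))"
proof -
  define f where "f n = of_real (q ^ n / real n) * (iexp (z * real n) - 1)" for n
  have 1: "(\<lambda>n. f (Suc n)) sums log_exponent q z"
    unfolding f_def by (rule log_exponent_sums) (use q in auto)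
  have 2: "(\<lambda>j. of_real ((- q) ^ Suc j / real (Suc j)) * (iexp (1 / 3 * z * real (Suc j)) - 1)) sums log_exponent (- q) (1 / 3 * z)"
    by (rule log_exponent_sums) (use q in auto)
  have eq: "(if 3 dvd Suc j then f (Suc j div 3) else 0) -
      of_real ((- q) ^ Suc j / real (Suc j)) * (iexp (1 / 3 * z * real (Suc j)) - 1)
     = of_real (rho_weight j) * (iexp (z * (real (Suc j) / 3)) - 1)" for j
  proof -
    have e1: "1 / 3 * z * real (Suc j) = z * (real (Suc j) / 3)" by simp
    have e2: "real (Suc j div 3) = real (Suc j) / 3" if "3 dvd Suc j"
      using that by (metis of_nat_numeral real_of_nat_div)
    show ?thesis
    proof (cases "3 dvd Suc j")
      case True
      show ?thesis unfolding f_def rho_weight_def e1 by (simp only: True if_True e2[OF True] of_real_diff left_diff_distrib)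
    next
      case False
      show ?thesis unfolding f_def rho_weight_def e1
        by (simp only: False if_False of_real_diff left_diff_distrib of_real_0 mult_zero_left)
    qed
  qed
  show ?thesis
    using sums_diff[OF 1[unfolded third_reindex] 2] unfolding eq .
qed

lemma summable_rho_weight: "summable (\<lambda>j. \<bar>rho_weight j\<bar>)"
proof (rule summable_comparison_test')
  let ?f = "\<lambda>j. (if 3 dvd Suc j then q ^ (Suc j div 3) / real (Suc j div 3) else 0) + q ^ Suc j"
  have le: "x ^ Suc n / real (Suc n) \<le> x ^ Suc n" if "0 \<le> x" for x :: real and n
    using that mult_left_mono[of 1 "real (Suc n)" "x ^ Suc n"] by (simp add: divide_le_eq del: power_Suc)
  have "summable (\<lambda>n. q ^ Suc n / real (Suc n))"
    by (rule summable_comparison_test'[OF sums_summable[OF geometric_Suc_sums[of q]]])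
       (use q le[of q] in \<open>auto simp del: power_Suc of_nat_Suc\<close>)
  then have "summable (\<lambda>j. if 3 dvd Suc j then q ^ (Suc j div 3) / real (Suc j div 3) else 0)"
    unfolding summable_def third_reindex[of "\<lambda>n. q ^ n / real n", symmetric] .
  moreover have "summable (\<lambda>n. q ^ Suc n)" using q by (intro sums_summable[OF geometric_Suc_sums]) auto
  ultimately show "summable ?f" by (rule summable_add)
  fix j
  have "\<bar>(- q) ^ Suc j / real (Suc j)\<bar> = q ^ Suc j / real (Suc j)"
    using q by (simp add: power_abs abs_mult del: of_nat_Suc)
  also have "\<dots> \<le> q ^ Suc j" using q by (intro le) auto
  finally have B: "\<bar>(- q) ^ Suc j / real (Suc j)\<bar> \<le> q ^ Suc j" .
  have A: "0 \<le> (if 3 dvd Suc j then q ^ (Suc j div 3) / real (Suc j div 3) else 0)" using q by simp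
  show "norm \<bar>rho_weight j\<bar> \<le> ?f j"
    unfolding rho_weight_def real_norm_def abs_abs
    by (rule order_trans[OF abs_triangle_ineq4 add_mono[OF _ B]]) (simp only: abs_of_nonneg[OF A] order_refl)
qed

end

section \<open>Quasi-infinite divisibility from a summable signed jump measure\<close>

lemma integral_weighted_points:
  fixes W x :: "nat \<Rightarrow> real" and f :: "real \<Rightarrow> complex"
  assumes W: "\<And>j. 0 \<le> W j" "summable W" and f: "f \<in> borel_measurable borel" "\<And>y. cmod (f y) \<le> B"
  shows "(\<lambda>j. of_real (W j) * f (x j)) sums (CLINT y|distr (density (count_space UNIV) (\<lambda>j. ennreal (W j))) borel x. f y)"
proof -
  have "summable (\<lambda>j. norm (W j *\<^sub>R f (x j)))"
  proof (rule summable_comparison_test')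
    show "summable (\<lambda>j. W j * B)" using W by (intro summable_mult2)
    show "norm (norm (W j *\<^sub>R f (x j))) \<le> W j * B" for j using W f by (auto intro: mult_left_mono)
  qed
  then have "integrable (count_space UNIV) (\<lambda>j. W j *\<^sub>R f (x j))"
    by (simp add: integrable_count_space_nat_iff)
  from sums_integral_count_space_nat[OF this]
  show ?thesis using f(1) W by (simp add: integral_distr integral_density scaleR_conv_of_real)
qed

text \<open>The positive and negative parts of the weights give the two measures; they live on
  disjoint sets because \<open>x\<close> is injective. Total masses are finite, so the truncated
  linear term can be split off and absorbed into the drift \<gamma>.\<close>

lemma quasi_ID_weighted_points:
  fixes W x :: "nat \<Rightarrow> real"
  assumes \<sigma>: "real_distribution \<sigma>" and W: "summable (\<lambda>j. \<bar>W j\<bar>)" and x: "inj x" "\<And>j. x j \<noteq> 0"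
    and char: "\<And>z. \<exists>\<psi>. (\<lambda>j. of_real (W j) * (iexp (z * x j) - 1)) sums \<psi> \<and> char \<sigma> z = exp \<psi>"
  shows "\<sigma> \<in> quasi_ID"
proof -
  define m where "m V = distr (density (count_space UNIV) (\<lambda>j. ennreal (V j))) borel x" for V :: "nat \<Rightarrow> real"
  define P where "P j = max (W j) 0" for j
  define Q where "Q j = max (- W j) 0" for j
  have PQ: "\<And>j. 0 \<le> P j" "\<And>j. 0 \<le> Q j" by (auto simp: P_def Q_def)
  have sPQ: "summable P" "summable Q"
    by (rule summable_comparison_test'[OF W], simp add: P_def Q_def)+
  have em: "emeasure (m V) A = (\<integral>\<^sup>+j. ennreal (V j) * indicator A (x j) \<partial>count_space UNIV)" if "A \<in> sets borel" for V A
    unfolding m_def using that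
    by (subst emeasure_distr) (auto simp: emeasure_density intro!: nn_integral_cong split: split_indicator)
  have em0: "emeasure (m V) A = 0 \<longleftrightarrow> (\<forall>j. x j \<in> A \<longrightarrow> V j \<le> 0)" if "A \<in> sets borel" for V A
    unfolding em[OF that] by (subst nn_integral_0_iff_AE) (auto simp: AE_count_space indicator_def ennreal_eq_0_iff)
  have tot: "(\<integral>\<^sup>+y. ennreal (min (y\<^sup>2) 1) \<partial>m V) < \<infinity>" if "\<And>j. 0 \<le> V j" "summable V" for V
  proof -
    have "(\<integral>\<^sup>+y. ennreal (min (y\<^sup>2) 1) \<partial>m V) \<le> (\<integral>\<^sup>+y. 1 \<partial>m V)"
      by (intro nn_integral_mono) (auto simp: ennreal_le_1)
    also have "\<dots> = (\<integral>\<^sup>+j. ennreal (V j) \<partial>count_space UNIV)"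
      using em[of UNIV V] by (simp add: m_def)
    also have "\<dots> = (\<Sum>j. ennreal (V j))" by (rule nn_integral_count_space_nat)
    also have "\<dots> < \<infinity>" using that by (subst suminf_ennreal2) auto
    finally show ?thesis .
  qed
  have A: "x ` {j. W j > 0} \<in> sets borel"
    by (rule sets.countable) (simp_all add: countableI_type)
  have "signed_levy_measure (m P) (m Q)"
    unfolding signed_levy_measure_def
  proof (intro conjI bexI)
    show "emeasure (m P) (- x ` {j. W j > 0}) = 0"
      using A by (subst em0) (auto simp: P_def)
    show "emeasure (m Q) (- (- x ` {j. W j > 0})) = 0"
      using A x(1) by (subst em0) (auto simp: Q_def inj_image_mem_iff)
    show "- x ` {j. W j > 0} \<in> sets borel" using A by (rule borel_comp)
    show "emeasure (m P) {0} = 0" "emeasure (m Q) {0} = 0" using x(2) by (auto simp: em0)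
    show "(\<integral>\<^sup>+y. ennreal (min (y\<^sup>2) 1) \<partial>m P) + (\<integral>\<^sup>+y. ennreal (min (y\<^sup>2) 1) \<partial>m Q) < \<infinity>"
      using tot[of P] tot[of Q] PQ sPQ by simp
  qed (simp_all add: m_def)
  \<comment> \<open>The truncation of the Levy-Khintchine integrand; its weighted sum over the
    points is the drift.\<close>
  moreover define c where "c y = y * indicator {-1..1} y" for y :: real
  have c1: "\<bar>c y\<bar> \<le> 1" for y by (auto simp: c_def indicator_def)
  have sc: "summable (\<lambda>j. W j * c (x j))"
  proof (rule summable_comparison_test'[OF W])
    show "norm (W j * c (x j)) \<le> \<bar>W j\<bar>" for j using c1[of "x j"] by (simp add: abs_mult mult_left_le)
  qed
  moreover have "char \<sigma> z = exp (\<i> * complex_of_real ((\<Sum>j. W j * c (x j)) * z) - complex_of_real (0 * z\<^sup>2) +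
      ((CLINT y|m P. levy_khintchine_integrand z y) - (CLINT y|m Q. levy_khintchine_integrand z y)))" for z
  proof -
    have lk: "levy_khintchine_integrand z y = iexp (z * y) - 1 - \<i> * complex_of_real (z * c y)" for y
      by (simp add: levy_khintchine_integrand_def c_def mult.assoc)
    have meas: "levy_khintchine_integrand z \<in> borel_measurable borel"
      unfolding levy_khintchine_integrand_def[abs_def] by measurable
    have bound: "cmod (levy_khintchine_integrand z y) \<le> 2 + \<bar>z\<bar>" for y
    proof -
      have "cmod (levy_khintchine_integrand z y) \<le> cmod (iexp (z * y)) + cmod 1 + cmod (\<i> * complex_of_real (z * c y))"
        unfolding lk by (intro order_trans[OF norm_triangle_ineq4] add_mono norm_triangle_ineq4 order_refl)
      also have "\<dots> \<le> 2 + \<bar>z\<bar>"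
        using c1[of y] by (simp add: norm_mult abs_mult mult_left_le)
      finally show ?thesis .
    qed
    obtain \<psi> where \<psi>: "(\<lambda>j. of_real (W j) * (iexp (z * x j) - 1)) sums \<psi>" "char \<sigma> z = exp \<psi>"
      using char by blast
    have PQW: "of_real (P j) * y - of_real (Q j) * y = of_real (W j) * (y::complex)" for j y
      unfolding left_diff_distrib[symmetric] of_real_diff[symmetric] by (simp add: P_def Q_def max_def)
    have "(\<lambda>j. of_real (W j) * levy_khintchine_integrand z (x j)) sums
        ((CLINT y|m P. levy_khintchine_integrand z y) - (CLINT y|m Q. levy_khintchine_integrand z y))"
      using sums_diff[OF integral_weighted_points[OF PQ(1) sPQ(1) meas bound, of x] integral_weighted_points[OF PQ(2) sPQ(2) meas bound, of x]]
      unfolding PQW m_def .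
    moreover have "(\<lambda>j. of_real (W j) * (iexp (z * x j) - 1) - \<i> * of_real z * of_real (W j * c (x j))) sums
       (\<psi> - \<i> * of_real z * of_real (\<Sum>j. W j * c (x j)))"
      by (intro sums_diff \<psi>(1) sums_mult sums_of_real summable_sums sc)
    moreover have "of_real (W j) * (iexp (z * x j) - 1) - \<i> * of_real z * of_real (W j * c (x j)) = 
      of_real (W j) * levy_khintchine_integrand z (x j)" for j
      unfolding lk by (simp add: algebra_simps)
    ultimately have "(CLINT y|m P. levy_khintchine_integrand z y) - (CLINT y|m Q. levy_khintchine_integrand z y) =
        \<psi> - \<i> * of_real z * of_real (\<Sum>j. W j * c (x j))"
      using sums_unique2 by simp
    then show ?thesis unfolding \<psi>(2) by (simp add: mult_ac)
  qed
  ultimately show ?thesis using \<sigma> unfolding quasi_ID_def by blast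
qed

lemma geometric_bernoulli_ID0:
  assumes q: "0 < q" "q < 1"
  shows "geometric_bernoulli q (1 / 3) \<in> ID0"
proof -
  note zero = emeasure_geometric_bernoulli_eq_0[OF q]
  have "geometric_bernoulli q (1 / 3) \<in> quasi_ID"
  proof (rule quasi_ID_weighted_points)
    show "summable (\<lambda>j. \<bar>rho_weight q j\<bar>)" by (rule summable_rho_weight[OF q])
    show "inj (\<lambda>j. real (Suc j) / 3)" by (auto simp: inj_def)
    show "\<exists>\<psi>. (\<lambda>j. of_real (rho_weight q j) * (iexp (z * (real (Suc j) / 3)) - 1)) sums \<psi> \<and>
        char (geometric_bernoulli q (1 / 3)) z = exp \<psi>" for z
      using rho_weight_sums[OF q] char_geometric_bernoulli[OF q] by blast
  qed (auto simp del: of_nat_Suc intro: real_distribution_geometric_bernoulli q)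
  moreover have "geometric_bernoulli q (1 / 3) \<notin> ID"
  proof (rule not_ID_if_no_double_atom[where a="1 / 3"])
    \<comment> \<open>Excludes \<open>n = 1 / 3\<close> and \<open>n = 2 / 3\<close>: an atom at
      \<open>2 / 3\<close> would need \<open>n = 2 / 3\<close> or
      \<open>n + 1 / 3 = 2 / 3\<close>.\<close>
    have int: "3 * real n \<noteq> 1" "3 * real n \<noteq> 2" for n
    proof -
      have "3 * n \<noteq> 1" "3 * n \<noteq> 2" by presburger+
      then have "real (3 * n) \<noteq> real 1" "real (3 * n) \<noteq> real 2" unfolding of_nat_eq_iff .
      then show "3 * real n \<noteq> 1" "3 * real n \<noteq> 2" by simp_all
    qed
    show "emeasure (geometric_bernoulli q (1 / 3)) {..<0} = 0" by (subst zero) auto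
    show "emeasure (geometric_bernoulli q (1 / 3)) {0<..<1 / 3} = 0" by (subst zero) (auto simp: not_less)
    show "emeasure (geometric_bernoulli q (1 / 3)) {0} \<noteq> 0" by (subst zero) (auto intro: exI[of _ 0])
    show "emeasure (geometric_bernoulli q (1 / 3)) {1 / 3} \<noteq> 0" by (subst zero) (auto intro: exI[of _ 0])
    show "emeasure (geometric_bernoulli q (1 / 3)) {2 * (1 / 3)} = 0" 
      using int by (subst zero) (auto simp: field_simps)
  qed (use q in \<open>auto intro: real_distribution_geometric_bernoulli\<close>)
  ultimately show ?thesis by (simp add: ID0_def)
qed

section \<open>The corollary\<close>

lemma integral_nu:
  fixes f :: "real \<times> real \<Rightarrow> complex"
  assumes "0 < c" "0 \<le> u" "0 \<le> v" "0 \<le> w" and f: "f \<in> borel_measurable borel"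
  shows "(CLINT x|nu k c u v w. f x) = of_real u * f (1, 0) + of_real v * f (0, 1) + of_real w * f (1, c powi (- k))"
proof -
  let ?A = "{(1, 0), (0, 1), (1, c powi (- k))} :: (real \<times> real) set"
  let ?g = "\<lambda>x :: real \<times> real. if x = (1, 0) then u else if x = (0, 1) then v else w"
  have "nu k c u v w = distr (point_measure ?A (\<lambda>x. ennreal (?g x))) borel (\<lambda>x. x)"
    unfolding nu_def by (intro arg_cong[where f="\<lambda>m. distr m borel (\<lambda>x. x)"] arg_cong[where f="point_measure ?A"] ext) simp
  then have "(CLINT x|nu k c u v w. f x) = (CLINT x|point_measure ?A (\<lambda>x. ennreal (?g x)). f x)"
    using f by (simp add: integral_distr)
  also have "\<dots> = (\<Sum>x\<in>?A. ?g x *\<^sub>R f x)"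
    using assms by (intro lebesgue_integral_point_measure_finite) auto
  also have "\<dots> = of_real u * f (1, 0) + of_real v * f (0, 1) + of_real w * f (1, c powi (- k))"
  proof -
    \<comment> \<open>As \<open>a\<close> is nonzero, the points \<open>(1, 0)\<close> and
      \<open>(1, a)\<close> differ and the three masses do not merge.\<close>
    define a where "a = c powi (- k)"
    have "a \<noteq> 0" using assms(1) by (simp add: a_def)
    then show ?thesis unfolding a_def[symmetric] by (simp add: scaleR_conv_of_real)
  qed
  finally show ?thesis .
qed

lemma bivariate_compound_poisson_iff:
  assumes "0 < c" "0 \<le> u" "0 \<le> v" "0 \<le> w" "0 < u + w"
  shows "bivariate_compound_poisson k c u v w M N L \<longleftrightarrow> poisson_pair M N L u v w (c powi (- k))"
proof -
  have "(CLINT x|nu k c u v w. (iexp (z1 * fst x + z2 * snd x) - 1)) = joint_exponent u v w (c powi (- k)) z1 z2" for z1 z2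
  proof -
    have "(\<lambda>x :: real \<times> real. iexp (z1 * fst x + z2 * snd x) - 1) \<in> borel_measurable borel"
      unfolding borel_prod[symmetric] by measurable
    then show ?thesis
      by (subst integral_nu) (use assms in \<open>auto simp: joint_exponent_def mult.commute\<close>)
  qed
  then show ?thesis
    unfolding bivariate_compound_poisson_def poisson_pair_def using assms by (auto simp: less_imp_le)
qed

text \<open>The rates are \<open>p\<close>, \<open>q\<close>, \<open>r\<close> up to a common speed
  \<open>s\<close>. It multiplies \<open>kappa\<close> and \<open>beta\<close> alike, so it cancels
  in the quotient and in the functional equation.\<close>

lemma rates_imp:
  assumes "rates p q r u v w"
  obtains s where "0 < s" "u = s * p" "v = s * q" "w = s * r" "0 \<le> p" "0 \<le> q" "0 \<le> r" "p + q + r = 1"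
proof -
  have "0 < u + v + w" "0 \<le> u" "0 \<le> v" "0 \<le> w" using assms by (auto simp: rates_def)
  moreover have "p = u / (u + v + w)" "q = v / (u + v + w)" "r = w / (u + v + w)" using assms by (auto simp: rates_def)
  ultimately show thesis by (intro that[of "u + v + w"]) (auto simp flip: add_divide_distrib)
qed

lemma realisation_exists:
  assumes "0 < c" "0 < p" "0 < q" "0 < r" "p + q + r = 1"
  shows "\<exists>(M :: (nat \<Rightarrow> real) measure) N L. rates p q r p q r \<and> bivariate_compound_poisson k c p q r M N L"
proof -
  \<comment> \<open>\<open>poisson_blocks\<close> asks for a positive rate of every type; the value
    \<open>r\<close> serves for all types from \<open>2\<close> on.\<close>
  define rt where "rt y = (if y = 0 then p else if y = 1 then q else r)" for y :: nat
  interpret B: poisson_blocks rt "block_space rt" by unfold_locales (use assms in \<open>auto simp: rt_def\<close>)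
  have "rates p q r p q r" using assms by (simp add: rates_def)
  moreover have "bivariate_compound_poisson k c p q r (block_space rt)
     (\<lambda>t \<omega>. fst (B.pair_process (c powi (- k)) t \<omega>)) (\<lambda>t \<omega>. snd (B.pair_process (c powi (- k)) t \<omega>))"
    using B.poisson_pair_process[of "c powi (- k)"] assms
    by (subst bivariate_compound_poisson_iff) (auto simp: rt_def)
  ultimately show ?thesis by blast
qed

text \<open>Every admissible law has characteristic function \<open>beta / kappa\<close>, which is
  that of \<sigma>; the block construction provides an admissible law. Together these evaluate the
  \<open>THE\<close>.\<close>

lemma rho_eqI:
  assumes c: "0 < c" and pqr: "0 < p" "0 < q" "0 < r" "p + q + r = 1"
    and \<sigma>: "real_distribution \<sigma>"
    and ch: "\<And>z. char \<sigma> z = (of_real p + of_real r * iexp (c powi (- k) * z)) / (1 - of_real q * iexp z)"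
  shows "rho k c p q r = \<sigma>"
proof -
  have unique: "\<sigma>' = \<sigma>" if "is_rho_law TYPE(nat \<Rightarrow> real) k c p q r \<sigma>'" for \<sigma>'
  proof -
    from that obtain u v w and M :: "(nat \<Rightarrow> real) measure" and N L Y
      where rates: "rates p q r u v w" and X: "bivariate_compound_poisson k c u v w M N L"
        and Y: "Y \<in> borel_measurable M" "AE \<omega> in M. Y \<omega> = L (first_jump_time (\<lambda>t. N t \<omega>)) \<omega>" "\<sigma>' = distr M borel Y"
      unfolding is_rho_law_def by blast
    from rates obtain s where s: "0 < s" "u = s * p" "v = s * q" "w = s * r" by (rule rates_imp)
    interpret poisson_pair M N L u v w "c powi (- k)"
      using X c s pqr by (subst (asm) bivariate_compound_poisson_iff) (auto intro: add_pos_pos)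
    show ?thesis
      unfolding Y(3)
    proof (rule Levy_uniqueness[OF real_distribution_distr \<sigma>])
      show "char (distr M borel Y) = char \<sigma>"
      proof
        fix z
        have "beta z = of_real s * (of_real p + of_real r * iexp (c powi (- k) * z))"
          unfolding beta_def by (simp add: s algebra_simps)
        moreover have "kappa z = of_real s * (1 - of_real q * iexp z)"
        proof -
          have "u + v + w = s" using pqr(4) by (simp add: s flip: distrib_left)
          then show ?thesis unfolding kappa_def by (simp add: s(3) algebra_simps del: of_real_add)
        qed
        ultimately show "char (distr M borel Y) z = char \<sigma> z"
          using s(1) by (simp add: char_L_first_jump[OF Y(1,2)] ch)
      qed
    qed (rule Y(1))
  qed
  obtain M :: "(nat \<Rightarrow> real) measure" and N L where rates: "rates p q r p q r" and X: "bivariate_compound_poisson k c p q r M N L"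
    using realisation_exists[OF c pqr] by blast
  interpret poisson_pair M N L p q r "c powi (- k)"
    using X c pqr by (subst (asm) bivariate_compound_poisson_iff) auto
  obtain Y where "Y \<in> borel_measurable M" "AE \<omega> in M. Y \<omega> = L (first_jump_time (\<lambda>t. N t \<omega>)) \<omega>"
    using exists_L_first_jump by blast
  then have law: "is_rho_law TYPE(nat \<Rightarrow> real) k c p q r (distr M borel Y)"
    unfolding is_rho_law_def using rates X by blast
  from unique[OF law] law have "is_rho_law TYPE(nat \<Rightarrow> real) k c p q r \<sigma>" by simp
  then show ?thesis unfolding rho_def using unique by (rule the_equality)
qed

text \<open>The characteristic function of \<sigma> takes the place of \<open>F\<close> in
  \<open>mu_char\<close>, with \<open>eq\<close> as the martingale condition. Any realisation then
  yields \<sigma>, and the block construction supplies one.\<close>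

lemma mu_eqI:
  assumes c: "1 < c" and pqr: "0 < p" "0 < q" "0 < r" "p + q + r = 1"
    and \<sigma>: "real_distribution \<sigma>" and lip: "\<And>z. cmod (char \<sigma> z - 1) \<le> m * \<bar>z\<bar>"
    and eq: "\<And>z. (of_real p + of_real r * iexp (c powi (- k) * z)) * char \<sigma> (z / c) = (1 - of_real q * iexp z) * char \<sigma> z"
  shows "mu k c p q r = \<sigma>"
proof -
  interpret \<sigma>: real_distribution \<sigma> by fact
  have unique: "\<sigma>' = \<sigma>" if "is_mu_law TYPE(nat \<Rightarrow> real) k c p q r \<sigma>'" for \<sigma>'
  proof -
    from that obtain u v w and M :: "(nat \<Rightarrow> real) measure" and N L Z
      where rates: "rates p q r u v w" and X: "bivariate_compound_poisson k c u v w M N L"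
        and Z: "Z \<in> borel_measurable M"
          "AE \<omega> in M. ((\<lambda>t. stieltjes_integral c (\<lambda>s. N s \<omega>) (\<lambda>s. L s \<omega>) t) \<longlongrightarrow> Z \<omega>) at_top" "\<sigma>' = distr M borel Z"
      unfolding is_mu_law_def by blast
    from rates obtain s where s: "0 < s" "u = s * p" "v = s * q" "w = s * r" by (rule rates_imp)
    interpret poisson_pair M N L u v w "c powi (- k)"
      using X c s pqr by (subst (asm) bivariate_compound_poisson_iff) (auto intro: add_pos_pos)
    interpret mu_char M N L u v w "c powi (- k)" c "char \<sigma>"
    proof
      fix z
      have "beta z = of_real s * (of_real p + of_real r * iexp (c powi (- k) * z))"
        unfolding beta_def by (simp add: s algebra_simps)
      moreover have "kappa z = of_real s * (1 - of_real q * iexp z)"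
      proof -
        have "u + v + w = s" using pqr(4) by (simp add: s flip: distrib_left)
        then show ?thesis unfolding kappa_def by (simp add: s(3) algebra_simps del: of_real_add)
      qed
      ultimately show "beta z * char \<sigma> (z / c) = kappa z * char \<sigma> z"
        using eq[of z] by (simp only: mult.assoc)
    qed (use c \<sigma>.cmod_char_le_1 \<sigma>.char_measurable in auto)
    show ?thesis
      unfolding Z(3)
      by (rule Levy_uniqueness[OF real_distribution_distr \<sigma>])
         (use Z(1) char_stochastic_integral[OF lip Z(1,2)] in \<open>auto simp: fun_eq_iff\<close>)
  qed
  have c0: "0 < c" using c by simp
  obtain M :: "(nat \<Rightarrow> real) measure" and N L where rates: "rates p q r p q r" and X: "bivariate_compound_poisson k c p q r M N L"
    using realisation_exists[OF c0 pqr] by blast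
  interpret poisson_pair M N L p q r "c powi (- k)"
    using X c0 pqr by (subst (asm) bivariate_compound_poisson_iff) auto
  obtain Z where "Z \<in> borel_measurable M"
      "AE \<omega> in M. ((\<lambda>t. stieltjes_integral c (\<lambda>s. N s \<omega>) (\<lambda>s. L s \<omega>) t) \<longlongrightarrow> Z \<omega>) at_top"
    using exists_stochastic_integral[OF c] by blast
  then have law: "is_mu_law TYPE(nat \<Rightarrow> real) k c p q r (distr M borel Z)"
    unfolding is_mu_law_def using rates X by blast
  from unique[OF law] law have "is_mu_law TYPE(nat \<Rightarrow> real) k c p q r \<sigma>" by simp
  then show ?thesis unfolding mu_def using unique by (rule the_equality)
qed

theorem corollary5p4:
  fixes k :: nat
  assumes "k \<ge> 1"
  shows "\<exists>c p q r :: real.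
    c > 1 \<and> p \<ge> 0 \<and> q \<ge> 0 \<and> r \<ge> 0 \<and> p + q + r = 1 \<and> p + r > 0 \<and> q + r > 0 \<and>
    mu (int k) c p q r \<in> ID \<and> rho (int k) c p q r \<in> ID0"
proof -
  \<comment> \<open>Makes the joint jump height \<open>c powi (- k)\<close> equal to
    \<open>1 / 3\<close>.\<close>
  define c where "c = root k 3"
  \<comment> \<open>With \<open>q = 1 / 2\<close>, the conditions \<open>r = p * q\<close> and
    \<open>p + q + r = 1\<close> leave only these values.\<close>
  define p q r :: real where "p = 1 / 3" and "q = 1 / 2" and "r = 1 / 6"
  have c: "1 < c" using assms by (simp add: c_def)
  have ck: "c ^ k = 3" using assms by (simp add: c_def)
  have a: "c powi (- int k) = 1 / 3" by (simp add: power_int_minus ck inverse_eq_divide)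
  have bk: "(1 / c) ^ k = 1 / 3" by (simp add: power_divide ck)
  have b: "0 < 1 / c" "1 / c < 1" and q: "0 < q" "q < 1" using c by (auto simp: q_def)
  have pqr: "0 < p" "0 < q" "0 < r" "p + q + r = 1" by (auto simp: p_def q_def r_def)
  have "rho (int k) c p q r = geometric_bernoulli q (1 / 3)"
  proof (rule rho_eqI[OF _ pqr real_distribution_geometric_bernoulli[OF q]])
    fix z
    have "char (geometric_bernoulli q (1 / 3)) z = exp (log_exponent q z) / exp (log_exponent (- q) (1 / 3 * z))"
      unfolding char_geometric_bernoulli[OF q] exp_diff ..
    also have "\<dots> = (of_real p + of_real r * iexp (c powi (- int k) * z)) / (1 - of_real q * iexp z)"
    proof -
      have "exp (log_exponent q z) / exp (log_exponent (- q) (1 / 3 * z)) =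
          (1 - of_real q) / (1 + of_real q) * (1 + of_real q * iexp (1 / 3 * z)) / (1 - of_real q * iexp z)"
      proof -
        have 1: "exp (log_exponent q z) = (1 - of_real q) / (1 - of_real q * iexp z)"
          by (rule exp_log_exponent) (use q in simp)
        have "exp (log_exponent (- q) y) = (1 - of_real (- q)) / (1 - of_real (- q) * iexp y)" for y
          by (rule exp_log_exponent) (use q in simp)
        then have 2: "exp (log_exponent (- q) y) = (1 + of_real q) / (1 + of_real q * iexp y)" for y by simp
        have alg: "(A / B) / (C / D) = A / C * D / B" for A B C D :: complex
          by (simp add: divide_inverse mult_ac)
        show ?thesis unfolding 1 2 alg ..
      qed
      moreover have "(1 - of_real q) / (1 + of_real q) * (1 + of_real q * iexp (1 / 3 * z)) = of_real p + of_real r * iexp (1 / 3 * z)"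
        by (simp add: p_def q_def r_def field_simps)
      ultimately show ?thesis unfolding a by (simp only:)
    qed
    finally show "char (geometric_bernoulli q (1 / 3)) z = \<dots>" .
  qed (use c in simp)
  then have rho: "rho (int k) c p q r \<in> ID0" using geometric_bernoulli_ID0[OF q] by simp
  obtain m where m: "subordinator_exponent (mu_exponent k (1 / c) q) m"
    using subordinator_exponent_mu[OF b less_imp_le[OF q(1)] q(2)] by blast
  \<comment> \<open>The member of the semigroup at \<open>s = 1\<close>; its mean bound provides the
    Lipschitz condition of \<open>mu_eqI\<close>.\<close>
  then obtain \<sigma> where \<sigma>: "real_distribution \<sigma>" "AE x in \<sigma>. 0 \<le> x" "(\<integral>\<^sup>+x. ennreal x \<partial>\<sigma>) \<le> ennreal m"
      "\<And>z. char \<sigma> z = exp (mu_exponent k (1 / c) q z)" and m0: "0 \<le> m"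
    unfolding subordinator_exponent_def by (metis mult_1 of_real_1 zero_le_one)
  have "mu (int k) c p q r = \<sigma>"
  proof (rule mu_eqI[OF c pqr \<sigma>(1) norm_char_minus_one_le[OF \<sigma>(1-3) m0]])
    fix z
    have "(1 - of_real q * iexp z) * (1 + of_real q) * char \<sigma> z =
        (1 - of_real q) * (1 + of_real q * iexp (1 / 3 * z)) * char \<sigma> (z / c)"
      using exp_mu_exponent_rec[OF b less_imp_le[OF q(1)] q(2), of z k] unfolding \<sigma>(4) bk by simp
    \<comment> \<open>Uses \<open>1 - q = (1 + q) * p\<close> and
      \<open>(1 - q) * q = (1 + q) * r\<close>, so that \<open>1 + q\<close> cancels.\<close>
    moreover have "(1 - of_real q) * (1 + of_real q * e) = (1 + of_real q) * (of_real p + of_real r * e)" for e :: complex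
      by (simp add: p_def q_def r_def algebra_simps)
    ultimately have "(1 + of_real q) * ((1 - of_real q * iexp z) * char \<sigma> z) =
        (1 + of_real q) * ((of_real p + of_real r * iexp (1 / 3 * z)) * char \<sigma> (z / c))"
      by (simp only: mult_ac)
    moreover have "1 + complex_of_real q \<noteq> 0" by (simp add: q_def)
    ultimately show "(of_real p + of_real r * iexp (c powi (- int k) * z)) * char \<sigma> (z / c) = (1 - of_real q * iexp z) * char \<sigma> z"
      unfolding a by (simp only: mult_cancel_left) simp
  qed
  then have mu: "mu (int k) c p q r \<in> ID"
    using ID_subordinator[OF m \<sigma>(1,4)] by simp
  show ?thesis using c pqr mu rho by (intro exI[of _ c] exI[of _ p] exI[of _ q] exI[of _ r]) simp
qed

end
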